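(* Let $\lambda>0$, $p>0$, $\tau\in\mathbb{R}$, $-1\le\delta<p-1$ and $a\in\mathcal{A}^{\tau}_{\delta}(\mathbb{R})$. All double signs $\pm$ are in the same order. (i) For any $N\in\mathbb{N}$ with $N\ge p+1$, $$\tilde I_{p,1}^{\pm}[a](\lambda):=Os\text{-}\int_0^\infty e^{\pm i\lambda x^p}a(x)\,dx=\sum_{k=0}^{N-[p]-1}\tilde I_{p,k+1}^{\pm}\frac{a^{(k)}(0)}{k!}\lambda^{-\frac{k+1}{p}}+R_N^{\pm}(\lambda),$$ where $$R_N^{\pm}(\lambda):=\sum_{k=N-[p]}^{N-1}\tilde I_{p,k+1}^{\pm}\frac{a^{(k)}(0)}{k!}\lambda^{-\frac{k+1}{p}}+\frac{1}{N!}\,Os\text{-}\int_0^\infty e^{\pm i\lambda x^p}x^N a^{(N)}(\theta x)\,dx,\qquad 0<\theta<1,$$ and there exists a positive constant $C_N$ such that for any $\lambda\ge1$, $$|R_N^{\pm}(\lambda)|\le C_N\Big(\max_{k<N}|a^{(k)}(0)|+|a|^{(\tau)}_{N+l_0+l_{p,N+1}}\Big)\lambda^{-\frac{N-p+1}{p}},$$ where $l_0:=[(N+1)/p)$ and $l_{p,N+1}:=\left[(N+1+\tau)^+/(p-1-\delta)\right]+1$. (ii) If $p=m\in\mathbb{N}$, then for any $N\in\mathbb{N}$ with $N>m$, $$\tilde J_m^{\pm}[a](\lambda):=Os\text{-}\int_{-\infty}^\infty e^{\pm i\lambda x^m}a(x)\,dx=\sum_{k=0}^{N-m-1}\tilde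 c_k^{\pm}\frac{a^{(k)}(0)}{k!}\lambda^{-\frac{k+1}{m}}+\tilde R_N^{\pm}(\lambda),$$ where $$\tilde R_N^{\pm}(\lambda):=\sum_{k=N-m}^{N-1}\tilde c_k^{\pm}\frac{a^{(k)}(0)}{k!}\lambda^{-\frac{k+1}{m}}+\frac{1}{N!}\,Os\text{-}\int_{-\infty}^\infty e^{\pm i\lambda x^m}x^N a^{(N)}(\theta x)\,dx,\qquad 0<\theta<1,$$ $$\tilde c_k^{\pm}:=m^{-1}\left\{e^{\pm i\frac{\pi}{2}\frac{k+1}{m}}+(-1)^k e^{\pm(-1)^m i\frac{\pi}{2}\frac{k+1}{m}}\right\}\Gamma\!\left(\frac{k+1}{m}\right),$$ and there exists a positive constant $\tilde C_N$ such that for any $\lambda\ge1$, $$|\tilde R_N^{\pm}(\lambda)|\le\tilde C_N\Big(\max_{k<N}|a^{(k)}(0)|+|a|^{(\tau)}_{N+l_0+l_{m,N+1}}\Big)\lambda^{-\frac{N-m+1}{m}},$$ where $l_0:=[(N+1)/m)$ and $l_{m,N+1}:=\left[(N+1+\tau)^+/(m-1-\delta)\right]+1$.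
   Context: $\mathbb{N}=\{1,2,\dots\}$. $[x]$ is the integer with $x-1<[x]\le x$; $[x)$ is the greatest integer strictly smaller than $x$ (so $x-1\le[x)<x$); $t^+:=\max\{t,0\}$; $\langle x\rangle:=(1+|x|^2)^{1/2}$. Empty sums are $0$. Amplitude class: for $p>0$, $\tau\in\mathbb{R}$, $-1\le\delta<p-1$, a complex-valued $a\in C^\infty(\mathbb{R})$ belongs to $\mathcal{A}^\tau_\delta(\mathbb{R})$ if for each $k\in\mathbb{Z}_{\ge0}$ there is $C_k>0$ with $|a^{(k)}(x)|\le C_k\langle x\rangle^{\tau+\delta k}$ for all $x\in\mathbb{R}$. For $l\in\mathbb{Z}_{\ge0}$, $|a|^{(\tau)}_l:=\max_{k=0,\dots,l}\sup_{x\in\mathbb{R}}\langle x\rangle^{-\tau-\delta k}|a^{(k)}(x)|$. Oscillatory integrals: for $J=(0,\infty)$ or $J=\mathbb{R}$, $Os\text{-}\int_J e^{\pm i\lambda x^p}b(x)\,dx:=\lim_{\varepsilon\to+0}\int_J e^{\pm i\lambda x^p}b(x)\chi(\varepsilon x)\,dx$, where $\chi\in\mathcal{S}(\mathbb{R})$ (Schwartz space), $\chi(0)=1$, $0<\varepsilon<1$; existence means that the limit exists and is independent of $\chi$ (existence of the oscillatory integrals written is part of the claim). Generalized Fresnel integrals: for $p,q>0$, $\tilde I_{p,q}^{\pm}:=Os\text{-}\int_0^\infty e^{\pm ix^p}x^{q-1}dx=p^{-1}e^{\pm i\frac{\pi}{2}\frac{q}{p}}\Gamma(q/p)$. The expression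 $\frac{x^N}{N!}a^{(N)}(\theta x)$ with $0<\theta<1$ is the notation for the order-$N$ Taylor remainder of $a$ at $0$ (with $\theta$ depending on $x$), i.e. for $a(x)-\sum_{k=0}^{N-1}\frac{a^{(k)}(0)}{k!}x^k$. *)

theory Defs
  imports "HOL-Analysis.Analysis"
begin

definition nderiv :: "nat \<Rightarrow> (real \<Rightarrow> complex) \<Rightarrow> real \<Rightarrow> complex" where
  "nderiv k f = ((\<lambda>g x. vector_derivative g (at x)) ^^ k) f"

definition smooth :: "(real \<Rightarrow> complex) \<Rightarrow> bool" where
  "smooth f \<longleftrightarrow> (\<forall>k x. nderiv k f differentiable (at x))"

definition schwartz :: "(real \<Rightarrow> complex) \<Rightarrow> bool" where
  "schwartz f \<longleftrightarrow> smooth f \<and> (\<forall>j k. \<exists>C. \<forall>x. \<bar>x\<bar> ^ j * cmod (nderiv k f x) \<le> C)"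

definition japanese :: "real \<Rightarrow> real" where
  "japanese x = (1 + \<bar>x\<bar>\<^sup>2) powr (1/2)"

definition amplitude :: "real \<Rightarrow> real \<Rightarrow> (real \<Rightarrow> complex) set" where
  "amplitude \<tau> \<delta> = {a. smooth a \<and>
     (\<forall>k. \<exists>C>0. \<forall>x. cmod (nderiv k a x) \<le> C * japanese x powr (\<tau> + \<delta> * real k))}"

text \<open>For \<open>a \<in> amplitude \<tau> \<delta>\<close> each of the suprema below is over a bounded set of reals.\<close>

definition amp_norm :: "real \<Rightarrow> real \<Rightarrow> nat \<Rightarrow> (real \<Rightarrow> complex) \<Rightarrow> real" where
  "amp_norm \<tau> \<delta> l a =
     Max ((\<lambda>k. SUP x. japanese x powr (- \<tau> - \<delta> * real k) * cmod (nderiv k a x)) ` {..l})"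

text \<open>The greatest integer strictly smaller than \<open>x\<close>, as opposed to \<open>\<lfloor>x\<rfloor>\<close>.\<close>

definition strict_floor :: "real \<Rightarrow> int" where
  "strict_floor x = \<lceil>x\<rceil> - 1"

text \<open>
  Oscillatory integral over \<open>J\<close> with real phase \<open>\<phi>\<close> and integrand \<open>b\<close>. Its existence comprises
  the absolute convergence of all regularised integrals, the existence of the limit for every
  regularising function \<open>h\<close>, and the independence of the limit of \<open>h\<close>. Since \<open>os_integral\<close> is a
  definite description, it is meaningful only together with \<open>os_integrable\<close>.
\<close>

definition has_os_integral ::
  "real set \<Rightarrow> (real \<Rightarrow> real) \<Rightarrow> (real \<Rightarrow> complex) \<Rightarrow> complex \<Rightarrow> bool" where
  "has_os_integral J \<phi> b I \<longleftrightarrow>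
     (\<forall>h. schwartz h \<and> h 0 = 1 \<longrightarrow>
        (\<forall>\<epsilon>. 0 < \<epsilon> \<and> \<epsilon> < 1 \<longrightarrow>
           set_integrable lborel J (\<lambda>x. exp (\<i> * of_real (\<phi> x)) * b x * h (\<epsilon> * x))) \<and>
        ((\<lambda>\<epsilon>. LINT x:J|lborel. exp (\<i> * of_real (\<phi> x)) * b x * h (\<epsilon> * x)) \<longlongrightarrow> I)
          (at_right 0))"

definition os_integrable ::
  "real set \<Rightarrow> (real \<Rightarrow> real) \<Rightarrow> (real \<Rightarrow> complex) \<Rightarrow> bool" where
  "os_integrable J \<phi> b \<longleftrightarrow> (\<exists>I. has_os_integral J \<phi> b I)"

definition os_integral ::
  "real set \<Rightarrow> (real \<Rightarrow> real) \<Rightarrow> (real \<Rightarrow> complex) \<Rightarrow> complex" where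
  "os_integral J \<phi> b = (THE I. has_os_integral J \<phi> b I)"

text \<open>
  The generalized Fresnel integrals. Here and below the parameter \<open>s\<close>, which is \<open>1\<close> or \<open>-1\<close>,
  represents the double sign.
\<close>

definition fresnel :: "real \<Rightarrow> real \<Rightarrow> real \<Rightarrow> complex" where
  "fresnel s p q = os_integral {0<..} (\<lambda>x. s * x powr p) (\<lambda>x. of_real (x powr (q - 1)))"

definition fresnel_exists :: "real \<Rightarrow> real \<Rightarrow> real \<Rightarrow> bool" where
  "fresnel_exists s p q \<longleftrightarrow>
     os_integrable {0<..} (\<lambda>x. s * x powr p) (\<lambda>x. of_real (x powr (q - 1)))"

text \<open>
  The order-\<open>N\<close> Taylor remainder at \<open>0\<close>, traditionally written
  \<open>x^N / N! * a^(N) (\<theta> x)\<close> with \<open>0 < \<theta> < 1\<close>. The mean value form is only notation,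
  since it is not literally available for complex-valued functions. The factor \<open>1 / N!\<close> is included.
\<close>

definition taylor_rem :: "nat \<Rightarrow> (real \<Rightarrow> complex) \<Rightarrow> real \<Rightarrow> complex" where
  "taylor_rem N a x = a x - (\<Sum>k<N. nderiv k a 0 / fact k * of_real (x ^ k))"

definition half_line_term :: "real \<Rightarrow> real \<Rightarrow> (real \<Rightarrow> complex) \<Rightarrow> real \<Rightarrow> nat \<Rightarrow> complex" where
  "half_line_term s p a lam k =
     fresnel s p (real k + 1) * (nderiv k a 0 / fact k) * of_real (lam powr (- (real k + 1) / p))"

definition half_line_rem :: "real \<Rightarrow> real \<Rightarrow> nat \<Rightarrow> (real \<Rightarrow> complex) \<Rightarrow> real \<Rightarrow> complex" where
  "half_line_rem s p N a lam =
     (\<Sum>k\<in>{N - nat \<lfloor>p\<rfloor>..<N}. half_line_term s p a lam k)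
     + os_integral {0<..} (\<lambda>x. s * lam * x powr p) (taylor_rem N a)"

definition line_coeff :: "real \<Rightarrow> nat \<Rightarrow> nat \<Rightarrow> complex" where
  "line_coeff s m k =
     inverse (of_nat m)
     * (exp (of_real s * \<i> * of_real (pi / 2 * ((real k + 1) / real m)))
        + (-1) ^ k * exp (of_real s * (-1) ^ m * \<i> * of_real (pi / 2 * ((real k + 1) / real m))))
     * of_real (Gamma ((real k + 1) / real m))"

definition line_term :: "real \<Rightarrow> nat \<Rightarrow> (real \<Rightarrow> complex) \<Rightarrow> real \<Rightarrow> nat \<Rightarrow> complex" where
  "line_term s m a lam k =
     line_coeff s m k * (nderiv k a 0 / fact k) * of_real (lam powr (- (real k + 1) / real m))"

definition line_rem :: "real \<Rightarrow> nat \<Rightarrow> nat \<Rightarrow> (real \<Rightarrow> complex) \<Rightarrow> real \<Rightarrow> complex" where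
  "line_rem s m N a lam =
     (\<Sum>k\<in>{N - m..<N}. line_term s m a lam k)
     + os_integral UNIV (\<lambda>x. s * lam * x ^ m) (taylor_rem N a)"

text \<open>
  The order \<open>N + l\<^sub>0 + l\<close> of the seminorm. Both integers converted by \<open>nat\<close> are nonnegative
  whenever \<open>p > 0\<close> and \<open>\<delta> < p - 1\<close>.
\<close>

definition norm_order :: "real \<Rightarrow> real \<Rightarrow> real \<Rightarrow> nat \<Rightarrow> nat" where
  "norm_order p \<tau> \<delta> N =
     N + nat (strict_floor ((real N + 1) / p))
       + nat (\<lfloor>max (real N + 1 + \<tau>) 0 / (p - 1 - \<delta>)\<rfloor> + 1)"

definition bound_norm :: "real \<Rightarrow> real \<Rightarrow> real \<Rightarrow> nat \<Rightarrow> (real \<Rightarrow> complex) \<Rightarrow> real" where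
  "bound_norm p \<tau> \<delta> N a =
     Max ((\<lambda>k. cmod (nderiv k a 0)) ` {..<N}) + amp_norm \<tau> \<delta> (norm_order p \<tau> \<delta> N) a"

end

theory Submission
  imports Defs
begin

text \<open>
  Since \<open>exp (\<beta> * x powr p) = (\<beta> * p * x powr (p - 1))\<inverse> * d/dx (exp (\<beta> * x powr p))\<close>, an integration by
  parts replaces an amplitude \<open>b\<close> by \<open>- (\<beta> * p)\<inverse> * x powr (- p) * (x d/dx + 1 - p) b\<close>. Near \<open>0\<close> this costs a
  factor \<open>x powr (- p)\<close>, at infinity it gains \<open>x powr (\<delta> + 1 - p)\<close>, so sufficiently many integrations by parts on
  \<open>(1, \<infinity>)\<close> make the oscillatory integral absolutely convergent. The Taylor remainder vanishes to order
  \<open>N\<close> at \<open>0\<close>, which permits \<open>l\<^sub>0\<close> integrations by parts on all of \<open>(0, \<infinity>)\<close>; they yield the factor \<open>\<lambda> powr (- l\<^sub>0)\<close>, and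
  \<open>l\<^sub>0 \<ge> (N + 1) / p - 1\<close>. The monomials give Fresnel integrals, which are evaluated with the regularizing
  function \<open>exp (- (y powr p))\<close>. The integral over the line is the sum of the half-line integrals of \<open>a x\<close>
  and \<open>a (- x)\<close>, with phases \<open>\<plusminus> \<lambda> * x ^ m\<close> and \<open>\<plusminus> (-1) ^ m * \<lambda> * x ^ m\<close>.
\<close>

section \<open>Convergence of integrals on the half line\<close>

text \<open>Both summands of the seminorm order are thresholds. After n integrations by parts the
  remainder is of size x^(N - p n) near 0. This is integrable if n < (N + 1) / p, whereas equality
  would leave x^(-1); hence the greatest integer strictly below. At infinity the amplitude needs
  \<tau> + (\<delta> + 1 - p) j < -1 after j steps in all, which l further steps with l > (N + 1 +
  \<tau>) / (p - 1 - \<delta>) guarantee.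

  The obstacle is the Taylor polynomial inside the remainder: it grows like x^(N - 1) whatever
  \<tau> is. Absorbing it into \<tau> could demand more integrations by parts than the seminorm
  order allows. Sizes at infinity are therefore recorded by two exponents, which drop by p - 1 -
  \<delta> and by p in each step.

  The constant in the theorem precedes the amplitude, \<lambda> and the sign. Hence the estimates
  carry a bound M on the symbol, linear in the seminorm, and a factor that is chosen before \<beta>,
  b and M.\<close>

lemma set_dominated_convergence_within:
  fixes f :: "'a \<Rightarrow> complex" and s :: "real \<Rightarrow> 'a \<Rightarrow> complex"
  assumes w: "set_integrable M A w"
    and meas: "\<And>t. t \<in> T - {t0} \<Longrightarrow> set_borel_measurable M A (s t)"
    and measf: "set_borel_measurable M A f"
    and lim: "\<And>x. x \<in> A \<Longrightarrow> ((\<lambda>t. s t x) \<longlongrightarrow> f x) (at t0 within T)"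
    and bound: "\<And>t x. t \<in> T - {t0} \<Longrightarrow> x \<in> A \<Longrightarrow> norm (s t x) \<le> w x"
  shows "((\<lambda>t. LINT x:A|M. s t x) \<longlongrightarrow> (LINT x:A|M. f x)) (at t0 within T)"
  unfolding tendsto_at_iff_sequentially
proof (intro allI impI)
  fix X :: "nat \<Rightarrow> real"
  assume X: "\<forall>i. X i \<in> T - {t0}" "X \<longlonglongrightarrow> t0"
  \<comment> \<open>Dominated convergence is sequential, so the limit is tested on sequences
    avoiding \<open>t0\<close>; the hypotheses are accordingly made off \<open>t0\<close>. This
    serves both \<epsilon> tending to 0 from the right and difference quotients.\<close>
  show "((\<lambda>t. LINT x:A|M. s t x) \<circ> X) \<longlonglongrightarrow> (LINT x:A|M. f x)"
    unfolding set_lebesgue_integral_def comp_def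
  proof (rule integral_dominated_convergence[where w = "\<lambda>x. indicator A x *\<^sub>R w x"])
    show "AE x in M. (\<lambda>i. indicat_real A x *\<^sub>R s (X i) x) \<longlonglongrightarrow> indicat_real A x *\<^sub>R f x"
    proof (rule AE_I2)
      fix x
      show "(\<lambda>i. indicat_real A x *\<^sub>R s (X i) x) \<longlonglongrightarrow> indicat_real A x *\<^sub>R f x"
        using lim[of x] X unfolding tendsto_at_iff_sequentially
        by (cases "x \<in> A") (auto simp: comp_def)
    qed
  qed (use w meas measf bound X in \<open>auto simp: set_integrable_def set_borel_measurable_def indicator_def\<close>)
qed

lemma set_borel_measurable_continuous_on:
  fixes f :: "real \<Rightarrow> 'a::real_normed_vector"
  assumes "continuous_on A f" "A \<in> sets borel"
  shows "set_borel_measurable lborel A f"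
  using borel_measurable_continuous_on_indicator[OF assms(2,1)]
  by (simp add: set_borel_measurable_def)

lemma set_integrable_continuous_bound:
  fixes f :: "real \<Rightarrow> complex" and w :: "real \<Rightarrow> real"
  assumes "set_integrable lborel A w" "continuous_on A f" "A \<in> sets borel"
    and "\<And>x. x \<in> A \<Longrightarrow> norm (f x) \<le> w x"
  shows "set_integrable lborel A f"
  by (rule set_integrable_bound[OF assms(1) set_borel_measurable_continuous_on[OF assms(2,3)]])
     (use assms(4) in \<open>force intro!: AE_I2\<close>)

text \<open>For nonnegative functions gauge integrability is absolute. Continuity supplies the Borel
  measurability that the passage from the completed measure to \<open>lborel\<close>
  requires.\<close>

lemma set_integrable_lborel_nonneg:
  fixes f :: "real \<Rightarrow> real"
  assumes "f integrable_on A" "continuous_on A f" "A \<in> sets borel" "\<And>x. x \<in> A \<Longrightarrow> 0 \<le> f x"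
  shows "set_integrable lborel A f"
proof -
  have "f absolutely_integrable_on A"
    by (rule nonnegative_absolutely_integrable_1) (use assms in auto)
  thus ?thesis
    using borel_measurable_continuous_on_indicator[OF assms(3,2)]
    unfolding set_integrable_def by (subst (asm) integrable_completion) auto
qed

lemma set_integrable_powr_near_0:
  assumes "\<nu> > -1"
  shows "set_integrable lborel {0<..1} (\<lambda>x::real. x powr \<nu>)"
  by (rule set_integrable_lborel_nonneg)
     (auto intro!: integrable_on_powr_from_0' continuous_intros assms)

lemma set_integrable_powr_at_top:
  assumes "\<mu> < -1"
  shows "set_integrable lborel {1<..} (\<lambda>x::real. x powr \<mu>)"
proof (rule set_integrable_subset)
  show "set_integrable lborel {1..} (\<lambda>x::real. x powr \<mu>)"
    using has_integral_powr_to_inf[OF assms, of 1]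
    by (intro set_integrable_lborel_nonneg) (auto intro!: continuous_intros)
qed auto

text \<open>Both boundary values are limits, so that primitives containing powers of x with negative
  exponent can be used on the ray starting at 0.\<close>

lemma integral_FTC_ray:
  fixes f F :: "real \<Rightarrow> complex"
  assumes "\<And>x. x > a \<Longrightarrow> (F has_vector_derivative f x) (at x)"
    and "continuous_on {a<..} f" and "set_integrable lborel {a<..} f"
    and "(F \<longlongrightarrow> A) (at_right a)" and "(F \<longlongrightarrow> B) at_top"
  shows "(LINT x:{a<..}|lborel. f x) = B - A"
proof -
  have "(LBINT x=ereal a..\<infinity>. f x) = B - A"
    using assms continuous_on_eq_continuous_at[of "{a<..}" f]
    by (intro interval_integral_FTC_integrable[of _ _ F])
       (auto simp: ereal_tendsto_simps einterval_eq)
  thus ?thesis by (simp add: interval_lebesgue_integral_def einterval_eq)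
qed

section \<open>Symbols of the Euler operator\<close>

definition weight :: "real \<Rightarrow> real \<Rightarrow> real \<Rightarrow> real \<Rightarrow> real" where
  "weight \<nu> \<mu> \<eta> x = (if x \<le> 1 then x powr \<nu> else x powr \<mu> + x powr \<eta>)"

text \<open>
  Derivatives are taken with respect to the Euler operator \<open>x d/dx\<close>: below, \<open>b'\<close> is \<open>x\<close> times the
  derivative of \<open>b\<close>. Each of the at most \<open>K\<close> Euler derivatives costs a factor \<open>x powr \<sigma>\<close> in the first term of the
  weight at infinity, with \<open>\<sigma> = \<delta> + 1\<close> for amplitudes; the second term, which accounts for the
  Taylor polynomial, and the weight at \<open>0\<close> stay the same.
\<close>

primrec symb :: "real \<Rightarrow> nat \<Rightarrow> real \<Rightarrow> real \<Rightarrow> real \<Rightarrow> real \<Rightarrow> (real \<Rightarrow> complex) \<Rightarrow> bool" where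
  "symb \<sigma> 0 \<nu> \<mu> \<eta> M b \<longleftrightarrow>
     continuous_on {0<..} b \<and> (\<forall>x>0. cmod (b x) \<le> M * weight \<nu> \<mu> \<eta> x)"
| "symb \<sigma> (Suc K) \<nu> \<mu> \<eta> M b \<longleftrightarrow>
     continuous_on {0<..} b \<and> (\<forall>x>0. cmod (b x) \<le> M * weight \<nu> \<mu> \<eta> x) \<and>
     (\<exists>b'. (\<forall>x>0. (b has_vector_derivative b' x / of_real x) (at x)) \<and>
        symb \<sigma> K \<nu> (\<mu> + \<sigma>) \<eta> M b')"

lemma weight_nonneg: "0 \<le> weight \<nu> \<mu> \<eta> x"
  by (simp add: weight_def)

lemma weight_mono: "x > 0 \<Longrightarrow> \<mu> \<le> \<mu>' \<Longrightarrow> weight \<nu> \<mu> \<eta> x \<le> weight \<nu> \<mu>' \<eta> x"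
  by (simp add: weight_def powr_mono)

lemma weight_powr:
  "x > 0 \<Longrightarrow> x powr \<alpha> * weight \<nu> \<mu> \<eta> x = weight (\<nu> + \<alpha>) (\<mu> + \<alpha>) (\<eta> + \<alpha>) x"
  by (simp add: weight_def powr_add algebra_simps)

lemma symb_continuous: "symb \<sigma> K \<nu> \<mu> \<eta> M b \<Longrightarrow> continuous_on {0<..} b"
  and symb_bound: "symb \<sigma> K \<nu> \<mu> \<eta> M b \<Longrightarrow> x > 0 \<Longrightarrow> cmod (b x) \<le> M * weight \<nu> \<mu> \<eta> x"
  by (cases K; simp)+

text \<open>The weight is 1 at x = 1, whatever the exponents.\<close>

lemma symb_nonneg: "symb \<sigma> K \<nu> \<mu> \<eta> M b \<Longrightarrow> 0 \<le> M"
  using symb_bound[of \<sigma> K \<nu> \<mu> \<eta> M b 1] norm_ge_zero[of "b 1"]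
  by (simp add: weight_def del: norm_ge_zero)

lemma symb_Suc_D: "symb \<sigma> (Suc K) \<nu> \<mu> \<eta> M b \<Longrightarrow> symb \<sigma> K \<nu> \<mu> \<eta> M b"
proof (induction K arbitrary: \<mu> b)
  case (Suc K)
  then obtain b' where "\<forall>x>0. (b has_vector_derivative b' x / of_real x) (at x)"
    "symb \<sigma> (Suc K) \<nu> (\<mu> + \<sigma>) \<eta> M b'" by auto
  with Suc.IH[of "\<mu> + \<sigma>" b'] Suc.prems show ?case by auto
qed simp

lemma symb_le: "symb \<sigma> K \<nu> \<mu> \<eta> M b \<Longrightarrow> k \<le> K \<Longrightarrow> symb \<sigma> k \<nu> \<mu> \<eta> M b"
proof (induction K)
  case (Suc K)
  thus ?case using symb_Suc_D by (cases "k = Suc K") auto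
qed simp

lemma symb_weaken:
  "symb \<sigma> K \<nu> \<mu> \<eta> M b \<Longrightarrow> \<mu> \<le> \<mu>' \<Longrightarrow> M \<le> M' \<Longrightarrow> symb \<sigma> K \<nu> \<mu>' \<eta> M' b"
proof (induction K arbitrary: \<mu> \<mu>' b)
  case 0
  have "M * weight \<nu> \<mu> \<eta> x \<le> M' * weight \<nu> \<mu>' \<eta> x" if "x > 0" for x
    using 0 that symb_nonneg[OF 0(1)] by (intro mult_mono weight_mono weight_nonneg) auto
  with 0 show ?case by (force intro: order_trans)
next
  case (Suc K)
  have "M * weight \<nu> \<mu> \<eta> x \<le> M' * weight \<nu> \<mu>' \<eta> x" if "x > 0" for x
    using Suc.prems that symb_nonneg[OF Suc.prems(1)]
    by (intro mult_mono weight_mono weight_nonneg) auto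
  moreover obtain b' where "\<forall>x>0. (b has_vector_derivative b' x / of_real x) (at x)"
    "symb \<sigma> K \<nu> (\<mu> + \<sigma>) \<eta> M b'" using Suc.prems by auto
  moreover have "symb \<sigma> K \<nu> (\<mu>' + \<sigma>) \<eta> M' b'"
    by (rule Suc.IH[OF calculation(3)]) (use Suc.prems in auto)
  ultimately show ?case using Suc.prems by (force intro: order_trans)
qed

lemma symb_add:
  "symb \<sigma> K \<nu> \<mu> \<eta> M b \<Longrightarrow> symb \<sigma> K \<nu> \<mu> \<eta> M' c \<Longrightarrow> symb \<sigma> K \<nu> \<mu> \<eta> (M + M') (\<lambda>x. b x + c x)"
proof (induction K arbitrary: \<mu> b c)
  case 0
  thus ?case
    by (auto simp: distrib_right intro!: continuous_intros norm_triangle_le add_mono)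
next
  case (Suc K)
  from Suc.prems obtain b' c' where
      "\<forall>x>0. (b has_vector_derivative b' x / of_real x) (at x)" "symb \<sigma> K \<nu> (\<mu> + \<sigma>) \<eta> M b'"
      "\<forall>x>0. (c has_vector_derivative c' x / of_real x) (at x)" "symb \<sigma> K \<nu> (\<mu> + \<sigma>) \<eta> M' c'"
    by auto
  with Suc.prems Suc.IH[of "\<mu> + \<sigma>" b' c'] show ?case
    by (auto simp: distrib_right add_divide_distrib
        intro!: continuous_intros norm_triangle_le add_mono exI[of _ "\<lambda>x. b' x + c' x"]
          has_vector_derivative_add)
qed

lemma symb_cmult:
  "symb \<sigma> K \<nu> \<mu> \<eta> M b \<Longrightarrow> symb \<sigma> K \<nu> \<mu> \<eta> (cmod z * M) (\<lambda>x. z * b x)"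
proof (induction K arbitrary: \<mu> b)
  case 0
  thus ?case
    by (auto simp: norm_mult mult.assoc intro!: continuous_intros mult_left_mono)
next
  case (Suc K)
  from Suc.prems obtain b' where
      "\<forall>x>0. (b has_vector_derivative b' x / of_real x) (at x)" "symb \<sigma> K \<nu> (\<mu> + \<sigma>) \<eta> M b'"
    by auto
  with Suc.prems Suc.IH[of "\<mu> + \<sigma>" b'] show ?case
    by (auto simp: norm_mult mult.assoc simp flip: times_divide_eq_right
        intro!: continuous_intros mult_left_mono exI[of _ "\<lambda>x. z * b' x"]
          has_vector_derivative_mult_right)
qed

lemma has_vector_derivative_powr:
  "x > 0 \<Longrightarrow> ((\<lambda>x. complex_of_real (x powr \<alpha>)) has_vector_derivative of_real (\<alpha> * x powr \<alpha>) / of_real x) (at x)"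
  using has_vector_derivative_of_real[OF has_real_derivative_powr[of x \<alpha>], where 'a = complex]
  by (simp add: powr_diff)

text \<open>Since x d/dx (x^\<alpha> b) = x^\<alpha> (b' + \<alpha> b), every Euler derivative costs
  a factor 1 + |\<alpha>|. For the term \<alpha> b the condition \<sigma> \<ge> 0 is used: b is then
  also a symbol with the larger exponent \<mu> + \<sigma> that belongs to b'.\<close>

lemma symb_powr_mult:
  assumes "\<sigma> \<ge> 0"
  shows "symb \<sigma> K \<nu> \<mu> \<eta> M b \<Longrightarrow>
    symb \<sigma> K (\<nu> + \<alpha>) (\<mu> + \<alpha>) (\<eta> + \<alpha>) ((1 + \<bar>\<alpha>\<bar>) ^ K * M) (\<lambda>x. of_real (x powr \<alpha>) * b x)"
proof (induction K arbitrary: \<mu> b M)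
  case 0
  thus ?case
    by (auto simp: norm_mult mult.left_commute[of M] simp flip: weight_powr
        intro!: continuous_intros mult_left_mono)
next
  case (Suc K)
  have M: "0 \<le> M" using Suc.prems by (rule symb_nonneg)
  from Suc.prems obtain b' where
      b': "\<forall>x>0. (b has_vector_derivative b' x / of_real x) (at x)" "symb \<sigma> K \<nu> (\<mu> + \<sigma>) \<eta> M b'"
    by auto
  have "symb \<sigma> K \<nu> (\<mu> + \<sigma>) \<eta> M b"
    by (rule symb_weaken[OF symb_Suc_D[OF Suc.prems]]) (use assms in auto)
  from symb_add[OF b'(2) symb_cmult[OF this, of "of_real \<alpha>"]]
  have *: "symb \<sigma> K \<nu> (\<mu> + \<sigma>) \<eta> ((1 + \<bar>\<alpha>\<bar>) * M) (\<lambda>x. b' x + of_real \<alpha> * b x)"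
    by (simp add: algebra_simps)
  have "symb \<sigma> K (\<nu> + \<alpha>) (\<mu> + \<alpha> + \<sigma>) (\<eta> + \<alpha>) ((1 + \<bar>\<alpha>\<bar>) ^ Suc K * M)
      (\<lambda>x. of_real (x powr \<alpha>) * (b' x + of_real \<alpha> * b x))"
    using Suc.IH[OF *] by (simp add: algebra_simps)
  moreover have "((\<lambda>x. of_real (x powr \<alpha>) * b x) has_vector_derivative
       (of_real (x powr \<alpha>) * (b' x + of_real \<alpha> * b x)) / of_real x) (at x)" if "x > 0" for x
    by (rule has_vector_derivative_eq_rhs,
        rule has_vector_derivative_mult[OF has_vector_derivative_powr[OF that] b'(1)[rule_format, OF that]])
       (use that in \<open>simp add: divide_simps\<close>, simp add: algebra_simps)
  moreover have "cmod (of_real (x powr \<alpha>) * b x)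
      \<le> (1 + \<bar>\<alpha>\<bar>) ^ Suc K * M * weight (\<nu> + \<alpha>) (\<mu> + \<alpha>) (\<eta> + \<alpha>) x" if "x > 0" for x
  proof -
    have "cmod (of_real (x powr \<alpha>) * b x) \<le> x powr \<alpha> * (M * weight \<nu> \<mu> \<eta> x)"
      using symb_bound[OF Suc.prems that] by (simp add: norm_mult mult_left_mono)
    also have "\<dots> = 1 * M * weight (\<nu> + \<alpha>) (\<mu> + \<alpha>) (\<eta> + \<alpha>) x"
      using weight_powr[OF that, of \<alpha> \<nu> \<mu> \<eta>] by (simp add: mult.left_commute)
    also have "\<dots> \<le> (1 + \<bar>\<alpha>\<bar>) ^ Suc K * M * weight (\<nu> + \<alpha>) (\<mu> + \<alpha>) (\<eta> + \<alpha>) x"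
      using M by (intro mult_right_mono weight_nonneg one_le_power) auto
    finally show ?thesis .
  qed
  moreover have "continuous_on {0<..} (\<lambda>x. of_real (x powr \<alpha>) * b x)"
    using symb_continuous[OF Suc.prems] by (auto intro!: continuous_intros)
  ultimately show ?case unfolding symb.simps
    by (intro conjI exI[of _ "\<lambda>x. of_real (x powr \<alpha>) * (b' x + of_real \<alpha> * b x)"]) auto
qed

section \<open>Regularizing functions\<close>

definition rapid :: "(real \<Rightarrow> complex) \<Rightarrow> complex \<Rightarrow> bool" where
  "rapid h L \<longleftrightarrow> continuous_on {0<..} h \<and> (\<forall>j. \<exists>C. \<forall>y>0. y ^ j * cmod (h y) \<le> C) \<and>
     (h \<longlongrightarrow> L) (at_right 0)"

text \<open>
  An Euler derivative commutes with the dilations \<open>x \<mapsto> \<epsilon> * x\<close>, which is why the class is set up in terms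
  of it. Besides Schwartz functions it contains \<open>exp (- (y powr p))\<close>, which for general \<open>p\<close> is not the
  restriction of a Schwartz function but gives explicitly computable Fresnel integrals.
\<close>

primrec reg :: "nat \<Rightarrow> (real \<Rightarrow> complex) \<Rightarrow> complex \<Rightarrow> bool" where
  "reg 0 h L \<longleftrightarrow> rapid h L"
| "reg (Suc K) h L \<longleftrightarrow> rapid h L \<and>
     (\<exists>g. (\<forall>y>0. (h has_vector_derivative g y / of_real y) (at y)) \<and> reg K g 0)"

lemma reg_rapid: "reg K h L \<Longrightarrow> rapid h L"
  by (cases K) auto

lemma reg_le: "reg K h L \<Longrightarrow> k \<le> K \<Longrightarrow> reg k h L"
proof (induction k arbitrary: K h L)
  case (Suc k)
  then obtain K' where "K = Suc K'" by (cases K) auto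
  with Suc show ?case by auto
qed (use reg_rapid in auto)

lemma rapid_lincomb:
  assumes "rapid f A" "rapid g B"
  shows "rapid (\<lambda>y. c * f y + d * g y) (c * A + d * B)"
proof -
  have "\<exists>C. \<forall>y>0. y ^ j * cmod (c * f y + d * g y) \<le> C" for j
  proof -
    from assms obtain C D where CD: "\<forall>y>0. y ^ j * cmod (f y) \<le> C" "\<forall>y>0. y ^ j * cmod (g y) \<le> D"
      by (meson rapid_def)
    have "y ^ j * cmod (c * f y + d * g y) \<le> cmod c * C + cmod d * D" if "y > 0" for y
    proof -
      have "y ^ j * cmod (c * f y + d * g y) \<le> y ^ j * (cmod c * cmod (f y) + cmod d * cmod (g y))"
        using that by (intro mult_left_mono norm_triangle_le) (auto simp: norm_mult)
      also have "\<dots> = cmod c * (y ^ j * cmod (f y)) + cmod d * (y ^ j * cmod (g y))"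
        by (simp add: algebra_simps)
      also have "\<dots> \<le> cmod c * C + cmod d * D"
        using CD that by (intro add_mono mult_left_mono) auto
      finally show ?thesis .
    qed
    thus ?thesis by blast
  qed
  with assms show ?thesis by (auto simp: rapid_def intro!: continuous_intros tendsto_intros)
qed

lemma reg_lincomb:
  "reg K f A \<Longrightarrow> reg K g B \<Longrightarrow> reg K (\<lambda>y. c * f y + d * g y) (c * A + d * B)"
proof (induction K arbitrary: f g A B)
  case 0
  thus ?case by (simp add: rapid_lincomb)
next
  case (Suc K)
  from Suc.prems obtain f' g' where *:
    "\<forall>y>0. (f has_vector_derivative f' y / of_real y) (at y)" "reg K f' 0"
    "\<forall>y>0. (g has_vector_derivative g' y / of_real y) (at y)" "reg K g' 0" by auto
  have "((\<lambda>y. c * f y + d * g y) has_vector_derivative (c * f' y + d * g' y) / of_real y) (at y)"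
    if "y > 0" for y
    using has_vector_derivative_add[OF
        has_vector_derivative_mult_right[OF *(1)[rule_format, OF that], of c]
        has_vector_derivative_mult_right[OF *(3)[rule_format, OF that], of d]]
    by (simp add: add_divide_distrib)
  moreover have "reg K (\<lambda>y. c * f' y + d * g' y) 0"
    using Suc.IH[OF *(2,4)] by simp
  moreover have "rapid (\<lambda>y. c * f y + d * g y) (c * A + d * B)"
    using Suc.prems by (auto intro: rapid_lincomb)
  ultimately show ?case unfolding reg.simps
    by (intro conjI exI[of _ "\<lambda>y. c * f' y + d * g' y"]) auto
qed

section \<open>Regularized oscillatory integrals\<close>

text \<open>
  The limit is asserted for an arbitrary value \<open>L\<close> of the regularizing function at \<open>0\<close>. In an integration
  by parts, the term in which the regularizing function is differentiated thus has limit \<open>0 * I\<close>.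
\<close>

definition osc :: "real set \<Rightarrow> complex \<Rightarrow> real \<Rightarrow> nat \<Rightarrow> (real \<Rightarrow> complex) \<Rightarrow> complex \<Rightarrow> bool" where
  "osc J \<beta> p K b I \<longleftrightarrow>
     (\<forall>G L. reg K G L \<longrightarrow>
        (\<forall>\<epsilon>>0. set_integrable lborel J (\<lambda>x. exp (\<beta> * of_real (x powr p)) * b x * G (\<epsilon> * x))) \<and>
        ((\<lambda>\<epsilon>. LINT x:J|lborel. exp (\<beta> * of_real (x powr p)) * b x * G (\<epsilon> * x)) \<longlongrightarrow> L * I)
          (at_right 0))"

lemma continuous_on_osc:
  fixes b G :: "real \<Rightarrow> complex"
  assumes "continuous_on {0<..} b" "continuous_on {0<..} G" "\<epsilon> > 0"
  shows "continuous_on {0<..} (\<lambda>x. exp (\<beta> * of_real (x powr p)) * b x * G (\<epsilon> * x))"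
proof -
  have "continuous_on {0<..} (G \<circ> (\<lambda>x. \<epsilon> * x))"
    using assms by (intro continuous_on_compose continuous_intros) (auto elim!: continuous_on_subset)
  thus ?thesis
    using assms by (auto simp: o_def intro!: continuous_intros)
qed

text \<open>For fixed \<epsilon> the decay of the regularizing function beats any power of x. The
  constant contains \<epsilon>^(-j), so this yields integrability and vanishing boundary terms for
  each \<epsilon>, but no information on the limit.\<close>

lemma osc_bound_top:
  assumes b: "symb \<sigma> K \<nu> \<mu> \<eta> M b" and G: "rapid G L" and "\<epsilon> > 0" and \<beta>: "Re \<beta> = 0"
  shows "\<exists>C. \<forall>x>1. cmod (exp (\<beta> * of_real (x powr p)) * b x * G (\<epsilon> * x))
      \<le> C * (x powr (\<mu> - real j) + x powr (\<eta> - real j))"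
proof -
  obtain C where C: "\<forall>y>0. y ^ j * cmod (G y) \<le> C"
    using G by (auto simp: rapid_def)
  have "cmod (exp (\<beta> * of_real (x powr p)) * b x * G (\<epsilon> * x))
      \<le> M * (C / \<epsilon> ^ j) * (x powr (\<mu> - real j) + x powr (\<eta> - real j))" if x: "x > 1" for x
  proof -
    have "cmod (b x) \<le> M * (x powr \<mu> + x powr \<eta>)"
      using symb_bound[OF b, of x] x by (simp add: weight_def)
    moreover have "cmod (G (\<epsilon> * x)) \<le> C / \<epsilon> ^ j * x powr - real j"
      using C[rule_format, of "\<epsilon> * x"] x \<open>\<epsilon> > 0\<close>
      by (simp add: powr_minus powr_realpow field_simps)
    ultimately have "cmod (b x) * cmod (G (\<epsilon> * x)) \<le>
        (M * (x powr \<mu> + x powr \<eta>)) * (C / \<epsilon> ^ j * x powr - real j)"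
      using symb_nonneg[OF b] by (intro mult_mono) auto
    also have "\<dots> = M * (C / \<epsilon> ^ j) * (x powr (\<mu> - real j) + x powr (\<eta> - real j))"
      by (simp add: powr_diff powr_minus divide_inverse algebra_simps)
    finally show ?thesis
      using \<beta> by (simp add: norm_mult)
  qed
  thus ?thesis by blast
qed

lemma osc_integrable_top:
  assumes b: "symb \<sigma> K \<nu> \<mu> \<eta> M b" and G: "rapid G L" and "\<epsilon> > 0" and \<beta>: "Re \<beta> = 0"
  shows "set_integrable lborel {1<..} (\<lambda>x. exp (\<beta> * of_real (x powr p)) * b x * G (\<epsilon> * x))"
proof -
  obtain j :: nat where j: "real j > \<mu> + 1" "real j > \<eta> + 1"
    using reals_Archimedean2[of "max (\<mu> + 1) (\<eta> + 1)"] by auto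
  obtain C where C: "\<forall>x>1. cmod (exp (\<beta> * of_real (x powr p)) * b x * G (\<epsilon> * x))
      \<le> C * (x powr (\<mu> - real j) + x powr (\<eta> - real j))"
    using osc_bound_top[OF assms] by blast
  show ?thesis
  proof (rule set_integrable_continuous_bound)
    show "set_integrable lborel {1<..} (\<lambda>x. C * (x powr (\<mu> - real j) + x powr (\<eta> - real j)))"
      using j by (intro set_integrable_mult_right set_integral_add set_integrable_powr_at_top) auto
    show "continuous_on {1<..} (\<lambda>x. exp (\<beta> * of_real (x powr p)) * b x * G (\<epsilon> * x))"
      by (rule continuous_on_subset[OF continuous_on_osc])
         (use symb_continuous[OF b] G \<open>\<epsilon> > 0\<close> in \<open>auto simp: rapid_def\<close>)
  qed (use C in auto)
qed

lemma osc_tendsto_top: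
  assumes b: "symb \<sigma> K \<nu> \<mu> \<eta> M b" and G: "rapid G L" and "\<epsilon> > 0" and \<beta>: "Re \<beta> = 0"
  shows "((\<lambda>x. exp (\<beta> * of_real (x powr p)) * b x * G (\<epsilon> * x)) \<longlongrightarrow> 0) at_top"
proof -
  obtain j :: nat where j: "real j > \<mu>" "real j > \<eta>"
    using reals_Archimedean2[of "max \<mu> \<eta>"] by auto
  obtain C where C: "\<forall>x>1. cmod (exp (\<beta> * of_real (x powr p)) * b x * G (\<epsilon> * x))
      \<le> C * (x powr (\<mu> - real j) + x powr (\<eta> - real j))"
    using osc_bound_top[OF assms] by blast
  have "((\<lambda>x. C * (x powr (\<mu> - real j) + x powr (\<eta> - real j))) \<longlongrightarrow> C * (0 + 0)) at_top"
    using j by (intro tendsto_intros tendsto_neg_powr filterlim_ident) auto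
  hence "((\<lambda>x. C * (x powr (\<mu> - real j) + x powr (\<eta> - real j))) \<longlongrightarrow> 0) at_top" by simp
  thus ?thesis
    by (rule Lim_null_comparison[rotated])
       (rule eventually_mono[OF eventually_gt_at_top[of 1] C[rule_format]])
qed

lemma osc_integrable_near_0:
  assumes b: "symb \<sigma> K \<nu> \<mu> \<eta> M b" and G: "rapid G L" and "\<epsilon> > 0" and \<beta>: "Re \<beta> = 0" and "\<nu> > -1"
  shows "set_integrable lborel {0<..1} (\<lambda>x. exp (\<beta> * of_real (x powr p)) * b x * G (\<epsilon> * x))"
proof -
  from G have "\<exists>C. \<forall>y>0. y ^ 0 * cmod (G y) \<le> C" unfolding rapid_def by blast
  then obtain C where C: "\<forall>y>0. cmod (G y) \<le> C" by auto
  show ?thesis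
  proof (rule set_integrable_continuous_bound)
    show "set_integrable lborel {0<..1} (\<lambda>x. M * C * x powr \<nu>)"
      using assms by (intro set_integrable_mult_right set_integrable_powr_near_0) auto
    show "continuous_on {0<..1} (\<lambda>x. exp (\<beta> * of_real (x powr p)) * b x * G (\<epsilon> * x))"
      by (rule continuous_on_subset[OF continuous_on_osc])
         (use symb_continuous[OF b] G \<open>\<epsilon> > 0\<close> in \<open>auto simp: rapid_def\<close>)
    fix x :: real assume x: "x \<in> {0<..1}"
    have "cmod (b x) * cmod (G (\<epsilon> * x)) \<le> (M * x powr \<nu>) * C"
      using symb_nonneg[OF b] symb_bound[OF b, of x] C x \<open>\<epsilon> > 0\<close>
      by (intro mult_mono) (auto simp: weight_def)
    thus "norm (exp (\<beta> * of_real (x powr p)) * b x * G (\<epsilon> * x)) \<le> M * C * x powr \<nu>"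
      using \<beta> by (simp add: norm_mult mult_ac)
  qed auto
qed

lemma tendsto_rescaled:
  fixes G :: "real \<Rightarrow> complex"
  assumes "(G \<longlongrightarrow> L) (at_right 0)" "x > 0"
  shows "((\<lambda>\<epsilon>. G (\<epsilon> * x)) \<longlongrightarrow> L) (at_right 0)"
proof (rule filterlim_compose[OF assms(1)])
  have "((\<lambda>\<epsilon>. \<epsilon> * x) \<longlongrightarrow> 0 * x) (at_right 0)" by (intro tendsto_intros)
  thus "filterlim (\<lambda>\<epsilon>. \<epsilon> * x) (at_right 0) (at_right 0)"
    using assms(2) by (auto simp: filterlim_at eventually_at_filter)
qed

text \<open>Dominated convergence with majorant C w, where C bounds G. Only boundedness of G and its
  limit at 0 enter, so the order K is arbitrary; this is where every chain of integrations by parts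
  ends.\<close>

lemma osc_absolutely_convergent:
  assumes w: "set_integrable lborel J w" and J: "J \<subseteq> {0<..}" "J \<in> sets borel"
    and b: "continuous_on {0<..} b" and bw: "\<And>x. x \<in> J \<Longrightarrow> cmod (b x) \<le> w x"
    and \<beta>: "Re \<beta> = 0"
  shows "osc J \<beta> p K b (LINT x:J|lborel. exp (\<beta> * of_real (x powr p)) * b x)"
  unfolding osc_def
proof (intro allI impI)
  fix G L assume "reg K G L"
  hence G: "rapid G L" by (rule reg_rapid)
  from G have "\<exists>C. \<forall>y>0. y ^ 0 * cmod (G y) \<le> C" unfolding rapid_def by blast
  then obtain C where C: "\<forall>y>0. cmod (G y) \<le> C" by auto
  let ?e = "\<lambda>x. exp (\<beta> * of_real (x powr p))"
  have cont: "continuous_on J (\<lambda>x. ?e x * b x * G (\<epsilon> * x))" if "\<epsilon> > 0" for \<epsilon>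
    by (rule continuous_on_subset[OF continuous_on_osc])
       (use G b J that in \<open>auto simp: rapid_def\<close>)
  have bound: "cmod (?e x * b x * G (\<epsilon> * x)) \<le> C * w x" if "\<epsilon> > 0" "x \<in> J" for \<epsilon> x
  proof -
    have x: "x > 0" using that J by auto
    have "cmod (?e x * b x * G (\<epsilon> * x)) = cmod (G (\<epsilon> * x)) * cmod (b x)"
      using \<beta> by (simp add: norm_mult mult_ac)
    also have "\<dots> \<le> C * w x"
      using x that by (intro mult_mono bw C[rule_format] order_trans[OF norm_ge_zero C[rule_format, of 1]]) auto
    finally show ?thesis .
  qed
  have "set_integrable lborel J (\<lambda>x. C * w x)" using w by simp
  moreover have "set_integrable lborel J (\<lambda>x. ?e x * b x * G (\<epsilon> * x))" if "\<epsilon> > 0" for \<epsilon>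
    by (rule set_integrable_continuous_bound[OF calculation cont[OF that] J(2) bound[OF that]])
  moreover have "((\<lambda>\<epsilon>. LINT x:J|lborel. ?e x * b x * G (\<epsilon> * x)) \<longlongrightarrow>
      (LINT x:J|lborel. ?e x * b x * L)) (at_right 0)"
    using J G b
    by (intro set_dominated_convergence_within[OF calculation(1)]
              set_borel_measurable_continuous_on cont tendsto_intros tendsto_rescaled bound)
       (auto simp: rapid_def intro!: continuous_intros elim!: continuous_on_subset)
  ultimately show "(\<forall>\<epsilon>>0. set_integrable lborel J (\<lambda>x. ?e x * b x * G (\<epsilon> * x))) \<and>
     ((\<lambda>\<epsilon>. LINT x:J|lborel. ?e x * b x * G (\<epsilon> * x)) \<longlongrightarrow>
      L * (LINT x:J|lborel. ?e x * b x)) (at_right 0)"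
    by (simp add: mult.commute)
qed

lemma osc_Un:
  assumes "osc {0<..1} \<beta> p K b I" "osc {1<..} \<beta> p K b I'"
  shows "osc {0<..} \<beta> p K b (I + I')"
  unfolding osc_def
proof (intro allI impI)
  fix G L assume reg: "reg K G L"
  let ?f = "\<lambda>\<epsilon> x. exp (\<beta> * of_real (x powr p)) * b x * G (\<epsilon> * x)"
  have eq: "{0<..} = {0<..1} \<union> {1::real<..}" "{0<..1} \<inter> {1<..} = ({} :: real set)"
    by auto
  from assms reg have
    int: "\<forall>\<epsilon>>0. set_integrable lborel {0<..1} (?f \<epsilon>)" "\<forall>\<epsilon>>0. set_integrable lborel {1<..} (?f \<epsilon>)"
    and lim: "((\<lambda>\<epsilon>. LINT x:{0<..1}|lborel. ?f \<epsilon> x) \<longlongrightarrow> L * I) (at_right 0)"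
      "((\<lambda>\<epsilon>. LINT x:{1<..}|lborel. ?f \<epsilon> x) \<longlongrightarrow> L * I') (at_right 0)"
    by (simp_all add: osc_def)
  have "((\<lambda>\<epsilon>. LINT x:{0<..}|lborel. ?f \<epsilon> x) \<longlongrightarrow> L * I + L * I') (at_right 0)"
  proof (rule Lim_transform_eventually[OF tendsto_add[OF lim]])
    show "\<forall>\<^sub>F \<epsilon> in at_right 0. (LINT x:{0<..1}|lborel. ?f \<epsilon> x) + (LINT x:{1<..}|lborel. ?f \<epsilon> x)
        = (LINT x:{0<..}|lborel. ?f \<epsilon> x)"
      unfolding eventually_at_filter using int
      by (auto simp: eq set_integral_Un intro!: always_eventually)
  qed
  moreover have "\<forall>\<epsilon>>0. set_integrable lborel {0<..} (?f \<epsilon>)"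
    unfolding eq(1) using int by (auto intro!: set_integrable_Un)
  ultimately show "(\<forall>\<epsilon>>0. set_integrable lborel {0<..} (?f \<epsilon>)) \<and>
     ((\<lambda>\<epsilon>. LINT x:{0<..}|lborel. ?f \<epsilon> x) \<longlongrightarrow> L * (I + I')) (at_right 0)"
    by (simp add: distrib_left)
qed

section \<open>Integration by parts\<close>

text \<open>The factor x^(1 - p) / (\<beta> p) cancels the derivative of the phase and returns the
  integrand. The second term comes from differentiating x^(1 - p) b, the third from G(\<epsilon> x).
  In the latter no power of \<epsilon> appears, because x d/dx commutes with dilations.\<close>

lemma has_vector_derivative_osc_primitive:
  fixes b G :: "real \<Rightarrow> complex" and b' g :: complex
  assumes x: "x > 0" and "\<epsilon> > 0" "\<beta> \<noteq> 0" "p > 0"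
    and b: "(b has_vector_derivative b' / of_real x) (at x)"
    and G: "(G has_vector_derivative g / of_real (\<epsilon> * x)) (at (\<epsilon> * x))"
  shows "((\<lambda>x. exp (\<beta> * of_real (x powr p)) * (of_real (x powr (1 - p)) / (\<beta> * of_real p) * b x) * G (\<epsilon> * x))
     has_vector_derivative
       exp (\<beta> * of_real (x powr p)) * b x * G (\<epsilon> * x)
       + exp (\<beta> * of_real (x powr p)) * (of_real (x powr -p) / (\<beta> * of_real p) * (b' + (1 - of_real p) * b x)) * G (\<epsilon> * x)
       + exp (\<beta> * of_real (x powr p)) * (of_real (x powr -p) / (\<beta> * of_real p) * b x) * g) (at x)"
proof -
  have 1: "((\<lambda>x. exp (\<beta> * of_real (x powr p))) has_vector_derivative
      (\<beta> * (of_real (p * x powr p) / of_real x)) * exp (\<beta> * of_real (x powr p))) (at x)"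
    using field_vector_diff_chain_at[OF has_vector_derivative_mult_right[OF has_vector_derivative_powr[OF x]] DERIV_exp]
    by (simp add: o_def)
  have "((\<lambda>x. \<epsilon> * x) has_vector_derivative \<epsilon>) (at x)"
    by (auto intro!: derivative_eq_intros)
  from vector_diff_chain_at[OF this G]
  have 2: "((\<lambda>x. G (\<epsilon> * x)) has_vector_derivative g / of_real x) (at x)"
    using \<open>\<epsilon> > 0\<close> by (simp add: o_def scaleR_conv_of_real)
  have 3: "((\<lambda>x. of_real (x powr (1 - p)) / (\<beta> * of_real p) * b x) has_vector_derivative
     of_real (x powr (1 - p)) / (\<beta> * of_real p) * (b' / of_real x) +
     of_real ((1 - p) * x powr (1 - p)) / of_real x / (\<beta> * of_real p) * b x) (at x)"
    by (intro has_vector_derivative_mult b has_vector_derivative_divide has_vector_derivative_powr x)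
  \<comment> \<open>With the two powers abstracted and linked only by P Q = 1, the identity becomes
    field arithmetic.\<close>
  define P Q where "P = complex_of_real (x powr p)" and "Q = complex_of_real (x powr -p)"
  have PQ: "P * Q = 1" and xQ: "complex_of_real (x powr (1 - p)) = of_real x * Q"
    using x by (auto simp: P_def Q_def powr_minus powr_diff field_simps)
  have *: "complex_of_real (p * x powr p) = of_real p * P"
    "complex_of_real ((1 - p) * x powr (1 - p)) = (1 - of_real p) * (of_real x * Q)"
    by (simp_all add: P_def flip: xQ)
  have x0: "complex_of_real x \<noteq> 0" "complex_of_real p \<noteq> 0" using x \<open>p > 0\<close> by auto
  show ?thesis
  proof (rule has_vector_derivative_eq_rhs[OF has_vector_derivative_mult[OF has_vector_derivative_mult[OF 1 3] 2]])
    define E where "E = exp (\<beta> * P)"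
    have "E * (of_real x * Q / (\<beta> * of_real p) * b x) * (g / of_real x) +
       (E * (of_real x * Q / (\<beta> * of_real p) * (b' / of_real x) +
          (1 - of_real p) * (of_real x * Q) / of_real x / (\<beta> * of_real p) * b x) +
        \<beta> * (of_real p * P / of_real x) * E * (of_real x * Q / (\<beta> * of_real p) * b x)) * G (\<epsilon> * x)
      = E * b x * G (\<epsilon> * x) * (P * Q)
       + E * (Q / (\<beta> * of_real p) * (b' + (1 - of_real p) * b x)) * G (\<epsilon> * x)
       + E * (Q / (\<beta> * of_real p) * b x) * g"
      using x0 \<open>\<beta> \<noteq> 0\<close> by (simp add: divide_simps) (simp add: algebra_simps)
    thus "exp (\<beta> * of_real (x powr p)) * (of_real (x powr (1 - p)) / (\<beta> * of_real p) * b x) * (g / of_real x) +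
       (exp (\<beta> * of_real (x powr p)) * (of_real (x powr (1 - p)) / (\<beta> * of_real p) * (b' / of_real x) +
          of_real ((1 - p) * x powr (1 - p)) / of_real x / (\<beta> * of_real p) * b x) +
        \<beta> * (of_real (p * x powr p) / of_real x) * exp (\<beta> * of_real (x powr p)) *
        (of_real (x powr (1 - p)) / (\<beta> * of_real p) * b x)) * G (\<epsilon> * x)
      = exp (\<beta> * of_real (x powr p)) * b x * G (\<epsilon> * x)
       + exp (\<beta> * of_real (x powr p)) * (of_real (x powr -p) / (\<beta> * of_real p) * (b' + (1 - of_real p) * b x)) * G (\<epsilon> * x)
       + exp (\<beta> * of_real (x powr p)) * (of_real (x powr -p) / (\<beta> * of_real p) * b x) * g"
      by (simp only: * xQ PQ mult_1_right flip: P_def Q_def E_def)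
  qed
qed

text \<open>The boundary contribution is kept abstract to treat both rays at once:
  \<open>B G \<epsilon>\<close> is the value of the primitive at the left end point. It is 0 for the
  ray from 0, and \<open>A * G \<epsilon>\<close> for the ray from 1. One order of G is spent, since
  its Euler derivative g is only of order K.\<close>

lemma osc_by_parts:
  fixes b b' :: "real \<Rightarrow> complex"
  assumes "a \<ge> 0" and p: "p > 0" and \<beta>: "\<beta> \<noteq> 0"
    and b: "continuous_on {0<..} b" and b': "continuous_on {0<..} b'"
    and deriv: "\<And>x. x > 0 \<Longrightarrow> (b has_vector_derivative b' x / of_real x) (at x)"
    and int: "\<And>G L \<epsilon>. reg (Suc K) G L \<Longrightarrow> \<epsilon> > 0 \<Longrightarrow>
        set_integrable lborel {a<..} (\<lambda>x. exp (\<beta> * of_real (x powr p)) * b x * G (\<epsilon> * x))"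
    and I: "osc {a<..} \<beta> p K
        (\<lambda>x. of_real (x powr -p) / (\<beta> * of_real p) * (b' x + (1 - of_real p) * b x)) I"
    and I': "osc {a<..} \<beta> p K (\<lambda>x. of_real (x powr -p) / (\<beta> * of_real p) * b x) I'"
    and top: "\<And>G L \<epsilon>. reg (Suc K) G L \<Longrightarrow> \<epsilon> > 0 \<Longrightarrow>
        ((\<lambda>x. exp (\<beta> * of_real (x powr p)) *
          (of_real (x powr (1 - p)) / (\<beta> * of_real p) * b x) * G (\<epsilon> * x)) \<longlongrightarrow> 0) at_top"
    and bdry: "\<And>G L \<epsilon>. reg (Suc K) G L \<Longrightarrow> \<epsilon> > 0 \<Longrightarrow>
        ((\<lambda>x. exp (\<beta> * of_real (x powr p)) *
          (of_real (x powr (1 - p)) / (\<beta> * of_real p) * b x) * G (\<epsilon> * x)) \<longlongrightarrow> B G \<epsilon>) (at_right a)"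
    and lim: "\<And>G L. reg (Suc K) G L \<Longrightarrow> (B G \<longlongrightarrow> L * A) (at_right 0)"
  shows "osc {a<..} \<beta> p (Suc K) b (- A - I)"
  unfolding osc_def
proof (intro allI impI)
  fix G L assume reg: "reg (Suc K) G L"
  then obtain g where g: "\<And>y. y > 0 \<Longrightarrow> (G has_vector_derivative g y / of_real y) (at y)"
    and regg: "reg K g 0" by auto
  have regG: "reg K G L" by (rule reg_le[OF reg]) simp
  let ?e = "\<lambda>x. exp (\<beta> * of_real (x powr p))"
  let ?S = "\<lambda>x. of_real (x powr -p) / (\<beta> * of_real p) * b x"
  let ?T = "\<lambda>x. of_real (x powr -p) / (\<beta> * of_real p) * (b' x + (1 - of_real p) * b x)"
  let ?f = "\<lambda>\<epsilon> x. ?e x * b x * G (\<epsilon> * x)"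
  let ?u = "\<lambda>\<epsilon> x. ?e x * ?T x * G (\<epsilon> * x)"
  let ?v = "\<lambda>\<epsilon> x. ?e x * ?S x * g (\<epsilon> * x)"
  have ints: "set_integrable lborel {a<..} (?f \<epsilon>)" "set_integrable lborel {a<..} (?u \<epsilon>)"
    "set_integrable lborel {a<..} (?v \<epsilon>)" if "\<epsilon> > 0" for \<epsilon>
    using int[OF reg] I I' regG regg that by (auto simp: osc_def)
  have eq: "(LINT x:{a<..}|lborel. ?f \<epsilon> x) =
      - B G \<epsilon> - (LINT x:{a<..}|lborel. ?u \<epsilon> x) - (LINT x:{a<..}|lborel. ?v \<epsilon> x)" if "\<epsilon> > 0" for \<epsilon>
  proof -
    have cont: "continuous_on {a<..} (\<lambda>x. ?f \<epsilon> x + ?u \<epsilon> x + ?v \<epsilon> x)"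
      using reg_rapid[OF reg] reg_rapid[OF regg] that \<open>a \<ge> 0\<close> \<beta> p b b'
      by (intro continuous_on_add continuous_on_subset[OF continuous_on_osc[where \<epsilon> = \<epsilon>]])
         (auto simp: rapid_def intro!: continuous_intros)
    have d: "((\<lambda>x. ?e x * (of_real (x powr (1 - p)) / (\<beta> * of_real p) * b x) * G (\<epsilon> * x))
        has_vector_derivative ?f \<epsilon> x + ?u \<epsilon> x + ?v \<epsilon> x) (at x)" if "x > a" for x
      by (rule has_vector_derivative_osc_primitive)
         (use \<open>a \<ge> 0\<close> \<open>\<epsilon> > 0\<close> \<open>x > a\<close> \<beta> p deriv g[of "\<epsilon> * x"] in auto)
    have "(LINT x:{a<..}|lborel. ?f \<epsilon> x + ?u \<epsilon> x + ?v \<epsilon> x) = 0 - B G \<epsilon>"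
      by (rule integral_FTC_ray[OF d cont _ bdry[OF reg that] top[OF reg that]])
         (auto intro!: set_integral_add ints that simp del: mult_eq_0_iff times_divide_eq_left times_divide_eq_right)
    also have "(LINT x:{a<..}|lborel. ?f \<epsilon> x + ?u \<epsilon> x + ?v \<epsilon> x) = (LINT x:{a<..}|lborel. ?f \<epsilon> x) +
        (LINT x:{a<..}|lborel. ?u \<epsilon> x) + (LINT x:{a<..}|lborel. ?v \<epsilon> x)"
      using ints[OF that] by (simp add: set_integral_add)
    finally show ?thesis by (simp add: algebra_simps)
  qed
  have "((\<lambda>\<epsilon>. - B G \<epsilon> - (LINT x:{a<..}|lborel. ?u \<epsilon> x) - (LINT x:{a<..}|lborel. ?v \<epsilon> x))
      \<longlongrightarrow> - (L * A) - L * I - 0 * I') (at_right 0)"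
    by (intro tendsto_diff tendsto_minus lim[OF reg]
          I[unfolded osc_def, rule_format, OF regG, THEN conjunct2]
          I'[unfolded osc_def, rule_format, OF regg, THEN conjunct2])
  moreover have "\<forall>\<^sub>F \<epsilon> in at_right 0. - B G \<epsilon> - (LINT x:{a<..}|lborel. ?u \<epsilon> x)
      - (LINT x:{a<..}|lborel. ?v \<epsilon> x) = (LINT x:{a<..}|lborel. ?f \<epsilon> x)"
    unfolding eventually_at_filter by (auto simp: eq)
  ultimately have "((\<lambda>\<epsilon>. LINT x:{a<..}|lborel. ?f \<epsilon> x) \<longlongrightarrow> - (L * A) - L * I - 0 * I') (at_right 0)"
    by (rule Lim_transform_eventually)
  moreover have "- (L * A) - L * I - 0 * I' = L * (- A - I)" by (simp add: algebra_simps)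
  ultimately show "(\<forall>\<epsilon>>0. set_integrable lborel {a<..} (?f \<epsilon>)) \<and>
     ((\<lambda>\<epsilon>. LINT x:{a<..}|lborel. ?f \<epsilon> x) \<longlongrightarrow> L * (- A - I)) (at_right 0)"
    using ints(1) by simp
qed

text \<open>The constant collects (1 + p)^K from multiplying by x^(-p), 1 / p from the prefactor,
  and 2 + p as a bound for 1 + |1 - p|. The factor 1 / |\<beta>| is the gain of one integration by
  parts. Both functions are given the exponents that b' forces, so that one induction hypothesis
  applies to the two of them.\<close>

lemma symb_transport:
  assumes \<sigma>: "0 \<le> \<sigma>" and p: "p > 0"
  shows "\<exists>C\<ge>0. \<forall>(\<beta>::complex) b b' M. \<beta> \<noteq> 0 \<longrightarrow> symb \<sigma> K \<nu> \<mu> \<eta> M b \<longrightarrow> symb \<sigma> K \<nu> (\<mu> + \<sigma>) \<eta> M b' \<longrightarrow>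
     symb \<sigma> K (\<nu> - p) (\<mu> + \<sigma> - p) (\<eta> - p) (C * M / cmod \<beta>)
       (\<lambda>x. of_real (x powr -p) / (\<beta> * of_real p) * (b' x + (1 - of_real p) * b x)) \<and>
     symb \<sigma> K (\<nu> - p) (\<mu> + \<sigma> - p) (\<eta> - p) (C * M / cmod \<beta>)
       (\<lambda>x. of_real (x powr -p) / (\<beta> * of_real p) * b x)"
proof (intro exI[of _ "(1 + p) ^ K * (2 + p) / p"] conjI allI impI)
  show "0 \<le> (1 + p) ^ K * (2 + p) / p" using p by simp
  fix \<beta> :: complex and b b' M
  assume \<beta>: "\<beta> \<noteq> 0" and b: "symb \<sigma> K \<nu> \<mu> \<eta> M b" and b': "symb \<sigma> K \<nu> (\<mu> + \<sigma>) \<eta> M b'"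
  have M: "M \<ge> 0" by (rule symb_nonneg[OF b])
  have n: "cmod (1 / (\<beta> * of_real p)) = 1 / (cmod \<beta> * p)" "\<bar>-p\<bar> = p"
    using p by (simp_all add: norm_divide norm_mult)
  have n': "cmod (1 - of_real p) = \<bar>1 - p\<bar>"
    by (metis norm_of_real of_real_1 of_real_diff)
  have b1: "symb \<sigma> K \<nu> (\<mu> + \<sigma>) \<eta> M b"
    by (rule symb_weaken[OF b]) (use \<sigma> in auto)
  have conv: "symb \<sigma> K (\<nu> - p) (\<mu> + \<sigma> - p) (\<eta> - p) ((1 + p) ^ K * (2 + p) / p * M / cmod \<beta>)
      (\<lambda>x. of_real (x powr -p) / (\<beta> * of_real p) * c x)"
    if "symb \<sigma> K \<nu> (\<mu> + \<sigma>) \<eta> M' c" "M' \<le> (2 + p) * M" for c M'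
  proof -
    have *: "(\<lambda>x. of_real (x powr -p) / (\<beta> * of_real p) * c x)
        = (\<lambda>x. 1 / (\<beta> * of_real p) * (of_real (x powr -p) * c x))"
      by (simp add: fun_eq_iff)
    have "(1 + p) ^ K * M' / (cmod \<beta> * p) \<le> (1 + p) ^ K * ((2 + p) * M) / (cmod \<beta> * p)"
      using that p \<beta> by (intro divide_right_mono mult_left_mono) auto
    hence le: "cmod (1 / (\<beta> * of_real p)) * ((1 + \<bar>-p\<bar>) ^ K * M') \<le> (1 + p) ^ K * (2 + p) / p * M / cmod \<beta>"
      unfolding n by (simp add: mult_ac)
    show ?thesis
      unfolding * using symb_weaken[OF symb_cmult[OF symb_powr_mult[OF \<sigma> that(1), of "-p"], of "1 / (\<beta> * of_real p)"] order_refl le]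
      by simp
  qed
  have "1 + \<bar>1 - p\<bar> \<le> 2 + p" using p by auto
  hence le: "M + cmod (1 - of_real p) * M \<le> (2 + p) * M"
    unfolding n' using M by (metis distrib_right mult_1 mult_right_mono)
  show "symb \<sigma> K (\<nu> - p) (\<mu> + \<sigma> - p) (\<eta> - p) ((1 + p) ^ K * (2 + p) / p * M / cmod \<beta>)
      (\<lambda>x. of_real (x powr -p) / (\<beta> * of_real p) * (b' x + (1 - of_real p) * b x))"
    by (rule conv[OF symb_add[OF b' symb_cmult[OF b1, of "1 - of_real p"]] le])
  have "1 * M \<le> (2 + p) * M" using M p by (intro mult_right_mono) auto
  thus "symb \<sigma> K (\<nu> - p) (\<mu> + \<sigma> - p) (\<eta> - p) ((1 + p) ^ K * (2 + p) / p * M / cmod \<beta>)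
      (\<lambda>x. of_real (x powr -p) / (\<beta> * of_real p) * b x)"
    by (intro conv[OF b1]) simp
qed

section \<open>Repeated integration by parts\<close>

text \<open>Each step lowers \<mu> by p - \<sigma> > 0 and \<eta> by p; the hypotheses say that
  after K steps both are below -1, where the integral converges absolutely. The behaviour at 0 is
  irrelevant on this ray, so \<nu> is free to drift during the induction. No decay in \<beta> is
  claimed: the powers of 1 / |\<beta>| are estimated by 1.\<close>

lemma osc_tail:
  assumes \<sigma>: "0 \<le> \<sigma>" "\<sigma> < p" 
  shows "\<mu> + (\<sigma> - p) * real K < -1 \<Longrightarrow> \<eta> - p * real K < -1 \<Longrightarrow>
    \<exists>C\<ge>0. \<forall>\<beta> b M. Re \<beta> = 0 \<longrightarrow> \<beta> \<noteq> 0 \<longrightarrow> symb \<sigma> K \<nu> \<mu> \<eta> M b \<longrightarrow>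
      (\<exists>I. osc {1<..} \<beta> p K b I \<and> (1 \<le> cmod \<beta> \<longrightarrow> cmod I \<le> C * M))"
proof (induction K arbitrary: \<nu> \<mu> \<eta>)
  case 0
  have w: "set_integrable lborel {1<..} (\<lambda>x::real. x powr \<mu> + x powr \<eta>)"
    using 0 by (intro set_integral_add set_integrable_powr_at_top) auto
  define C where "C = (LINT x:{1<..}|lborel. x powr \<mu> + x powr \<eta>)"
  have "C \<ge> 0" unfolding C_def set_lebesgue_integral_def
    by (intro Bochner_Integration.integral_nonneg) (auto simp: indicator_def)
  moreover have "\<exists>I. osc {1<..} \<beta> p 0 b I \<and> (1 \<le> cmod \<beta> \<longrightarrow> cmod I \<le> C * M)"
    if \<beta>: "Re \<beta> = 0" and b: "symb \<sigma> 0 \<nu> \<mu> \<eta> M b" for \<beta> b M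
  proof (intro exI conjI impI)
    have bound: "cmod (b x) \<le> M * (x powr \<mu> + x powr \<eta>)" if "x \<in> {1<..}" for x
      using symb_bound[OF b, of x] that by (simp add: weight_def)
    have w': "set_integrable lborel {1<..} (\<lambda>x. M * (x powr \<mu> + x powr \<eta>))"
      using w by simp
    show "osc {1<..} \<beta> p 0 b (LINT x:{1<..}|lborel. exp (\<beta> * of_real (x powr p)) * b x)"
      by (rule osc_absolutely_convergent[OF w' _ _ symb_continuous[OF b] bound \<beta>]) auto
    have "continuous_on {1<..} (\<lambda>x. exp (\<beta> * of_real (x powr p)) * b x)"
      by (intro continuous_intros continuous_on_subset[OF symb_continuous[OF b]]) auto
    hence int: "set_integrable lborel {1<..} (\<lambda>x. exp (\<beta> * of_real (x powr p)) * b x)"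
      by (rule set_integrable_continuous_bound[OF w'])
         (use bound \<beta> in \<open>auto simp: norm_mult\<close>)
    have "cmod (LINT x:{1<..}|lborel. exp (\<beta> * of_real (x powr p)) * b x)
        \<le> (LINT x:{1<..}|lborel. cmod (exp (\<beta> * of_real (x powr p)) * b x))"
      by (rule set_integral_norm_bound[OF int])
    also have "\<dots> \<le> (LINT x:{1<..}|lborel. M * (x powr \<mu> + x powr \<eta>))"
      by (rule set_integral_mono[OF set_integrable_norm[OF int] w'])
         (use bound \<beta> in \<open>auto simp: norm_mult\<close>)
    also have "\<dots> = C * M" by (simp add: C_def)
    finally show "cmod (LINT x:{1<..}|lborel. exp (\<beta> * of_real (x powr p)) * b x) \<le> C * M" .
  qed
  ultimately show ?case by blast
next
  case (Suc K)
  have p: "p > 0" using \<sigma> by simp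
  obtain C1 where C1: "C1 \<ge> 0" "\<forall>\<beta> b b' M. \<beta> \<noteq> 0 \<longrightarrow> symb \<sigma> K \<nu> \<mu> \<eta> M b \<longrightarrow> symb \<sigma> K \<nu> (\<mu> + \<sigma>) \<eta> M b' \<longrightarrow>
     symb \<sigma> K (\<nu> - p) (\<mu> + \<sigma> - p) (\<eta> - p) (C1 * M / cmod \<beta>)
       (\<lambda>x. of_real (x powr -p) / (\<beta> * of_real p) * (b' x + (1 - of_real p) * b x)) \<and>
     symb \<sigma> K (\<nu> - p) (\<mu> + \<sigma> - p) (\<eta> - p) (C1 * M / cmod \<beta>)
       (\<lambda>x. of_real (x powr -p) / (\<beta> * of_real p) * b x)"
    using symb_transport[OF \<sigma>(1) p, of K \<nu> \<mu> \<eta>] by (elim exE conjE)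
  have "\<mu> + \<sigma> - p + (\<sigma> - p) * real K < -1" "\<eta> - p - p * real K < -1"
    using Suc.prems by (auto simp: algebra_simps)
  from Suc.IH[OF this, of "\<nu> - p"] obtain C2 where C2: "C2 \<ge> 0"
    "\<forall>\<beta> b M. Re \<beta> = 0 \<longrightarrow> \<beta> \<noteq> 0 \<longrightarrow> symb \<sigma> K (\<nu> - p) (\<mu> + \<sigma> - p) (\<eta> - p) M b \<longrightarrow>
      (\<exists>I. osc {1<..} \<beta> p K b I \<and> (1 \<le> cmod \<beta> \<longrightarrow> cmod I \<le> C2 * M))"
    by (elim exE conjE)
  \<comment> \<open>Here 1 / p accounts for the boundary term at 1, and \<open>C2 * C1\<close> for
    the integral of the transported symbol.\<close>
  have "\<exists>I. osc {1<..} \<beta> p (Suc K) b I \<and> (1 \<le> cmod \<beta> \<longrightarrow> cmod I \<le> (1 / p + C2 * C1) * M)"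
    if \<beta>: "Re \<beta> = 0" "\<beta> \<noteq> 0" and b: "symb \<sigma> (Suc K) \<nu> \<mu> \<eta> M b" for \<beta> b M
  proof -
    have M: "M \<ge> 0" by (rule symb_nonneg[OF b])
    from b obtain b' where b': "\<And>x. x > 0 \<Longrightarrow> (b has_vector_derivative b' x / of_real x) (at x)"
      "symb \<sigma> K \<nu> (\<mu> + \<sigma>) \<eta> M b'" by auto
    note S = C1(2)[rule_format, OF \<beta>(2) symb_Suc_D[OF b] b'(2)]
    from C2(2)[rule_format, OF \<beta> conjunct1[OF S]] obtain I where I: "osc {1<..} \<beta> p K
        (\<lambda>x. of_real (x powr -p) / (\<beta> * of_real p) * (b' x + (1 - of_real p) * b x)) I"
        "1 \<le> cmod \<beta> \<longrightarrow> cmod I \<le> C2 * (C1 * M / cmod \<beta>)" by auto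
    from C2(2)[rule_format, OF \<beta> conjunct2[OF S]] obtain I' where I': "osc {1<..} \<beta> p K
        (\<lambda>x. of_real (x powr -p) / (\<beta> * of_real p) * b x) I'" by auto
    define A where "A = exp \<beta> * (1 / (\<beta> * of_real p) * b 1)"
    have sP: "symb \<sigma> (Suc K) (\<nu> + (1 - p)) (\<mu> + (1 - p)) (\<eta> + (1 - p))
       (cmod (1 / (\<beta> * of_real p)) * ((1 + \<bar>1 - p\<bar>) ^ Suc K * M))
       (\<lambda>x. 1 / (\<beta> * of_real p) * (of_real (x powr (1 - p)) * b x))"
      by (rule symb_cmult[OF symb_powr_mult[OF \<sigma>(1) b]])
    have "osc {1<..} \<beta> p (Suc K) b (- A - I)"
    proof (rule osc_by_parts[OF _ p \<beta>(2) symb_continuous[OF b] symb_continuous[OF b'(2)] b'(1) _ I(1) I',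
          where B = "\<lambda>G \<epsilon>. A * G \<epsilon>"])
      fix G L \<epsilon> assume "reg (Suc K) G L" and \<epsilon>: "\<epsilon> > (0::real)"
      hence G: "rapid G L" by (simp add: reg_rapid)
      show "set_integrable lborel {1<..} (\<lambda>x. exp (\<beta> * of_real (x powr p)) * b x * G (\<epsilon> * x))"
        by (rule osc_integrable_top[OF b G \<epsilon> \<beta>(1)])
      show "((\<lambda>x. exp (\<beta> * of_real (x powr p)) *
          (of_real (x powr (1 - p)) / (\<beta> * of_real p) * b x) * G (\<epsilon> * x)) \<longlongrightarrow> 0) at_top"
        using osc_tendsto_top[OF sP G \<epsilon> \<beta>(1), of p] by simp
      have "continuous_on {0<..} (\<lambda>x. exp (\<beta> * of_real (x powr p)) *
          (of_real (x powr (1 - p)) / (\<beta> * of_real p) * b x) * G (\<epsilon> * x))"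
        using continuous_on_osc[OF symb_continuous[OF sP], of G \<epsilon> \<beta> p] G \<epsilon>
        by (simp add: rapid_def)
      hence "isCont (\<lambda>x. exp (\<beta> * of_real (x powr p)) *
          (of_real (x powr (1 - p)) / (\<beta> * of_real p) * b x) * G (\<epsilon> * x)) 1"
        by (simp add: continuous_on_eq_continuous_at)
      hence "((\<lambda>x. exp (\<beta> * of_real (x powr p)) *
          (of_real (x powr (1 - p)) / (\<beta> * of_real p) * b x) * G (\<epsilon> * x)) \<longlongrightarrow> 
          exp (\<beta> * of_real (1 powr p)) *
          (of_real (1 powr (1 - p)) / (\<beta> * of_real p) * b 1) * G (\<epsilon> * 1)) (at_right 1)"
        unfolding isCont_def by (rule tendsto_within_subset) simp
      thus "((\<lambda>x. exp (\<beta> * of_real (x powr p)) *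
          (of_real (x powr (1 - p)) / (\<beta> * of_real p) * b x) * G (\<epsilon> * x)) \<longlongrightarrow> A * G \<epsilon>) (at_right 1)"
        by (simp add: A_def)
    next
      fix G L assume "reg (Suc K) G L"
      hence "(G \<longlongrightarrow> L) (at_right 0)" using reg_rapid rapid_def by blast
      thus "((\<lambda>\<epsilon>. A * G \<epsilon>) \<longlongrightarrow> L * A) (at_right 0)"
        by (auto intro!: tendsto_eq_intros)
    qed auto
    moreover have "cmod (- A - I) \<le> (1 / p + C2 * C1) * M" if 1: "1 \<le> cmod \<beta>"
    proof -
      have "cmod (b 1) \<le> M" using symb_bound[OF b, of 1] by (simp add: weight_def)
      hence "cmod A \<le> M / (cmod \<beta> * p)"
        using \<beta> p by (simp add: A_def norm_mult norm_divide divide_right_mono)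
      also have "\<dots> \<le> M / (1 * p)"
        using M p 1 \<beta> by (intro divide_left_mono mult_right_mono mult_pos_pos) auto
      finally have "cmod A \<le> 1 / p * M" by simp
      moreover have "C2 * (C1 * M / cmod \<beta>) \<le> C2 * (C1 * M / 1)"
        using M C1 C2 1 by (intro mult_left_mono divide_left_mono) auto
      ultimately show ?thesis
        using I(2) 1 norm_triangle_ineq4[of "- A" I] by (simp add: algebra_simps)
    qed
    ultimately show ?thesis by blast
  qed
  moreover have "1 / p + C2 * C1 \<ge> 0" using p C1 C2 by simp
  ultimately show ?case by blast
qed

text \<open>
  As long as \<open>\<nu> - p * n > -1\<close>, the first \<open>n\<close> integrations by parts can be carried out on the whole half
  line, without boundary terms, and each of them gains a factor \<open>1 / \<beta>\<close>. The remaining \<open>K\<close> ones only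
  serve convergence at infinity, so there the boundary terms at \<open>1\<close> do no harm.
\<close>

lemma osc_half_line:
  assumes \<sigma>: "0 \<le> \<sigma>" "\<sigma> < p"
  shows "\<nu> - p * real n > -1 \<Longrightarrow> \<mu> + (\<sigma> - p) * real (n + K) < -1 \<Longrightarrow> \<eta> - p * real (n + K) < -1 \<Longrightarrow>
    \<exists>C\<ge>0. \<forall>\<beta> b M. Re \<beta> = 0 \<longrightarrow> \<beta> \<noteq> 0 \<longrightarrow> symb \<sigma> (n + K) \<nu> \<mu> \<eta> M b \<longrightarrow>
      (\<exists>I. osc {0<..} \<beta> p (n + K) b I \<and> (1 \<le> cmod \<beta> \<longrightarrow> cmod I \<le> C * M / cmod \<beta> ^ n))"
proof (induction n arbitrary: \<nu> \<mu> \<eta>)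
  case 0
  obtain C1 where C1: "C1 \<ge> 0" "\<forall>\<beta> b M. Re \<beta> = 0 \<longrightarrow> \<beta> \<noteq> 0 \<longrightarrow> symb \<sigma> K \<nu> \<mu> \<eta> M b \<longrightarrow>
      (\<exists>I. osc {1<..} \<beta> p K b I \<and> (1 \<le> cmod \<beta> \<longrightarrow> cmod I \<le> C1 * M))"
    using osc_tail[OF \<sigma>, of \<mu> K \<eta> \<nu>] 0 by auto
  define C where "C = (LINT x:{0<..1}|lborel. x powr \<nu>)"
  have w: "set_integrable lborel {0<..1} (\<lambda>x::real. x powr \<nu>)"
    using 0 by (intro set_integrable_powr_near_0) auto
  have "C \<ge> 0" unfolding C_def set_lebesgue_integral_def
    by (intro Bochner_Integration.integral_nonneg) (auto simp: indicator_def)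
  moreover have "\<exists>I. osc {0<..} \<beta> p K b I \<and> (1 \<le> cmod \<beta> \<longrightarrow> cmod I \<le> (C + C1) * M)"
    if \<beta>: "Re \<beta> = 0" "\<beta> \<noteq> 0" and b: "symb \<sigma> K \<nu> \<mu> \<eta> M b" for \<beta> b M
  proof -
    obtain I where I: "osc {1<..} \<beta> p K b I" "1 \<le> cmod \<beta> \<longrightarrow> cmod I \<le> C1 * M"
      using C1(2) \<beta> b by blast
    have bound: "cmod (b x) \<le> M * x powr \<nu>" if "x \<in> {0<..1}" for x
      using symb_bound[OF b, of x] that by (simp add: weight_def)
    have w': "set_integrable lborel {0<..1} (\<lambda>x. M * x powr \<nu>)"
      using w by simp
    let ?I = "LINT x:{0<..1}|lborel. exp (\<beta> * of_real (x powr p)) * b x"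
    have "osc {0<..1} \<beta> p K b ?I"
      by (rule osc_absolutely_convergent[OF w' _ _ symb_continuous[OF b] bound \<beta>(1)]) auto
    hence "osc {0<..} \<beta> p K b (?I + I)" using I(1) by (rule osc_Un)
    moreover have "cmod ?I \<le> C * M"
    proof -
      have "continuous_on {0<..1} (\<lambda>x. exp (\<beta> * of_real (x powr p)) * b x)"
        by (intro continuous_intros continuous_on_subset[OF symb_continuous[OF b]]) auto
      hence int: "set_integrable lborel {0<..1} (\<lambda>x. exp (\<beta> * of_real (x powr p)) * b x)"
        by (rule set_integrable_continuous_bound[OF w'])
           (use bound \<beta> in \<open>auto simp: norm_mult\<close>)
      have "cmod ?I \<le> (LINT x:{0<..1}|lborel. cmod (exp (\<beta> * of_real (x powr p)) * b x))"
        by (rule set_integral_norm_bound[OF int])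
      also have "\<dots> \<le> (LINT x:{0<..1}|lborel. M * x powr \<nu>)"
        by (rule set_integral_mono[OF set_integrable_norm[OF int] w'])
           (use bound \<beta> in \<open>auto simp: norm_mult\<close>)
      also have "\<dots> = C * M" by (simp add: C_def)
      finally show ?thesis .
    qed
    ultimately show ?thesis
      using I(2) norm_triangle_ineq[of ?I I] by (intro exI[of _ "?I + I"]) (auto simp: distrib_right)
  qed
  ultimately show ?case using C1(1) by (intro exI[of _ "C + C1"]) auto
next
  case (Suc n)
  have p: "p > 0" using \<sigma> by simp
  obtain C1 where C1: "C1 \<ge> 0" "\<forall>\<beta> b b' M. \<beta> \<noteq> 0 \<longrightarrow> symb \<sigma> (n + K) \<nu> \<mu> \<eta> M b \<longrightarrow> symb \<sigma> (n + K) \<nu> (\<mu> + \<sigma>) \<eta> M b' \<longrightarrow>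
     symb \<sigma> (n + K) (\<nu> - p) (\<mu> + \<sigma> - p) (\<eta> - p) (C1 * M / cmod \<beta>)
       (\<lambda>x. of_real (x powr -p) / (\<beta> * of_real p) * (b' x + (1 - of_real p) * b x)) \<and>
     symb \<sigma> (n + K) (\<nu> - p) (\<mu> + \<sigma> - p) (\<eta> - p) (C1 * M / cmod \<beta>)
       (\<lambda>x. of_real (x powr -p) / (\<beta> * of_real p) * b x)"
    using symb_transport[OF \<sigma>(1) p, of "n + K" \<nu> \<mu> \<eta>] by (elim exE conjE)
  have "\<nu> - p - p * real n > -1" "\<mu> + \<sigma> - p + (\<sigma> - p) * real (n + K) < -1" "\<eta> - p - p * real (n + K) < -1"
    using Suc.prems by (auto simp: algebra_simps)
  from Suc.IH[OF this] obtain C2 where C2: "C2 \<ge> 0"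
    "\<forall>\<beta> b M. Re \<beta> = 0 \<longrightarrow> \<beta> \<noteq> 0 \<longrightarrow> symb \<sigma> (n + K) (\<nu> - p) (\<mu> + \<sigma> - p) (\<eta> - p) M b \<longrightarrow>
      (\<exists>I. osc {0<..} \<beta> p (n + K) b I \<and> (1 \<le> cmod \<beta> \<longrightarrow> cmod I \<le> C2 * M / cmod \<beta> ^ n))"
    by (elim exE conjE)
  have "p * real n \<ge> 0" "\<nu> - p - p * real n > -1" using p Suc.prems(1) by (simp_all add: algebra_simps)
  \<comment> \<open>The first inequality gives integrability at 0; the second makes the primitive,
    which is of size x^(\<nu> + 1 - p), vanish there.\<close>
  hence \<nu>: "\<nu> > -1" "\<nu> + (1 - p) > 0" using p by linarith+
  have "\<exists>I. osc {0<..} \<beta> p (Suc (n + K)) b I \<and> (1 \<le> cmod \<beta> \<longrightarrow> cmod I \<le> C2 * C1 * M / cmod \<beta> ^ Suc n)"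
    if \<beta>: "Re \<beta> = 0" "\<beta> \<noteq> 0" and b: "symb \<sigma> (Suc (n + K)) \<nu> \<mu> \<eta> M b" for \<beta> b M
  proof -
    have M: "M \<ge> 0" by (rule symb_nonneg[OF b])
    from b obtain b' where b': "\<And>x. x > 0 \<Longrightarrow> (b has_vector_derivative b' x / of_real x) (at x)"
      "symb \<sigma> (n + K) \<nu> (\<mu> + \<sigma>) \<eta> M b'" by auto
    note S = C1(2)[rule_format, OF \<beta>(2) symb_Suc_D[OF b] b'(2)]
    from C2(2)[rule_format, OF \<beta> conjunct1[OF S]] obtain I where I: "osc {0<..} \<beta> p (n + K)
        (\<lambda>x. of_real (x powr -p) / (\<beta> * of_real p) * (b' x + (1 - of_real p) * b x)) I"
        "1 \<le> cmod \<beta> \<longrightarrow> cmod I \<le> C2 * (C1 * M / cmod \<beta>) / cmod \<beta> ^ n" by auto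
    from C2(2)[rule_format, OF \<beta> conjunct2[OF S]] obtain I' where I': "osc {0<..} \<beta> p (n + K)
        (\<lambda>x. of_real (x powr -p) / (\<beta> * of_real p) * b x) I'" by auto
    let ?P = "\<lambda>x. of_real (x powr (1 - p)) / (\<beta> * of_real p) * b x"
    have sP: "symb \<sigma> (Suc (n + K)) (\<nu> + (1 - p)) (\<mu> + (1 - p)) (\<eta> + (1 - p))
       (cmod (1 / (\<beta> * of_real p)) * ((1 + \<bar>1 - p\<bar>) ^ Suc (n + K) * M)) ?P"
      using symb_cmult[OF symb_powr_mult[OF \<sigma>(1) b, of "1 - p"], of "1 / (\<beta> * of_real p)"] by simp
    have "osc {0<..} \<beta> p (Suc (n + K)) b (- 0 - I)"
    proof (rule osc_by_parts[OF _ p \<beta>(2) symb_continuous[OF b] symb_continuous[OF b'(2)] b'(1) _ I(1) I',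
          where B = "\<lambda>G \<epsilon>. 0"])
      fix G L \<epsilon> assume "reg (Suc (n + K)) G L" and \<epsilon>: "\<epsilon> > (0::real)"
      hence G: "rapid G L" by (simp add: reg_rapid)
      have eq: "{0<..} = {0<..1} \<union> {1::real<..}" by auto
      show "set_integrable lborel {0<..} (\<lambda>x. exp (\<beta> * of_real (x powr p)) * b x * G (\<epsilon> * x))"
        unfolding eq
        by (intro set_integrable_Un osc_integrable_top[OF b G \<epsilon> \<beta>(1)]
              osc_integrable_near_0[OF b G \<epsilon> \<beta>(1) \<nu>(1)]) auto
      show "((\<lambda>x. exp (\<beta> * of_real (x powr p)) * ?P x * G (\<epsilon> * x)) \<longlongrightarrow> 0) at_top"
        using osc_tendsto_top[OF sP G \<epsilon> \<beta>(1), of p] by simp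
      define M' where "M' = cmod (1 / (\<beta> * of_real p)) * ((1 + \<bar>1 - p\<bar>) ^ Suc (n + K) * M)"
      from G have "\<exists>C. \<forall>y>0. y ^ 0 * cmod (G y) \<le> C" unfolding rapid_def by blast
      then obtain C where C: "\<forall>y>0. cmod (G y) \<le> C" by auto
      have "((\<lambda>x. M' * x powr (\<nu> + (1 - p)) * C) \<longlongrightarrow> M' * 0 powr (\<nu> + (1 - p)) * C) (at_right 0)"
        using \<nu> by (intro tendsto_intros tendsto_powr2) (auto simp: eventually_at_filter)
      hence "((\<lambda>x. M' * x powr (\<nu> + (1 - p)) * C) \<longlongrightarrow> 0) (at_right 0)" by simp
      thus "((\<lambda>x. exp (\<beta> * of_real (x powr p)) * ?P x * G (\<epsilon> * x)) \<longlongrightarrow> 0) (at_right 0)"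
      proof (rule Lim_null_comparison[rotated])
        have "\<forall>\<^sub>F x in at_right 0. x \<in> {0<..<1::real}"
          by (rule eventually_at_right_real) simp
        thus "\<forall>\<^sub>F x in at_right 0. norm (exp (\<beta> * of_real (x powr p)) * ?P x * G (\<epsilon> * x))
            \<le> M' * x powr (\<nu> + (1 - p)) * C"
        proof eventually_elim
          case (elim x)
          have "cmod (?P x) \<le> M' * x powr (\<nu> + (1 - p))"
            using symb_bound[OF sP, of x] elim unfolding M'_def by (simp add: weight_def)
          hence "cmod (?P x) * cmod (G (\<epsilon> * x)) \<le> M' * x powr (\<nu> + (1 - p)) * C"
            using symb_nonneg[OF sP] C elim \<epsilon> by (intro mult_mono) (auto simp: M'_def)
          thus ?case using \<beta>(1) by (simp add: norm_mult norm_divide)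
        qed
      qed
    qed (use \<nu> in auto)
    moreover have "C2 * (C1 * M / cmod \<beta>) / cmod \<beta> ^ n = C2 * C1 * M / cmod \<beta> ^ Suc n"
      by simp
    ultimately show ?thesis using I(2) by (intro exI[of _ "-I"]) auto
  qed
  moreover have "C2 * C1 \<ge> 0" using C1 C2 by simp
  ultimately show ?case unfolding add_Suc by blast
qed

lemma symb_zero: "M \<ge> 0 \<Longrightarrow> symb \<sigma> K \<nu> \<mu> \<eta> M (\<lambda>x. 0)"
proof (induction K arbitrary: \<mu>)
  case (Suc K)
  thus ?case by (auto simp: weight_nonneg intro!: exI[of _ "\<lambda>x. 0"])
qed (simp add: weight_nonneg)

text \<open>The constant 1 is a symbol with Euler derivative 0, and powers arise from it by
  multiplication. The size of M does not matter, because the Fresnel integrals are evaluated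
  exactly.\<close>

lemma symb_powr: "\<sigma> \<ge> 0 \<Longrightarrow> \<exists>M. symb \<sigma> K \<alpha> \<alpha> \<alpha> M (\<lambda>x. of_real (x powr \<alpha>))"
proof -
  assume \<sigma>: "\<sigma> \<ge> 0"
  have "symb \<sigma> K 0 0 0 1 (\<lambda>x. 1)"
    by (cases K) (auto simp: weight_def intro!: exI[of _ "\<lambda>x. 0"] symb_zero)
  from symb_powr_mult[OF \<sigma> this, of \<alpha>] show ?thesis by auto
qed

section \<open>Schwartz functions as regularizing functions\<close>

lemma nderiv_0 [simp]: "nderiv 0 f = f"
  by (simp add: nderiv_def)

lemma nderiv_nderiv: "nderiv k (nderiv j f) = nderiv (k + j) f"
  by (simp add: nderiv_def funpow_add)

lemma nderiv_Suc: "nderiv (Suc k) f x = vector_derivative (nderiv k f) (at x)"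
  by (simp add: nderiv_def)

lemma nderiv_has_vector_derivative:
  "smooth f \<Longrightarrow> (nderiv k f has_vector_derivative nderiv (Suc k) f x) (at x)"
  by (auto simp: nderiv_Suc smooth_def simp flip: vector_derivative_works)

lemma continuous_on_nderiv: "smooth f \<Longrightarrow> continuous_on A (nderiv k f)"
  by (meson continuous_at_imp_continuous_on has_vector_derivative_continuous nderiv_has_vector_derivative)

text \<open>A conjectured formula F for all derivatives is verified one derivative at a time; this
  serves the reflections x \<mapsto> -x and the Gaussian.\<close>

lemma nderiv_eqI:
  assumes "F 0 = f" "\<And>k x. (F k has_vector_derivative F (Suc k) x) (at x)"
  shows "nderiv k f = F k"
proof (induction k)
  case (Suc k)
  have "nderiv (Suc k) f x = F (Suc k) x" for x
    using assms(2)[of k x] by (simp add: nderiv_Suc Suc.IH vector_derivative_at)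
  thus ?case by blast
qed (simp add: assms)

lemma smoothI:
  assumes "F 0 = f" "\<And>k x. (F k has_vector_derivative F (Suc k) x) (at x)"
  shows "smooth f"
  using assms nderiv_eqI[OF assms] unfolding smooth_def
  by (metis differentiableI_vector)

lemma nderiv_reflect_step:
  assumes "smooth f"
  shows "((\<lambda>x. (-1) ^ k * nderiv k f (- x)) has_vector_derivative (-1) ^ Suc k * nderiv (Suc k) f (- x)) (at x)"
proof -
  have "(uminus has_vector_derivative -1) (at x)" for x :: real
    by (auto intro!: derivative_eq_intros)
  from vector_diff_chain_at[OF this nderiv_has_vector_derivative[OF assms]]
  have "((\<lambda>x. nderiv k f (- x)) has_vector_derivative - nderiv (Suc k) f (- x)) (at x)"
    by (simp add: o_def)
  from has_vector_derivative_mult_right[OF this, of "(-1) ^ k"] show ?thesis by simp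
qed

lemma nderiv_reflect:
  "smooth f \<Longrightarrow> nderiv k (\<lambda>x. f (- x)) = (\<lambda>x. (-1) ^ k * nderiv k f (- x))"
  by (rule nderiv_eqI[where F = "\<lambda>k x. (-1) ^ k * nderiv k f (- x)"])
     (use nderiv_reflect_step in auto)

lemma smooth_reflect: "smooth f \<Longrightarrow> smooth (\<lambda>x. f (- x))"
  by (rule smoothI[where F = "\<lambda>k x. (-1) ^ k * nderiv k f (- x)"])
     (use nderiv_reflect_step in auto)

lemma schwartz_reflect: "schwartz h \<Longrightarrow> schwartz (\<lambda>x. h (- x))"
  unfolding schwartz_def
  by (auto simp: smooth_reflect nderiv_reflect norm_mult norm_power) (metis abs_minus_cancel)

lemma schwartz_rapid:
  assumes "schwartz h"
  shows "rapid (\<lambda>y. of_real (y ^ j) * nderiv j h y) (if j = 0 then h 0 else 0)"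
  unfolding rapid_def
proof (intro conjI allI)
  from assms have s: "smooth h" by (simp add: schwartz_def)
  show "continuous_on {0<..} (\<lambda>y. of_real (y ^ j) * nderiv j h y)"
    by (intro continuous_intros continuous_on_nderiv s)
  show "\<exists>C. \<forall>y>0. y ^ i * cmod (of_real (y ^ j) * nderiv j h y) \<le> C" for i
  proof -
    obtain C where "\<forall>x. \<bar>x\<bar> ^ (i + j) * cmod (nderiv j h x) \<le> C"
      using assms unfolding schwartz_def by blast
    hence "y ^ i * cmod (of_real (y ^ j) * nderiv j h y) \<le> C" if "y > 0" for y
      using that by (auto simp: norm_mult norm_power power_add mult.assoc dest!: spec[of _ y])
    thus ?thesis by blast
  qed
  have "isCont (\<lambda>y. of_real (y ^ j) * nderiv j h y) 0"
    using continuous_on_nderiv[OF s, of UNIV j]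
    by (intro continuous_intros) (auto simp: continuous_on_eq_continuous_at)
  hence "((\<lambda>y. of_real (y ^ j) * nderiv j h y) \<longlongrightarrow> of_real (0 ^ j) * nderiv j h 0) (at_right 0)"
    unfolding isCont_def by (rule tendsto_within_subset) simp
  thus "((\<lambda>y. of_real (y ^ j) * nderiv j h y) \<longlongrightarrow> (if j = 0 then h 0 else 0)) (at_right 0)"
    by (cases "j = 0") (auto simp: power_0_left)
qed

text \<open>The functions y^j f^(j) span a space closed under y d/dy, which converts ordinary
  derivatives into Euler derivatives. The factor \<open>1 *\<close> fits the form of the linear
  combinations to which this is applied.\<close>

lemma has_vector_derivative_euler:
  assumes "y > 0" "(f has_vector_derivative f') (at y)"
  shows "((\<lambda>y. complex_of_real (y ^ j) * f y) has_vector_derivative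
     (of_nat j * (of_real (y ^ j) * f y) + 1 * (of_real (y ^ Suc j) * f')) / of_real y) (at y)"
proof -
  have "((\<lambda>y. y ^ j) has_real_derivative real j * y ^ j / y) (at y)"
    using assms(1) by (auto intro!: derivative_eq_intros simp: power_diff_conv_inverse divide_inverse)
      (cases j, auto)
  from has_vector_derivative_mult[OF has_vector_derivative_of_real[OF this] assms(2)]
  show ?thesis using assms(1) by (simp add: divide_simps) (simp add: algebra_simps)
qed

text \<open>All j are treated together, as the Euler derivative of y^j h^(j) involves j and j + 1.
  Its limit at 0 is 0: the only function with a nonzero limit is h itself, and for j = 0 it comes
  with the coefficient j.\<close>

lemma schwartz_reg:
  "schwartz h \<Longrightarrow> reg K (\<lambda>y. of_real (y ^ j) * nderiv j h y) (if j = 0 then h 0 else 0)"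
proof (induction K arbitrary: j)
  case 0
  thus ?case using schwartz_rapid[of h j] by simp
next
  case (Suc K)
  have s: "smooth h" using Suc.prems by (simp add: schwartz_def)
  note d = has_vector_derivative_euler[OF _ nderiv_has_vector_derivative[OF s, of j], of _ j]
  have "reg K (\<lambda>y. of_nat j * (of_real (y ^ j) * nderiv j h y) + 1 * (of_real (y ^ Suc j) * nderiv (Suc j) h y)) 0"
    using reg_lincomb[OF Suc.IH[OF Suc.prems, of j] Suc.IH[OF Suc.prems, of "Suc j"], of "of_nat j" 1]
    by (cases "j = 0") auto
  with d schwartz_rapid[OF Suc.prems, of j] show ?case unfolding reg.simps
    by (intro conjI exI[of _ "\<lambda>y. of_nat j * (of_real (y ^ j) * nderiv j h y) + 1 * (of_real (y ^ Suc j) * nderiv (Suc j) h y)"])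
       auto
qed

corollary schwartz_imp_reg: "schwartz h \<Longrightarrow> reg K h (h 0)"
  using schwartz_reg[of h K 0] by simp

section \<open>The Gaussian and the uniqueness of oscillatory integrals\<close>

lemma power_le_fact_exp:
  assumes "x \<ge> (0::real)"
  shows "x ^ n \<le> fact n * exp x"
proof -
  have "x ^ n / fact n \<le> (\<Sum>k<Suc n. x ^ k / fact k)"
    using assms by (intro member_le_sum) auto
  also have "\<dots> = (\<Sum>k<Suc n. x ^ k /\<^sub>R fact k)"
    by (simp add: divide_inverse mult.commute)
  also have "\<dots> \<le> exp x"
    unfolding exp_def using assms by (intro sum_le_suminf summable_exp_generic) auto
  finally show ?thesis by (simp add: field_simps)
qed

text \<open>Every |x|^i is at most i! exp |x|, and |x| - x^2 \<le> 1 / 4 by completing the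
  square.\<close>

lemma bounded_poly_gauss: "\<exists>C. \<forall>x. \<bar>poly q x\<bar> * exp (- (x::real)\<^sup>2) \<le> C"
proof -
  define D where "D = (\<Sum>i\<le>degree q. \<bar>coeff q i\<bar> * fact i)"
  have "\<bar>poly q x\<bar> * exp (- x\<^sup>2) \<le> D * exp (1 / 4)" for x :: real
  proof -
    have "\<bar>poly q x\<bar> \<le> (\<Sum>i\<le>degree q. \<bar>coeff q i\<bar> * \<bar>x\<bar> ^ i)"
      unfolding poly_altdef by (rule order_trans[OF sum_abs]) (simp add: abs_mult power_abs)
    also have "\<dots> \<le> (\<Sum>i\<le>degree q. \<bar>coeff q i\<bar> * (fact i * exp \<bar>x\<bar>))"
      by (intro sum_mono mult_left_mono power_le_fact_exp) auto
    also have "\<dots> = D * exp \<bar>x\<bar>" by (simp add: D_def sum_distrib_right mult.assoc)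
    finally have "\<bar>poly q x\<bar> * exp (- x\<^sup>2) \<le> D * exp \<bar>x\<bar> * exp (- x\<^sup>2)"
      by (intro mult_right_mono) auto
    also have "\<dots> = D * exp (\<bar>x\<bar> - x\<^sup>2)" by (simp add: exp_diff exp_minus divide_inverse)
    also have "\<dots> \<le> D * exp (1 / 4)"
    proof -
      have "0 \<le> (\<bar>x\<bar> - 1 / 2)\<^sup>2" by simp
      hence "\<bar>x\<bar> - x\<^sup>2 \<le> 1 / 4" by (simp add: power2_eq_square algebra_simps)
      thus ?thesis by (intro mult_left_mono) (auto simp: D_def sum_nonneg)
    qed
    finally show ?thesis .
  qed
  thus ?thesis by blast
qed

text \<open>One Schwartz function with value 1 at 0 has to be exhibited: without any,
  \<open>has_os_integral\<close> would hold vacuously for every value. The polynomials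
  \<open>P k\<close> are the Hermite polynomials up to the sign (-1)^k.\<close>

lemma schwartz_gauss: "schwartz (\<lambda>x. of_real (exp (- x\<^sup>2)))"
proof -
  define P where "P = rec_nat 1 (\<lambda>_ q :: real poly. pderiv q - [:0, 2:] * q)"
  have P: "P 0 = 1" "P (Suc k) = pderiv (P k) - [:0, 2:] * P k" for k
    by (simp_all add: P_def)
  let ?F = "\<lambda>k x. complex_of_real (poly (P k) x * exp (- x\<^sup>2))"
  have step: "(?F k has_vector_derivative ?F (Suc k) x) (at x)" for k x
    by (rule has_vector_derivative_of_real)
       (auto intro!: derivative_eq_intros poly_DERIV simp: P algebra_simps)
  have F0: "?F 0 = (\<lambda>x. of_real (exp (- x\<^sup>2)))" by (simp add: P)
  have "\<exists>C. \<forall>x. \<bar>x\<bar> ^ j * cmod (?F k x) \<le> C" for j k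
    using bounded_poly_gauss[of "monom 1 j * P k"]
    by (simp add: poly_monom norm_mult abs_mult power_abs mult.assoc)
  thus ?thesis
    unfolding schwartz_def using smoothI[of ?F, OF F0 step] nderiv_eqI[of ?F, OF F0 step] by simp
qed

lemma has_os_integral_unique:
  assumes "has_os_integral J \<phi> b I" "has_os_integral J \<phi> b I'"
  shows "I = I'"
proof (rule tendsto_unique)
  show "((\<lambda>\<epsilon>. LINT x:J|lborel. exp (\<i> * of_real (\<phi> x)) * b x * of_real (exp (- (\<epsilon> * x)\<^sup>2))) \<longlongrightarrow> I)
      (at_right 0)"
    using assms(1) schwartz_gauss unfolding has_os_integral_def by fastforce
  show "((\<lambda>\<epsilon>. LINT x:J|lborel. exp (\<i> * of_real (\<phi> x)) * b x * of_real (exp (- (\<epsilon> * x)\<^sup>2))) \<longlongrightarrow> I')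
      (at_right 0)"
    using assms(2) schwartz_gauss unfolding has_os_integral_def by fastforce
qed simp

lemma os_integral_eq: "has_os_integral J \<phi> b I \<Longrightarrow> os_integral J \<phi> b = I"
  unfolding os_integral_def by (rule the_equality) (auto intro: has_os_integral_unique)

text \<open>Schwartz functions are regularizing functions of every order, so any K will do.\<close>

lemma osc_imp_has_os_integral:
  assumes "osc {0<..} (\<i> * of_real c) p K b I"
  shows "has_os_integral {0<..} (\<lambda>x. c * x powr p) b I"
  unfolding has_os_integral_def
proof (intro allI impI)
  fix h assume h: "schwartz h \<and> h 0 = 1"
  hence "reg K h 1" using schwartz_imp_reg by metis
  with assms have *: "(\<forall>\<epsilon>>0. set_integrable lborel {0<..} (\<lambda>x. exp (\<i> * of_real c * of_real (x powr p)) * b x * h (\<epsilon> * x)))"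
        "((\<lambda>\<epsilon>. LINT x:{0<..}|lborel. exp (\<i> * of_real c * of_real (x powr p)) * b x * h (\<epsilon> * x)) \<longlongrightarrow> 1 * I) (at_right 0)"
    unfolding osc_def by blast+
  have eq: "\<i> * of_real c * of_real (x powr p) = \<i> * of_real (c * x powr p)" for x
    by simp
  show "(\<forall>\<epsilon>. 0 < \<epsilon> \<and> \<epsilon> < 1 \<longrightarrow> set_integrable lborel {0<..} (\<lambda>x. exp (\<i> * of_real (c * x powr p)) * b x * h (\<epsilon> * x))) \<and>
        ((\<lambda>\<epsilon>. LINT x:{0<..}|lborel. exp (\<i> * of_real (c * x powr p)) * b x * h (\<epsilon> * x)) \<longlongrightarrow> I) (at_right 0)"
    using * unfolding eq by (simp only: mult_1_left) blast
qed

section \<open>Evaluation of the Fresnel integrals\<close>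

text \<open>In the variable u = y^p this is a bound on u^(s / p) exp (- u), and u^(s / p) \<le> 1 +
  u^n for an integer n \<ge> s / p.\<close>

lemma powr_exp_bounded:
  assumes "s \<ge> 0" "p > 0"
  shows "\<exists>C. \<forall>y>0. y powr s * exp (- (y powr p)) \<le> (C::real)"
proof -
  obtain n :: nat where n: "real n \<ge> s / p" using real_arch_simple by blast
  have "y powr s * exp (- (y powr p)) \<le> 1 + fact n" if "y > 0" for y
  proof -
    define u where "u = y powr p"
    have u: "u > 0" using that by (simp add: u_def)
    have "y powr s = u powr (s / p)" using assms by (simp add: u_def powr_powr)
    also have "\<dots> \<le> 1 + u ^ n"
    proof (cases "u \<le> 1")
      case True
      hence "u powr (s / p) \<le> 1" using u assms by (intro powr_le1) auto
      thus ?thesis using u by (simp add: add_increasing2)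
    next
      case False
      hence "u powr (s / p) \<le> u powr real n" using n by (intro powr_mono) auto
      thus ?thesis using u by (simp add: powr_realpow)
    qed
    also have "\<dots> \<le> exp u + fact n * exp u"
      using u by (intro add_mono power_le_fact_exp) auto
    finally have "y powr s * exp (- u) \<le> (exp u + fact n * exp u) * exp (- u)"
      by (intro mult_right_mono) auto
    also have "\<dots> = 1 + fact n" by (simp add: distrib_right exp_minus field_simps)
    finally show ?thesis by (simp add: u_def)
  qed
  thus ?thesis by blast
qed

lemma rapid_powr_exp:
  assumes "q \<ge> 0" "p > 0"
  shows "rapid (\<lambda>y. of_real (y powr q * exp (- (y powr p)))) (if q = 0 then 1 else 0)"
  unfolding rapid_def
proof (intro conjI allI)
  show "continuous_on {0<..} (\<lambda>y. complex_of_real (y powr q * exp (- (y powr p))))"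
    by (intro continuous_intros) auto
  show "\<exists>C. \<forall>y>0. y ^ j * cmod (of_real (y powr q * exp (- (y powr p)))) \<le> C" for j
  proof -
    obtain C where C: "\<forall>y>0. y powr (real j + q) * exp (- (y powr p)) \<le> C"
      using powr_exp_bounded[of "real j + q" p] assms by auto
    have "y ^ j * cmod (of_real (y powr q * exp (- (y powr p)))) \<le> C" if "y > 0" for y
      using C that by (simp add: norm_mult powr_add powr_realpow mult.assoc)
    thus ?thesis by blast
  qed
  have z: "((\<lambda>y::real. y powr r) \<longlongrightarrow> 0) (at_right 0)" if "r > 0" for r
    using tendsto_powr2[of "\<lambda>y. y" 0 "at_right 0" "\<lambda>_. r" r] that
    by (auto simp: eventually_at_filter)
  have "((\<lambda>y. complex_of_real (exp (- (y powr p)))) \<longlongrightarrow> of_real (exp (- 0))) (at_right 0)"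
    by (intro tendsto_intros z assms)
  hence e: "((\<lambda>y. complex_of_real (exp (- (y powr p)))) \<longlongrightarrow> 1) (at_right 0)" by simp
  show "((\<lambda>y. complex_of_real (y powr q * exp (- (y powr p)))) \<longlongrightarrow> (if q = 0 then 1 else 0)) (at_right 0)"
  proof (cases "q = 0")
    case True
    show ?thesis
      \<comment> \<open>The identity \<open>y powr 0 = 1\<close> fails at y = 0, so it is used to
        the right of 0 only.\<close>
      by (rule Lim_transform_eventually[OF _ eventually_mono[OF eventually_at_right_less[of 0]]])
         (use e True in auto)
  next
    case False
    have "((\<lambda>y. complex_of_real (y powr q) * complex_of_real (exp (- (y powr p)))) \<longlongrightarrow> of_real 0 * 1) (at_right 0)"
      using False assms by (intro tendsto_intros z e) auto
    thus ?thesis using False by simp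
  qed
qed

text \<open>With f_q = y^q exp (- y^p), the Euler derivative of f_q is q f_q - p f_(q + p), so the
  family is closed. Its limit at 0 is 0: f_0 alone tends to 1, and it carries the coefficient q =
  0.\<close>

lemma reg_powr_exp:
  assumes "p > 0"
  shows "q \<ge> 0 \<Longrightarrow> reg K (\<lambda>y. of_real (y powr q * exp (- (y powr p)))) (if q = 0 then 1 else 0)"
proof (induction K arbitrary: q)
  case 0
  thus ?case using rapid_powr_exp assms by simp
next
  case (Suc K)
  let ?f = "\<lambda>q y. complex_of_real (y powr q * exp (- (y powr p)))"
  have "(?f q has_vector_derivative (of_real q * ?f q y + of_real (-p) * ?f (q + p) y) / of_real y) (at y)"
    if "y > 0" for y
  proof -
    have "((\<lambda>y. y powr q * exp (- (y powr p))) has_real_derivative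
        (q * (y powr q * exp (- (y powr p))) - p * (y powr (q + p) * exp (- (y powr p)))) / y) (at y)"
      using that by (auto intro!: derivative_eq_intros simp: powr_diff powr_add field_simps)
    from has_vector_derivative_of_real[OF this, where 'a = complex] show ?thesis by simp
  qed
  moreover have "reg K (\<lambda>y. of_real q * ?f q y + of_real (-p) * ?f (q + p) y) 0"
    using reg_lincomb[OF Suc.IH[OF Suc.prems] Suc.IH[of "q + p"], of "of_real q" "of_real (-p)"] Suc.prems assms
    by (auto split: if_splits)
  moreover have "rapid (?f q) (if q = 0 then 1 else 0)"
    using rapid_powr_exp Suc.prems assms by simp
  ultimately show ?case unfolding reg.simps
    by (intro conjI exI[of _ "\<lambda>y. of_real q * ?f q y + of_real (-p) * ?f (q + p) y"]) auto
qed

section \<open>Gamma integrals with complex damping\<close>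

text \<open>The substitution u = c x^p in the Euler integral for Gamma(q / p).\<close>

lemma powr_exp_integral:
  assumes "p > 0" "q > 0" "c > (0::real)"
  shows "set_integrable lborel {0<..} (\<lambda>x. x powr (q - 1) * exp (- (c * x powr p)))"
    and "(LINT x:{0<..}|lborel. x powr (q - 1) * exp (- (c * x powr p))) = c powr (- (q / p)) * Gamma (q / p) / p"
proof -
  define \<kappa> where "\<kappa> = q / p"
  have \<kappa>: "\<kappa> > 0" using assms by (simp add: \<kappa>_def)
  define f where "f = (\<lambda>u. u powr (\<kappa> - 1) / exp u)"
  define g where "g = (\<lambda>x. c * x powr p)"
  have im: "g ` {0<..} = {0<..}"
  proof (intro equalityI subsetI)
    fix u :: real assume "u \<in> {0<..}"
    hence "u = g ((u / c) powr (1 / p))" "(u / c) powr (1 / p) \<in> {0<..}"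
      using assms by (auto simp: g_def powr_powr)
    thus "u \<in> g ` {0<..}" by blast
  qed (use assms in \<open>auto simp: g_def\<close>)
  have inj: "inj_on g {0<..}"
  proof (rule inj_onI)
    fix x y :: real assume "x \<in> {0<..}" "y \<in> {0<..}" "g x = g y"
    hence "x powr p = y powr p" using assms by (auto simp: g_def)
    hence "(x powr p) powr (1 / p) = (y powr p) powr (1 / p)" by simp
    thus "x = y" using \<open>x \<in> _\<close> \<open>y \<in> _\<close> assms by (simp add: powr_powr)
  qed
  have hi: "(f has_integral Gamma \<kappa>) {0..}"
    unfolding f_def by (rule Gamma_integral_real[OF \<kappa>])
  have "(f has_integral Gamma \<kappa>) {0<..}"
    by (rule iffD1[OF has_integral_spike_set_eq hi]) (auto intro!: negligible_subset[OF negligible_sing[of 0]])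
  moreover from this have "f absolutely_integrable_on {0<..}"
    by (intro nonnegative_absolutely_integrable_1) (auto simp: f_def)
  ultimately have "f absolutely_integrable_on g ` {0<..} \<and> integral (g ` {0<..}) f = Gamma \<kappa>"
    unfolding im by (auto intro: integral_unique)
  moreover have "(\<lambda>x. \<bar>c * (p * x powr (p - 1))\<bar> *\<^sub>R f (g x)) absolutely_integrable_on {0<..} \<and>
      integral {0<..} (\<lambda>x. \<bar>c * (p * x powr (p - 1))\<bar> *\<^sub>R f (g x)) = Gamma \<kappa>
     \<longleftrightarrow> f absolutely_integrable_on g ` {0<..} \<and> integral (g ` {0<..}) f = Gamma \<kappa>"
    by (rule has_absolute_integral_change_of_variables_real[OF _ _ inj])
       (auto simp: g_def intro!: derivative_eq_intros)
  ultimately have *: "(\<lambda>x. \<bar>c * (p * x powr (p - 1))\<bar> *\<^sub>R f (g x)) absolutely_integrable_on {0<..}"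
      "integral {0<..} (\<lambda>x. \<bar>c * (p * x powr (p - 1))\<bar> *\<^sub>R f (g x)) = Gamma \<kappa>"
    by auto
  let ?h = "\<lambda>x. x powr (q - 1) * exp (- (c * x powr p))"
  \<comment> \<open>The Jacobian c p x^(p - 1) meets (c x^p)^(\<kappa> - 1); the powers of x combine
    to x^(q - 1) because p \<kappa> = q.\<close>
  have eq: "\<bar>c * (p * x powr (p - 1))\<bar> *\<^sub>R f (g x) = (p * c powr \<kappa>) * ?h x" if "x \<in> {0<..}" for x
  proof -
    have x: "x > 0" using that by simp
    have "(c * x powr p) powr (\<kappa> - 1) = c powr (\<kappa> - 1) * x powr (q - p)"
      using x assms by (simp add: powr_mult powr_powr \<kappa>_def right_diff_distrib)
    thus ?thesis
      using x assms
      by (simp add: f_def g_def exp_minus divide_inverse powr_diff abs_mult) (simp add: field_simps)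
  qed
  have "((\<lambda>x. \<bar>c * (p * x powr (p - 1))\<bar> *\<^sub>R f (g x)) has_integral Gamma \<kappa>) {0<..}"
    using * set_lebesgue_integral_eq_integral(1)[OF *(1)] by (metis has_integral_integral)
  hence "((\<lambda>x. (p * c powr \<kappa>) * ?h x) has_integral Gamma \<kappa>) {0<..}"
    by (rule has_integral_eq[rotated]) (rule eq)
  from has_integral_mult_right[OF this, of "1 / (p * c powr \<kappa>)"]
  have hi: "(?h has_integral Gamma \<kappa> / (p * c powr \<kappa>)) {0<..}"
    using assms by simp
  show int: "set_integrable lborel {0<..} ?h"
    using hi by (intro set_integrable_lborel_nonneg) (auto intro!: continuous_intros)
  have "(LINT x:{0<..}|lborel. ?h x) = Gamma \<kappa> / (p * c powr \<kappa>)"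
    using set_borel_integral_eq_integral(2)[OF int] hi by (simp add: integral_unique)
  thus "(LINT x:{0<..}|lborel. ?h x) = c powr (- (q / p)) * Gamma (q / p) / p"
    by (simp add: \<kappa>_def powr_minus divide_inverse mult_ac)
qed

text \<open>In the variable x^p this is a Laplace transform of a power, at the point c - \<i> t. For
  c = \<epsilon>^p it is the Fresnel integral regularized by exp (- (\<epsilon> x)^p).\<close>

definition damped :: "real \<Rightarrow> real \<Rightarrow> real \<Rightarrow> real \<Rightarrow> complex" where
  "damped p c q t = (LINT x:{0<..}|lborel.
     exp ((- of_real c + \<i> * of_real t) * of_real (x powr p)) * of_real (x powr (q - 1)))"

lemma norm_damped_integrand:
  "cmod (exp ((- of_real c + \<i> * of_real t) * of_real (x powr p)) * of_real (x powr (q - 1)))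
     = x powr (q - 1) * exp (- (c * x powr p))"
  by (simp add: norm_mult)

lemma damped_integrable:
  assumes "p > 0" "q > 0" "c > 0"
  shows "set_integrable lborel {0<..}
    (\<lambda>x. exp ((- of_real c + \<i> * of_real t) * of_real (x powr p)) * of_real (x powr (q - 1)))"
  by (rule set_integrable_continuous_bound[OF powr_exp_integral(1)[OF assms]])
     (auto simp: norm_mult intro!: continuous_intros)

text \<open>The integral of the derivative of exp (w x^p) x^q with w = - c + \<i> t: this function
  vanishes at 0 because q > 0, and at infinity because c > 0.\<close>

lemma damped_by_parts:
  assumes "p > 0" "q > 0" "c > 0"
  shows "of_real q * damped p c q t + (- of_real c + \<i> * of_real t) * of_real p * damped p c (q + p) t = 0"
proof -
  let ?w = "- of_real c + \<i> * of_real t"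
  let ?E = "\<lambda>q x. exp (?w * of_real (x powr p)) * of_real (x powr (q - 1))"
  let ?F = "\<lambda>x. exp (?w * of_real (x powr p)) * of_real (x powr q)"
  have d: "(?F has_vector_derivative of_real q * ?E q x + (?w * of_real p) * ?E (q + p) x) (at x)" if "x > 0" for x
  proof -
    have "((\<lambda>x. exp (?w * of_real (x powr p))) has_vector_derivative
      (?w * (of_real (p * x powr p) / of_real x)) * exp (?w * of_real (x powr p))) (at x)"
      using field_vector_diff_chain_at[OF has_vector_derivative_mult_right[OF has_vector_derivative_powr[OF that]] DERIV_exp]
      by (simp add: o_def)
    from has_vector_derivative_mult[OF this has_vector_derivative_powr[OF that, of q]]
    show ?thesis
      by (rule has_vector_derivative_eq_rhs) (use that in \<open>simp add: powr_diff powr_add field_simps\<close>)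
  qed
  have nF: "cmod (?F x) = x powr q * exp (- (c * x powr p))" for x
    by (simp add: norm_mult)
  obtain C where C: "\<forall>y>0. y powr (q + p) * exp (- (y powr p)) \<le> (C::real)"
    using powr_exp_bounded[of "q + p" p] assms by auto
  have "(?F \<longlongrightarrow> 0) at_top"
  proof (rule Lim_null_comparison)
    have "((\<lambda>x. C * c powr (- ((q + p) / p)) * x powr (-p)) \<longlongrightarrow> C * c powr (- ((q + p) / p)) * 0) at_top"
      using assms by (intro tendsto_intros tendsto_neg_powr filterlim_ident) auto
    thus "((\<lambda>x. C * c powr (- ((q + p) / p)) * x powr (-p)) \<longlongrightarrow> 0) at_top" by simp
    show "\<forall>\<^sub>F x in at_top. norm (?F x) \<le> C * c powr (- ((q + p) / p)) * x powr (-p)"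
      using eventually_gt_at_top[of 0]
    proof eventually_elim
      case (elim x)
      \<comment> \<open>The rescaling turns y^p into c x^p; the surplus factor x^p in the quantity
        bounded by C provides the decay x^(-p).\<close>
      define y where "y = c powr (1 / p) * x"
      have y: "y > 0" "y powr p = c * x powr p" "y powr (q + p) = c powr ((q + p) / p) * x powr (q + p)"
        using elim assms by (simp_all add: y_def powr_mult powr_powr)
      have "c powr ((q + p) / p) * x powr (q + p) * exp (- (c * x powr p)) \<le> C"
        using C[rule_format, OF y(1)] unfolding y by simp
      thus ?case
        unfolding nF using elim assms by (simp add: powr_minus powr_add field_simps)
    qed
  qed
  moreover have "(?F \<longlongrightarrow> 0) (at_right 0)"
  proof (rule Lim_null_comparison)
    show "((\<lambda>x::real. x powr q) \<longlongrightarrow> 0) (at_right 0)"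
      using tendsto_powr2[of "\<lambda>y. y" 0 "at_right 0" "\<lambda>_. q" q] assms
      by (auto simp: eventually_at_filter)
    show "\<forall>\<^sub>F x in at_right 0. norm (?F x) \<le> x powr q"
      using eventually_at_right_less[of "0::real"]
    proof eventually_elim
      case (elim x)
      have "x powr q * exp (- (c * x powr p)) \<le> x powr q * 1"
        using assms by (intro mult_left_mono) auto
      thus ?case unfolding nF by simp
    qed
  qed
  moreover have "set_integrable lborel {0<..} (\<lambda>x. of_real q * ?E q x + (?w * of_real p) * ?E (q + p) x)"
    using assms by (intro set_integral_add set_integrable_mult_right damped_integrable) auto
  moreover have "continuous_on {0<..} (\<lambda>x. of_real q * ?E q x + (?w * of_real p) * ?E (q + p) x)"
    by (intro continuous_intros) auto
  ultimately have "(LINT x:{0<..}|lborel. of_real q * ?E q x + (?w * of_real p) * ?E (q + p) x) = 0 - 0"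
    using d by (intro integral_FTC_ray[where F = ?F]) auto
  moreover have "(LINT x:{0<..}|lborel. of_real q * ?E q x + (?w * of_real p) * ?E (q + p) x)
     = (LINT x:{0<..}|lborel. of_real q * ?E q x) + (LINT x:{0<..}|lborel. (?w * of_real p) * ?E (q + p) x)"
    using assms by (intro set_integral_add set_integrable_mult_right damped_integrable) auto
  ultimately show ?thesis unfolding damped_def by simp
qed

lemma norm_exp_imaginary_diff: "cmod (exp (\<i> * of_real a) - exp (\<i> * of_real b)) \<le> \<bar>a - b\<bar>"
proof -
  have "exp (\<i> * of_real a) - exp (\<i> * of_real b) = exp (\<i> * of_real b) * (exp (\<i> * of_real (a - b)) - 1)"
    by (simp add: right_diff_distrib flip: exp_add)
  hence "cmod (exp (\<i> * of_real a) - exp (\<i> * of_real b)) = 2 * \<bar>sin ((a - b) / 2)\<bar>"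
    by (simp add: norm_mult dist_exp_i_1 del: of_real_diff)
  also have "\<dots> \<le> 2 * \<bar>(a - b) / 2\<bar>"
    by (intro mult_left_mono abs_sin_x_le_abs_x) auto
  finally show ?thesis by simp
qed

text \<open>Differentiation under the integral sign. Since |exp(\<i> a) - exp(\<i> b)| \<le> |a -
  b|, the difference quotient and the candidate derivative are each dominated by x^(q + p - 1) exp
  (- c x^p), uniformly in y; this explains the factor 2 in the majorant.\<close>

lemma damped_has_vector_derivative:
  assumes "p > 0" "q > 0" "c > 0"
  shows "(damped p c q has_vector_derivative \<i> * damped p c (q + p) t) (at t)"
  unfolding has_vector_derivative_def
proof (rule has_derivativeI)
  let ?E = "\<lambda>q t x. exp ((- of_real c + \<i> * of_real t) * of_real (x powr p)) * of_real (x powr (q - 1))"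
  let ?R = "\<lambda>y x. (?E q y x - ?E q t x - (y - t) *\<^sub>R (\<i> * ?E (q + p) t x)) /\<^sub>R \<bar>y - t\<bar>"
  have shift: "?E (q + p) t x = of_real (x powr p) * ?E q t x" for t x
    by (simp add: powr_add powr_diff mult_ac)
  have int: "set_integrable lborel {0<..} (?E q y)" "set_integrable lborel {0<..} (?E (q + p) y)" for y
    using damped_integrable[of p q c y] damped_integrable[of p "q + p" c y] assms by auto
  have eq: "(damped p c q y - damped p c q t - (y - t) *\<^sub>R (\<i> * damped p c (q + p) t)) /\<^sub>R norm (y - t)
      = (LINT x:{0<..}|lborel. ?R y x)" for y
    unfolding damped_def using int
    by (simp add: set_integral_diff scaleR_conv_of_real)
  have w: "set_integrable lborel {0<..} (\<lambda>x. 2 * (x powr (q + p - 1) * exp (- (c * x powr p))))"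
    using powr_exp_integral(1)[of p "q + p" c] assms by auto
  have "((\<lambda>y. LINT x:{0<..}|lborel. ?R y x) \<longlongrightarrow> (LINT x:{0::real<..}|lborel. 0)) (at t within UNIV)"
  proof (rule set_dominated_convergence_within[OF w])
    fix y :: real
    show "set_borel_measurable lborel {0<..} (?R y)"
      by (intro set_borel_measurable_continuous_on continuous_intros) auto
  next
    fix x :: real assume x: "x \<in> {0<..}"
    have "((\<lambda>y. ?E q y x) has_vector_derivative \<i> * ?E (q + p) t x) (at t)"
    proof -
      have "((\<lambda>y. - complex_of_real c + \<i> * of_real y) has_vector_derivative \<i>) (at t)"
        by (auto intro!: derivative_eq_intros)
      from field_vector_diff_chain_at[OF has_vector_derivative_mult_left[OF this] DERIV_exp]
      have "((\<lambda>y. exp ((- complex_of_real c + \<i> * of_real y) * of_real (x powr p))) has_vector_derivative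
          (\<i> * of_real (x powr p)) * exp ((- complex_of_real c + \<i> * of_real t) * of_real (x powr p))) (at t)"
        by (simp add: o_def)
      from has_vector_derivative_mult_left[OF this, of "of_real (x powr (q - 1))"]
      show ?thesis unfolding shift by (simp add: mult_ac)
    qed
    thus "((\<lambda>y. ?R y x) \<longlongrightarrow> 0) (at t within UNIV)"
      unfolding has_vector_derivative_def has_derivative_at_within by simp
  next
    fix y x :: real assume y: "y \<in> UNIV - {t}" and x: "x \<in> {0<..}"
    have "cmod (?E q y x - ?E q t x) = (x powr (q - 1) * exp (- (c * x powr p))) *
        cmod (exp (\<i> * of_real (y * x powr p)) - exp (\<i> * of_real (t * x powr p)))"
    proof -
      have "?E q y x - ?E q t x = of_real (x powr (q - 1) * exp (- (c * x powr p))) *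
        (exp (\<i> * of_real (y * x powr p)) - exp (\<i> * of_real (t * x powr p)))"
        by (simp add: distrib_right exp_add exp_of_real[symmetric] exp_minus algebra_simps exp_diff divide_inverse)
      thus ?thesis by (simp add: norm_mult)
    qed
    also have "\<dots> \<le> (x powr (q - 1) * exp (- (c * x powr p))) * \<bar>y * x powr p - t * x powr p\<bar>"
      by (intro mult_left_mono norm_exp_imaginary_diff) auto
    also have "\<dots> = \<bar>y - t\<bar> * (x powr (q + p - 1) * exp (- (c * x powr p)))"
      by (simp add: powr_add powr_diff abs_mult flip: left_diff_distrib)
    finally have 1: "cmod (?E q y x - ?E q t x) \<le> \<dots>" .
    have 2: "cmod ((y - t) *\<^sub>R (\<i> * ?E (q + p) t x)) = \<bar>y - t\<bar> * (x powr (q + p - 1) * exp (- (c * x powr p)))"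
      using norm_damped_integrand[of c t x p "q + p"] by (simp only: norm_scaleR norm_mult norm_ii mult_1 real_norm_def)
    have "cmod (?E q y x - ?E q t x - (y - t) *\<^sub>R (\<i> * ?E (q + p) t x))
        \<le> \<bar>y - t\<bar> * (2 * (x powr (q + p - 1) * exp (- (c * x powr p))))"
      by (rule order_trans[OF norm_triangle_ineq4], rule order_trans[OF add_mono[OF 1 eq_refl[OF 2]]]) simp
    thus "norm (?R y x) \<le> 2 * (x powr (q + p - 1) * exp (- (c * x powr p)))"
      using y by (simp only: norm_scaleR) (simp add: field_simps)
  qed (auto simp: set_borel_measurable_def)
  thus "((\<lambda>y. (damped p c q y - damped p c q t - (y - t) *\<^sub>R (\<i> * damped p c (q + p) t)) /\<^sub>R norm (y - t)) \<longlongrightarrow> 0) (at t)"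
    unfolding eq by (simp add: set_lebesgue_integral_def)
qed (auto intro: bounded_linear_scaleR_left)

text \<open>
  Integration by parts turns the derivative in \<open>t\<close> into the differential equation of
  \<open>(c - \<i> * t) powr (- (q / p))\<close>; the constant is determined at \<open>t = 0\<close>.
\<close>

lemma damped_eq:
  assumes p: "p > 0" and q: "q > 0" and c: "c > 0"
  shows "damped p c q t = (of_real c - \<i> * of_real t) powr of_real (- (q / p)) * of_real (Gamma (q / p) / p)"
proof -
  define \<kappa> where "\<kappa> = q / p"
  let ?z = "\<lambda>t. of_real c - \<i> * of_real t"
  let ?f = "\<lambda>t. exp (of_real \<kappa> * Ln (?z t)) * damped p c q t"
  \<comment> \<open>As c > 0, the point c - \<i> t stays in the open right half plane, off the
    branch cut of \<open>Ln\<close>.\<close>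
  have z0: "?z t \<noteq> 0" "?z t \<notin> \<real>\<^sub>\<le>\<^sub>0" for t
    using c by (auto simp: complex_eq_iff complex_nonpos_Reals_iff)
  have "(?f has_vector_derivative 0) (at t within UNIV)" for t
  proof -
    have "(?z has_vector_derivative - \<i>) (at t)"
      by (auto intro!: derivative_eq_intros)
    from field_vector_diff_chain_at[OF this has_field_derivative_Ln[OF z0(2)]]
    have "((\<lambda>t. Ln (?z t)) has_vector_derivative - \<i> * inverse (?z t)) (at t)" by (simp add: o_def)
    from field_vector_diff_chain_at[OF has_vector_derivative_mult_right[OF this] DERIV_exp]
    have "((\<lambda>t. exp (of_real \<kappa> * Ln (?z t))) has_vector_derivative
        of_real \<kappa> * (- \<i> * inverse (?z t)) * exp (of_real \<kappa> * Ln (?z t))) (at t)" by (simp add: o_def)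
    from has_vector_derivative_mult[OF this damped_has_vector_derivative[OF p q c]]
    have *: "(?f has_vector_derivative
        exp (of_real \<kappa> * Ln (?z t)) * (\<i> * damped p c (q + p) t) +
        of_real \<kappa> * (- \<i> * inverse (?z t)) * exp (of_real \<kappa> * Ln (?z t)) * damped p c q t) (at t)" .
    have "of_real q * damped p c q t = ?z t * of_real p * damped p c (q + p) t"
      using damped_by_parts[OF p q c, of t] by (simp add: algebra_simps)
    hence "of_real \<kappa> * inverse (?z t) * damped p c q t = damped p c (q + p) t"
      using p z0(1)[of t] by (simp add: \<kappa>_def field_simps)
    hence "exp (of_real \<kappa> * Ln (?z t)) * (\<i> * damped p c (q + p) t) +
        of_real \<kappa> * (- \<i> * inverse (?z t)) * exp (of_real \<kappa> * Ln (?z t)) * damped p c q t = 0"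
      by (simp add: algebra_simps)
    with * show ?thesis by simp
  qed
  then obtain d where d: "\<And>t. ?f t = d"
    using has_vector_derivative_zero_constant[of UNIV ?f] by auto
  have "damped p c q 0 = of_real (LINT x:{0<..}|lborel. x powr (q - 1) * exp (- (c * x powr p)))"
    unfolding damped_def set_integral_complex_of_real[symmetric]
    by (simp add: exp_of_real[symmetric] mult.commute)
  also have "\<dots> = of_real (c powr (- \<kappa>) * Gamma \<kappa> / p)"
    using powr_exp_integral(2)[OF p q c] by (simp add: \<kappa>_def)
  finally have "?f 0 = of_real (exp (\<kappa> * ln c) * (c powr (- \<kappa>) * Gamma \<kappa> / p))"
    using c by (simp add: Ln_of_real exp_of_real[symmetric])
  also have "exp (\<kappa> * ln c) * (c powr (- \<kappa>) * Gamma \<kappa> / p) = Gamma \<kappa> / p"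
    using c by (simp add: powr_def flip: exp_add)
  finally have *: "of_real (Gamma \<kappa> / p) = ?f t" using d by metis
  hence "damped p c q t = of_real (Gamma \<kappa> / p) / exp (of_real \<kappa> * Ln (?z t))"
    unfolding * by simp
  also have "\<dots> = ?z t powr of_real (- \<kappa>) * of_real (Gamma \<kappa> / p)"
    using z0(1)[of t] by (auto simp: powr_def exp_minus divide_inverse)
  finally show ?thesis by (simp add: \<kappa>_def)
qed

text \<open>The value I is the same for all regularizing functions, so exp (- y^p) may be chosen: it
  merges with the phase into a damped integral with c = \<epsilon>^p. As c tends to 0 the principal
  power is continuous, because - \<i> t with t \<noteq> 0 is off the branch cut.\<close>

lemma osc_powr_eq:
  assumes p: "p > 0" and q: "q > 0" and t: "t \<noteq> 0"
    and osc: "osc {0<..} (\<i> * of_real t) p K (\<lambda>x. of_real (x powr (q - 1))) I"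
  shows "I = (- (\<i> * of_real t)) powr of_real (- (q / p)) * of_real (Gamma (q / p) / p)"
proof (rule tendsto_unique)
  let ?G = "\<lambda>y. complex_of_real (y powr 0 * exp (- (y powr p)))"
  have "reg K ?G 1" using reg_powr_exp[OF p, of 0 K] by simp
  hence lim: "((\<lambda>\<epsilon>. LINT x:{0<..}|lborel. exp (\<i> * of_real t * of_real (x powr p)) * of_real (x powr (q - 1)) *
      ?G (\<epsilon> * x)) \<longlongrightarrow> 1 * I) (at_right 0)"
    using osc unfolding osc_def by blast
  have eq: "(LINT x:{0<..}|lborel. exp (\<i> * of_real t * of_real (x powr p)) * of_real (x powr (q - 1)) *
      ?G (\<epsilon> * x)) = damped p (\<epsilon> powr p) q t" if "\<epsilon> > 0" for \<epsilon>
    unfolding damped_def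
  proof (rule set_lebesgue_integral_cong)
    show "\<forall>x. x \<in> {0<..} \<longrightarrow> exp (\<i> * of_real t * of_real (x powr p)) * of_real (x powr (q - 1)) * ?G (\<epsilon> * x) =
        exp ((- of_real (\<epsilon> powr p) + \<i> * of_real t) * of_real (x powr p)) * of_real (x powr (q - 1))"
      using that by (auto simp: powr_mult exp_of_real[symmetric]) (simp add: algebra_simps flip: exp_add)
  qed auto
  show "((\<lambda>\<epsilon>. damped p (\<epsilon> powr p) q t) \<longlongrightarrow> I) (at_right 0)"
    using lim[unfolded mult_1_left]
    by (rule Lim_transform_eventually) (use eq in \<open>auto simp: eventually_at_filter\<close>)
  have "((\<lambda>\<epsilon>. \<epsilon> powr p) \<longlongrightarrow> 0) (at_right 0)"
    using tendsto_powr2[of "\<lambda>y. y" 0 "at_right 0" "\<lambda>_. p" p] p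
    by (auto simp: eventually_at_filter)
  hence "((\<lambda>\<epsilon>. (of_real (\<epsilon> powr p) - \<i> * of_real t) powr of_real (- (q / p)) * of_real (Gamma (q / p) / p))
      \<longlongrightarrow> (of_real 0 - \<i> * of_real t) powr of_real (- (q / p)) * of_real (Gamma (q / p) / p)) (at_right 0)"
    using t by (intro tendsto_intros tendsto_powr_complex) (auto simp: complex_nonpos_Reals_iff)
  hence "((\<lambda>\<epsilon>. (of_real (\<epsilon> powr p) - \<i> * of_real t) powr of_real (- (q / p)) * of_real (Gamma (q / p) / p))
      \<longlongrightarrow> (- (\<i> * of_real t)) powr of_real (- (q / p)) * of_real (Gamma (q / p) / p)) (at_right 0)"
    by simp
  thus "((\<lambda>\<epsilon>. damped p (\<epsilon> powr p) q t) \<longlongrightarrow>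
      (- (\<i> * of_real t)) powr of_real (- (q / p)) * of_real (Gamma (q / p) / p)) (at_right 0)"
    by (rule Lim_transform_eventually) (use p q in \<open>auto simp: eventually_at_filter damped_eq\<close>)
qed simp

text \<open>The principal logarithm of - \<i> s \<lambda> is ln \<lambda> - s \<i> \<pi> /
  2.\<close>

lemma neg_imaginary_powr:
  assumes "s \<in> {1, -1}" "lam > 0"
  shows "(- (\<i> * of_real (s * lam))) powr of_real (- \<kappa>) =
    exp (of_real s * \<i> * of_real (pi / 2 * \<kappa>)) * of_real (lam powr (- \<kappa>))"
proof -
  have "- (\<i> * of_real (s * lam)) = of_real lam * (if s = 1 then - \<i> else \<i>)"
    using assms(1) by auto
  moreover have "Ln (of_real lam * (if s = 1 then - \<i> else \<i>)) = of_real (ln lam) - of_real s * \<i> * of_real (pi / 2)"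
    using assms by (subst Ln_times_of_real) (auto simp: Ln_of_real)
  ultimately have "(- (\<i> * of_real (s * lam))) powr of_real (- \<kappa>) =
     exp (of_real (- \<kappa>) * (of_real (ln lam) - of_real s * \<i> * of_real (pi / 2)))"
    using assms by (auto simp: powr_def)
  also have "of_real (- \<kappa>) * (of_real (ln lam) - of_real s * \<i> * of_real (pi / 2))
      = of_real s * \<i> * of_real (pi / 2 * \<kappa>) + of_real (- \<kappa> * ln lam)"
    by (simp add: algebra_simps)
  finally show ?thesis
    using assms(2) by (simp only: exp_add) (simp add: powr_def exp_of_real[symmetric])
qed

section \<open>Oscillatory integrals and Taylor remainders\<close>

lemma has_os_integral_cong:
  assumes "\<And>x. x \<in> J \<Longrightarrow> b x = c x" "\<And>x. x \<in> J \<Longrightarrow> \<phi> x = \<psi> x" "J \<in> sets lborel"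
  shows "has_os_integral J \<phi> b I \<longleftrightarrow> has_os_integral J \<psi> c I"
proof -
  have 1: "set_integrable lborel J (\<lambda>x. exp (\<i> * of_real (\<phi> x)) * b x * h (\<epsilon> * x)) \<longleftrightarrow>
      set_integrable lborel J (\<lambda>x. exp (\<i> * of_real (\<psi> x)) * c x * h (\<epsilon> * x))" for h and \<epsilon> :: real
    by (rule set_integrable_cong) (use assms in auto)
  have 2: "(LINT x:J|lborel. exp (\<i> * of_real (\<phi> x)) * b x * h (\<epsilon> * x)) =
      (LINT x:J|lborel. exp (\<i> * of_real (\<psi> x)) * c x * h (\<epsilon> * x))" for h and \<epsilon> :: real
    by (rule set_lebesgue_integral_cong) (use assms in auto)
  show ?thesis unfolding has_os_integral_def 1 2 ..
qed

lemma has_os_integral_add: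
  assumes "has_os_integral J \<phi> b I" "has_os_integral J \<phi> c I'"
  shows "has_os_integral J \<phi> (\<lambda>x. b x + c x) (I + I')"
  unfolding has_os_integral_def
proof (intro allI impI)
  fix h assume h: "schwartz h \<and> h 0 = 1"
  let ?f = "\<lambda>b \<epsilon> x. exp (\<i> * of_real (\<phi> x)) * b x * h (\<epsilon> * x)"
  have eq: "exp (\<i> * of_real (\<phi> x)) * (b x + c x) * h (\<epsilon> * x) = ?f b \<epsilon> x + ?f c \<epsilon> x" for \<epsilon> x
    by (simp add: algebra_simps)
  from assms h have int: "\<forall>\<epsilon>. 0 < \<epsilon> \<and> \<epsilon> < 1 \<longrightarrow> set_integrable lborel J (?f b \<epsilon>)"
      "\<forall>\<epsilon>. 0 < \<epsilon> \<and> \<epsilon> < 1 \<longrightarrow> set_integrable lborel J (?f c \<epsilon>)"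
    and lim: "((\<lambda>\<epsilon>. LINT x:J|lborel. ?f b \<epsilon> x) \<longlongrightarrow> I) (at_right 0)"
      "((\<lambda>\<epsilon>. LINT x:J|lborel. ?f c \<epsilon> x) \<longlongrightarrow> I') (at_right 0)"
    unfolding has_os_integral_def by blast+
  have "\<forall>\<^sub>F \<epsilon> in at_right 0. \<epsilon> \<in> {0<..<1::real}"
    by (rule eventually_at_right_real) simp
  hence "\<forall>\<^sub>F \<epsilon> in at_right 0. (LINT x:J|lborel. ?f b \<epsilon> x) + (LINT x:J|lborel. ?f c \<epsilon> x) =
      (LINT x:J|lborel. ?f b \<epsilon> x + ?f c \<epsilon> x)"
    by eventually_elim (use int in \<open>simp add: set_integral_add\<close>)
  hence "((\<lambda>\<epsilon>. LINT x:J|lborel. ?f b \<epsilon> x + ?f c \<epsilon> x) \<longlongrightarrow> I + I') (at_right 0)"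
    by (rule Lim_transform_eventually[OF tendsto_add[OF lim]])
  moreover have "\<forall>\<epsilon>. 0 < \<epsilon> \<and> \<epsilon> < 1 \<longrightarrow> set_integrable lborel J (\<lambda>x. ?f b \<epsilon> x + ?f c \<epsilon> x)"
    using int by (auto intro: set_integral_add)
  ultimately show "(\<forall>\<epsilon>. 0 < \<epsilon> \<and> \<epsilon> < 1 \<longrightarrow> set_integrable lborel J (\<lambda>x. exp (\<i> * of_real (\<phi> x)) * (b x + c x) * h (\<epsilon> * x))) \<and>
     ((\<lambda>\<epsilon>. LINT x:J|lborel. exp (\<i> * of_real (\<phi> x)) * (b x + c x) * h (\<epsilon> * x)) \<longlongrightarrow> I + I') (at_right 0)"
    unfolding eq by blast
qed

lemma has_os_integral_cmult:
  assumes "has_os_integral J \<phi> b I"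
  shows "has_os_integral J \<phi> (\<lambda>x. z * b x) (z * I)"
proof -
  have eq: "exp (\<i> * of_real (\<phi> x)) * (z * b x) * y = z * (exp (\<i> * of_real (\<phi> x)) * b x * y)" for x y
    by (simp add: mult_ac)
  show ?thesis
    using assms unfolding has_os_integral_def eq
    by (auto intro!: tendsto_mult_left simp del: mult_eq_0_iff)
qed

lemma has_os_integral_sum:
  assumes "finite S" "\<And>k. k \<in> S \<Longrightarrow> has_os_integral J \<phi> (b k) (I k)"
  shows "has_os_integral J \<phi> (\<lambda>x. \<Sum>k\<in>S. b k x) (\<Sum>k\<in>S. I k)"
  using assms
proof (induction S rule: finite_induct)
  case empty
  show ?case by (simp add: has_os_integral_def set_integrable_def set_lebesgue_integral_def)
qed (auto intro!: has_os_integral_add)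

definition fresnel_value :: "real \<Rightarrow> real \<Rightarrow> nat \<Rightarrow> complex" where
  "fresnel_value s p k = inverse (of_real p) * exp (of_real s * \<i> * of_real (pi / 2 * ((real k + 1) / p)))
     * of_real (Gamma ((real k + 1) / p))"

text \<open>Existence is the case \<sigma> = 0, n = 0 of \<open>osc_half_line\<close>, with K large
  enough for convergence at infinity. The power of \<open>lam\<close> needs no change of variables;
  it comes out of the principal power of - \<i> s \<open>lam\<close>.\<close>

lemma has_os_integral_powr:
  assumes p: "p > 0" and s: "s \<in> {1, -1}" and lam: "lam > 0"
  shows "has_os_integral {0<..} (\<lambda>x. s * lam * x powr p) (\<lambda>x. of_real (x powr real k))
     (fresnel_value s p k * of_real (lam powr (- (real k + 1) / p)))"
proof -
  obtain K :: nat where K: "(real k + 1) / p < real K" using reals_Archimedean2 by blast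
  hence K': "real k - p * real K < -1" using p by (simp add: field_simps)
  let ?\<beta> = "\<i> * of_real (s * lam)"
  obtain M where M: "symb 0 K (real k) (real k) (real k) M (\<lambda>x. of_real (x powr real k))"
    using symb_powr[of 0 K "real k"] by auto
  have "\<exists>C\<ge>0. \<forall>\<beta> b M. Re \<beta> = 0 \<longrightarrow> \<beta> \<noteq> 0 \<longrightarrow> symb 0 (0 + K) (real k) (real k) (real k) M b \<longrightarrow>
      (\<exists>I. osc {0<..} \<beta> p (0 + K) b I \<and> (1 \<le> cmod \<beta> \<longrightarrow> cmod I \<le> C * M / cmod \<beta> ^ 0))"
    by (rule osc_half_line) (use p K' in auto)
  moreover have "Re ?\<beta> = 0" "?\<beta> \<noteq> 0" using s lam by auto
  ultimately obtain I where I: "osc {0<..} ?\<beta> p K (\<lambda>x. of_real (x powr real k)) I"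
    using M unfolding add_0 by blast
  have I': "osc {0<..} ?\<beta> p K (\<lambda>x. of_real (x powr (real k + 1 - 1))) I" and "s * lam \<noteq> 0"
    using I s lam by auto
  have "I = (- (\<i> * of_real (s * lam))) powr of_real (- ((real k + 1) / p)) * of_real (Gamma ((real k + 1) / p) / p)"
    by (rule osc_powr_eq[OF p _ \<open>s * lam \<noteq> 0\<close> I']) simp
  also have "\<dots> = fresnel_value s p k * of_real (lam powr (- (real k + 1) / p))"
    unfolding neg_imaginary_powr[OF s lam] fresnel_value_def
    by (simp only: minus_divide_left) (simp only: divide_inverse of_real_mult of_real_inverse mult_ac)
  finally show ?thesis using osc_imp_has_os_integral[OF I] by simp
qed

lemma fresnel_eq:
  assumes "p > 0" "s \<in> {1, -1}"
  shows "fresnel_exists s p (real k + 1)" "fresnel s p (real k + 1) = fresnel_value s p k"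
proof -
  have "has_os_integral {0<..} (\<lambda>x. s * x powr p) (\<lambda>x. of_real (x powr (real k + 1 - 1))) (fresnel_value s p k)"
    using has_os_integral_powr[OF assms, of 1 k] by simp
  thus "fresnel_exists s p (real k + 1)" "fresnel s p (real k + 1) = fresnel_value s p k"
    unfolding fresnel_exists_def fresnel_def os_integrable_def by (auto intro: os_integral_eq)
qed

section \<open>Weights and seminorms of amplitudes\<close>

lemma japanese_ge_1: "1 \<le> japanese x"
  unfolding japanese_def by (rule ge_one_powr_ge_zero) auto


text \<open>The bracket lies between u and 2 u; the factor 2^|e| covers exponents of either
  sign.\<close>

lemma japanese_powr_le:
  assumes u: "u = max 1 \<bar>x\<bar>"
  shows "japanese x powr e \<le> 2 powr \<bar>e\<bar> * u powr e"
proof -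
  have j: "japanese x = sqrt (1 + x\<^sup>2)" by (simp add: japanese_def powr_half_sqrt)
  have "1 \<le> u" "\<bar>x\<bar> \<le> u" using u by auto
  have "u \<le> japanese x"
    unfolding u j by (auto intro!: real_le_rsqrt)
  moreover have "japanese x \<le> 2 * u"
    unfolding j
  proof (rule real_le_lsqrt)
    have "1\<^sup>2 \<le> u\<^sup>2" "\<bar>x\<bar>\<^sup>2 \<le> u\<^sup>2" using \<open>1 \<le> u\<close> \<open>\<bar>x\<bar> \<le> u\<close> by (intro power_mono; simp)+
    thus "1 + x\<^sup>2 \<le> (2 * u)\<^sup>2" by (simp add: power_mult_distrib)
  qed (use \<open>1 \<le> u\<close> in auto)
  ultimately have le: "u \<le> japanese x" "japanese x \<le> 2 * u" .
  show ?thesis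
  proof (cases "e \<ge> 0")
    case True
    hence "japanese x powr e \<le> (2 * u) powr e"
      using le \<open>1 \<le> u\<close> by (intro powr_mono2) auto
    thus ?thesis using True \<open>1 \<le> u\<close> by (simp add: powr_mult)
  next
    case False
    hence "japanese x powr e \<le> u powr e"
      using le \<open>1 \<le> u\<close> by (intro powr_mono2') auto
    also have "\<dots> = 1 * u powr e" by simp
    also have "\<dots> \<le> 2 powr \<bar>e\<bar> * u powr e"
      by (intro mult_right_mono ge_one_powr_ge_zero) auto
    finally show ?thesis .
  qed
qed

text \<open>Membership in the class bounds the set of values, which makes the supremum an actual
  upper bound.\<close>

lemma amp_norm_bound:
  assumes a: "a \<in> amplitude \<tau> \<delta>" and k: "k \<le> l"
  shows "cmod (nderiv k a x) \<le> amp_norm \<tau> \<delta> l a * japanese x powr (\<tau> + \<delta> * real k)"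
proof -
  let ?g = "\<lambda>k x. japanese x powr (- \<tau> - \<delta> * real k) * cmod (nderiv k a x)"
  obtain C where C: "\<And>x. cmod (nderiv k a x) \<le> C * japanese x powr (\<tau> + \<delta> * real k)"
    using a by (auto simp: amplitude_def)
  have j: "japanese x > 0" for x using japanese_ge_1[of x] by linarith
  have pw: "japanese x powr (- \<tau> - \<delta> * real k) * japanese x powr (\<tau> + \<delta> * real k) = 1" for x
    using j[of x] by (simp flip: powr_add)
  have "?g k x \<le> C" for x
  proof -
    have "?g k x \<le> japanese x powr (- \<tau> - \<delta> * real k) * (C * japanese x powr (\<tau> + \<delta> * real k))"
      by (intro mult_left_mono C) auto
    also have "\<dots> = C" using pw[of x] by (simp add: mult.left_commute)
    finally show ?thesis .
  qed
  hence "bdd_above (range (?g k))" by (auto intro!: bdd_aboveI2)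
  hence "?g k x \<le> (SUP x. ?g k x)" by (intro cSUP_upper) auto
  also have "\<dots> \<le> amp_norm \<tau> \<delta> l a"
    unfolding amp_norm_def using k by (intro Max_ge) auto
  finally have "japanese x powr (\<tau> + \<delta> * real k) * ?g k x \<le> japanese x powr (\<tau> + \<delta> * real k) * amp_norm \<tau> \<delta> l a"
    by (intro mult_left_mono) auto
  thus ?thesis using pw[of x] by (simp add: mult_ac)
qed

lemma amp_norm_nonneg: "a \<in> amplitude \<tau> \<delta> \<Longrightarrow> 0 \<le> amp_norm \<tau> \<delta> l a"
  using amp_norm_bound[of a \<tau> \<delta> 0 l 0] japanese_ge_1[of 0]
  by (smt (verit) less_eq_nat.simps(1) norm_ge_zero powr_gt_zero zero_le_mult_iff)

lemma bound_norm_bounds: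
  assumes a: "a \<in> amplitude \<tau> \<delta>" and N: "N > 0"
  shows "0 \<le> bound_norm p \<tau> \<delta> N a"
    and "k < N \<Longrightarrow> cmod (nderiv k a 0) \<le> bound_norm p \<tau> \<delta> N a"
    and "k \<le> norm_order p \<tau> \<delta> N \<Longrightarrow>
      cmod (nderiv k a x) \<le> bound_norm p \<tau> \<delta> N a * japanese x powr (\<tau> + \<delta> * real k)"
proof -
  let ?M = "Max ((\<lambda>k. cmod (nderiv k a 0)) ` {..<N})"
  have M: "cmod (nderiv k a 0) \<le> ?M" if "k < N" for k
    using that by (intro Max_ge) auto
  have M0: "0 \<le> ?M" using M[OF N] norm_ge_zero order_trans by blast
  show "0 \<le> bound_norm p \<tau> \<delta> N a"
    unfolding bound_norm_def using M0 amp_norm_nonneg[OF a] by simp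
  show "cmod (nderiv k a 0) \<le> bound_norm p \<tau> \<delta> N a" if "k < N"
    unfolding bound_norm_def using M[OF that] amp_norm_nonneg[OF a, of "norm_order p \<tau> \<delta> N"] by linarith
  show "cmod (nderiv k a x) \<le> bound_norm p \<tau> \<delta> N a * japanese x powr (\<tau> + \<delta> * real k)"
    if "k \<le> norm_order p \<tau> \<delta> N"
  proof -
    have "cmod (nderiv k a x) \<le> amp_norm \<tau> \<delta> (norm_order p \<tau> \<delta> N) a * japanese x powr (\<tau> + \<delta> * real k)"
      by (rule amp_norm_bound[OF a that])
    also have "\<dots> \<le> bound_norm p \<tau> \<delta> N a * japanese x powr (\<tau> + \<delta> * real k)"
      unfolding bound_norm_def using M0 by (intro mult_right_mono) auto
    finally show ?thesis .
  qed
qed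

section \<open>Taylor remainders as symbols\<close>

lemma smooth_nderiv: "smooth f \<Longrightarrow> smooth (nderiv j f)"
  by (simp add: smooth_def nderiv_nderiv)

text \<open>Differentiation lowers the order by one. The truncated difference is right for n = 0 as
  well: the remainder of order 0 is the function itself, so more than n derivatives can be
  taken.\<close>

lemma taylor_rem_has_vector_derivative:
  assumes "smooth f"
  shows "(taylor_rem n f has_vector_derivative taylor_rem (n - 1) (nderiv 1 f) x) (at x)"
proof -
  have c: "((\<lambda>x. complex_of_real (x ^ k)) has_vector_derivative of_real (real k * x ^ (k - 1))) (at x)" for k
    by (rule has_vector_derivative_of_real) (auto intro!: derivative_eq_intros)
  have "((\<lambda>x. f x - (\<Sum>k<n. nderiv k f 0 / fact k * of_real (x ^ k))) has_vector_derivative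
      nderiv 1 f x - (\<Sum>k<n. nderiv k f 0 / fact k * of_real (real k * x ^ (k - 1)))) (at x)"
    using nderiv_has_vector_derivative[OF assms, of 0 x]
    by (intro has_vector_derivative_diff has_vector_derivative_sum has_vector_derivative_mult_right c) auto
  moreover have "(\<Sum>k<n. nderiv k f 0 / fact k * of_real (real k * x ^ (k - 1))) =
     (\<Sum>k<n - 1. nderiv k (nderiv 1 f) 0 / fact k * of_real (x ^ k))"
  proof (cases n)
    case (Suc m)
    have "nderiv (Suc k) f 0 / fact (Suc k) * of_real (real (Suc k) * x ^ k) =
        nderiv k (nderiv 1 f) 0 / fact k * of_real (x ^ k)" for k
      unfolding fact_Suc of_real_mult of_real_of_nat_eq
      by (simp add: nderiv_nderiv del: of_nat_Suc)
    thus ?thesis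
      unfolding Suc sum.lessThan_Suc_shift by simp
  qed simp
  ultimately show ?thesis unfolding taylor_rem_def[abs_def] by simp
qed

text \<open>The mean value inequality for norms, which is available for complex values, is applied
  once per order. The factor 1 / n! of the sharp estimate is given up.\<close>

lemma taylor_rem_bound:
  "smooth f \<Longrightarrow> 0 \<le> x \<Longrightarrow> (\<And>t. 0 \<le> t \<Longrightarrow> t \<le> x \<Longrightarrow> cmod (nderiv n f t) \<le> B) \<Longrightarrow> cmod (taylor_rem n f x) \<le> B * x ^ n"
proof (induction n arbitrary: f x)
  case 0
  thus ?case by (simp add: taylor_rem_def)
next
  case (Suc n)
  have z: "taylor_rem (Suc n) f 0 = 0"
    unfolding taylor_rem_def sum.lessThan_Suc_shift by simp
  show ?case
  proof (cases "x = 0")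
    case False
    hence x: "0 < x" using Suc.prems by simp
    note d = taylor_rem_has_vector_derivative[OF Suc.prems(1), of "Suc n"]
    have "continuous_on {0..x} (taylor_rem (Suc n) f)"
      by (intro continuous_at_imp_continuous_on) (use d has_vector_derivative_continuous in blast)
    then obtain t where t: "t \<in> {0<..<x}" "cmod (taylor_rem (Suc n) f x - taylor_rem (Suc n) f 0)
        \<le> cmod ((x - 0) *\<^sub>R taylor_rem n (nderiv 1 f) t)"
      using mvt_general[OF x, of "taylor_rem (Suc n) f" "\<lambda>t h. h *\<^sub>R taylor_rem n (nderiv 1 f) t"] d
      unfolding has_vector_derivative_def by auto
    have "cmod (taylor_rem n (nderiv 1 f) t) \<le> B * t ^ n"
      by (rule Suc.IH) (use Suc.prems t in \<open>auto simp: smooth_nderiv nderiv_nderiv\<close>)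
    also have "\<dots> \<le> B * x ^ n"
      using t x order_trans[OF norm_ge_zero Suc.prems(3)[of 0]] by (intro mult_left_mono power_mono) auto
    finally have "x * cmod (taylor_rem n (nderiv 1 f) t) \<le> x * (B * x ^ n)"
      using x by (intro mult_left_mono) auto
    moreover have "cmod (taylor_rem (Suc n) f x) \<le> x * cmod (taylor_rem n (nderiv 1 f) t)"
      using t x by (simp add: z)
    ultimately have "cmod (taylor_rem (Suc n) f x) \<le> x * (B * x ^ n)" by (rule order_trans[rotated])
    thus ?thesis by (simp add: mult_ac)
  qed (simp add: z)
qed

text \<open>The Euler derivative of x^j F_j is j x^j F_j + x^(j + 1) F_(j + 1). Its coefficients add
  up to j + 1 \<le> L + 1, which is the factor per step in the constant.\<close>

lemma symb_euler:
  assumes F: "\<And>j x. x > 0 \<Longrightarrow> (F j has_vector_derivative F (Suc j) x) (at x)"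
    and \<sigma>: "\<sigma> \<ge> 0"
    and bound: "\<And>j x. j \<le> L \<Longrightarrow> x > 0 \<Longrightarrow> cmod (of_real (x ^ j) * F j x) \<le> Q * weight \<nu> (\<mu> + \<sigma> * real j) \<eta> x"
  shows "j + K \<le> L \<Longrightarrow> symb \<sigma> K \<nu> (\<mu> + \<sigma> * real j) \<eta> (Q * (real L + 1) ^ K) (\<lambda>x. of_real (x ^ j) * F j x)"
proof (induction K arbitrary: j)
  have cont: "continuous_on {0<..} (\<lambda>x. of_real (x ^ j) * F j x)" for j
    by (intro continuous_intros continuous_at_imp_continuous_on)
       (use F has_vector_derivative_continuous in blast)
  {
    case 0
    thus ?case using cont bound by simp
  next
    case (Suc K)
    have Q: "Q \<ge> 0"
      using order_trans[OF norm_ge_zero bound[of 0 1]] by (simp add: weight_def)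
    note S1 = Suc.IH[of j] and S2 = Suc.IH[of "Suc j"]
    have S1': "symb \<sigma> K \<nu> (\<mu> + \<sigma> * real (Suc j)) \<eta> (Q * (real L + 1) ^ K) (\<lambda>x. of_real (x ^ j) * F j x)"
      by (rule symb_weaken[OF S1]) (use Suc.prems \<sigma> in \<open>auto simp: algebra_simps\<close>)
    have "symb \<sigma> K \<nu> (\<mu> + \<sigma> * real (Suc j)) \<eta>
        (cmod (of_nat j) * (Q * (real L + 1) ^ K) + cmod 1 * (Q * (real L + 1) ^ K))
        (\<lambda>x. of_nat j * (of_real (x ^ j) * F j x) + 1 * (of_real (x ^ Suc j) * F (Suc j) x))"
      by (rule symb_add[OF symb_cmult[OF S1'] symb_cmult[OF S2]]) (use Suc.prems in auto)
    moreover have "cmod (of_nat j) * (Q * (real L + 1) ^ K) + cmod 1 * (Q * (real L + 1) ^ K)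
        \<le> Q * (real L + 1) ^ Suc K"
    proof -
      have "(real j + 1) * (Q * (real L + 1) ^ K) \<le> (real L + 1) * (Q * (real L + 1) ^ K)"
        using Suc.prems Q by (intro mult_right_mono) auto
      thus ?thesis by (simp add: algebra_simps)
    qed
    ultimately have S: "symb \<sigma> K \<nu> (\<mu> + \<sigma> * real (Suc j)) \<eta> (Q * (real L + 1) ^ Suc K)
        (\<lambda>x. of_nat j * (of_real (x ^ j) * F j x) + 1 * (of_real (x ^ Suc j) * F (Suc j) x))"
      using symb_weaken by blast
    have bnd: "\<forall>x>0. cmod (of_real (x ^ j) * F j x) \<le> Q * (real L + 1) ^ Suc K * weight \<nu> (\<mu> + \<sigma> * real j) \<eta> x"
    proof (intro allI impI)
      fix x :: real assume "x > 0"
      have "Q * 1 * weight \<nu> (\<mu> + \<sigma> * real j) \<eta> x \<le> Q * (real L + 1) ^ Suc K * weight \<nu> (\<mu> + \<sigma> * real j) \<eta> x"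
        using Q by (intro mult_right_mono mult_left_mono weight_nonneg one_le_power) auto
      with bound[of j x] Suc.prems \<open>x > 0\<close>
      show "cmod (of_real (x ^ j) * F j x) \<le> Q * (real L + 1) ^ Suc K * weight \<nu> (\<mu> + \<sigma> * real j) \<eta> x"
        by simp
    qed
    have eq: "\<mu> + \<sigma> * real (Suc j) = \<mu> + \<sigma> * real j + \<sigma>" by (simp add: algebra_simps)
    have d: "\<forall>x>0. ((\<lambda>x. of_real (x ^ j) * F j x) has_vector_derivative
        (of_nat j * (of_real (x ^ j) * F j x) + 1 * (of_real (x ^ Suc j) * F (Suc j) x)) / of_real x) (at x)"
      using has_vector_derivative_euler[OF _ F, of _ j] by blast
    show ?case
      unfolding symb.simps
      by (intro conjI exI[of _ "\<lambda>x. of_nat j * (of_real (x ^ j) * F j x) + 1 * (of_real (x ^ Suc j) * F (Suc j) x)"])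
         (fact cont, fact bnd, fact d, fact S[unfolded eq])
  }
qed

text \<open>The j-th derivative of the remainder is the remainder of order N - j of a^(j).
  Multiplied by x^j it is O(x^N) at 0. At infinity a^(j) contributes x^(\<tau> + (\<delta> + 1) j),
  and the Taylor polynomial at most x^(N - 1) for every j; these are the two exponents of the
  weight. The bound is linear in Q, with a factor independent of a.\<close>

lemma symb_taylor_rem:
  assumes \<delta>: "\<delta> \<ge> -1" and N: "N > 0" and L: "N \<le> L"
  shows "\<exists>C\<ge>0. \<forall>a Q. smooth a \<longrightarrow> 0 \<le> Q \<longrightarrow> (\<forall>k<N. cmod (nderiv k a 0) \<le> Q) \<longrightarrow>
     (\<forall>k\<le>L. \<forall>x. cmod (nderiv k a x) \<le> Q * japanese x powr (\<tau> + \<delta> * real k)) \<longrightarrow>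
     symb (\<delta> + 1) L (real N) \<tau> (real N - 1) (C * Q) (taylor_rem N a)"
proof -
  define D where "D = 2 powr (\<bar>\<tau>\<bar> + \<bar>\<delta>\<bar> * real L)"
  have D0: "D \<ge> 0" by (simp add: D_def)
  have D: "2 powr \<bar>\<tau> + \<delta> * real j\<bar> \<le> D" if "j \<le> L" for j
  proof -
    have "\<bar>\<tau> + \<delta> * real j\<bar> \<le> \<bar>\<tau>\<bar> + \<bar>\<delta>\<bar> * real j"
      using abs_triangle_ineq[of \<tau> "\<delta> * real j"] by (simp add: abs_mult)
    also have "\<dots> \<le> \<bar>\<tau>\<bar> + \<bar>\<delta>\<bar> * real L" using that by (intro add_left_mono mult_left_mono) auto
    finally show ?thesis unfolding D_def by (intro powr_mono) auto
  qed
  show ?thesis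
  proof (intro exI[of _ "(D + real N) * (real L + 1) ^ L"] conjI allI impI)
    fix a Q
    assume a: "smooth a" and Q: "0 \<le> Q" and a0: "\<forall>k<N. cmod (nderiv k a 0) \<le> Q"
      and bd: "\<forall>k\<le>L. \<forall>x. cmod (nderiv k a x) \<le> Q * japanese x powr (\<tau> + \<delta> * real k)"
    define F where "F = (\<lambda>j. taylor_rem (N - j) (nderiv j a))"
    have nd: "cmod (nderiv j a x) \<le> D * Q * (max 1 \<bar>x\<bar>) powr (\<tau> + \<delta> * real j)" if "j \<le> L" for j x
    proof -
      have "cmod (nderiv j a x) \<le> Q * japanese x powr (\<tau> + \<delta> * real j)" using bd that by blast
      also have "\<dots> \<le> Q * (2 powr \<bar>\<tau> + \<delta> * real j\<bar> * (max 1 \<bar>x\<bar>) powr (\<tau> + \<delta> * real j))"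
        by (intro mult_left_mono japanese_powr_le Q refl)
      also have "\<dots> \<le> Q * (D * (max 1 \<bar>x\<bar>) powr (\<tau> + \<delta> * real j))"
        by (intro mult_left_mono mult_right_mono D that Q) auto
      finally show ?thesis by (simp add: mult_ac)
    qed
    have deriv: "(F j has_vector_derivative F (Suc j) x) (at x)" for j x
      using taylor_rem_has_vector_derivative[OF smooth_nderiv[OF a, of j], of "N - j" x]
      by (simp add: F_def nderiv_nderiv)
    have bound: "cmod (of_real (x ^ j) * F j x) \<le> (D + real N) * Q * weight (real N) (\<tau> + (\<delta> + 1) * real j) (real N - 1) x"
      if j: "j \<le> L" and x: "x > 0" for j x
    proof (cases "x \<le> 1")
      case True
      have "cmod (F j x) \<le> D * Q * x ^ (N - j)"
        unfolding F_def
      proof (rule taylor_rem_bound[OF smooth_nderiv[OF a]])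
        fix t assume t: "0 \<le> t" "t \<le> x"
        \<comment> \<open>With truncated subtraction this is the maximum of N and j, the order of
          the derivative of a that controls the remainder near 0.\<close>
        have "N - j + j \<le> L" using j L by auto
        from nd[OF this, of t] show "cmod (nderiv (N - j) (nderiv j a) t) \<le> D * Q"
          using t True by (simp add: nderiv_nderiv)
      qed (use x in auto)
      hence "cmod (of_real (x ^ j) * F j x) \<le> x ^ j * (D * Q * x ^ (N - j))"
        using x by (simp add: norm_mult norm_power)
      also have "\<dots> = D * Q * x ^ (j + (N - j))" by (simp add: power_add)
      also have "\<dots> \<le> D * Q * x ^ N"
        using D0 Q x True by (intro mult_left_mono power_decreasing) auto
      also have "\<dots> \<le> (D + real N) * Q * x ^ N"
        using Q x by (intro mult_right_mono) auto
      finally show ?thesis using True x by (simp add: weight_def powr_realpow)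
    next
      case False
      hence x1: "x > 1" by simp
      let ?u = "x powr (\<tau> + (\<delta> + 1) * real j)" and ?v = "x powr (real N - 1)"
      have "cmod (F j x) \<le> cmod (nderiv j a x) + (\<Sum>k<N - j. cmod (nderiv k (nderiv j a) 0 / fact k * of_real (x ^ k)))"
        unfolding F_def taylor_rem_def
        by (rule order_trans[OF norm_triangle_ineq4 add_left_mono[OF norm_sum]])
      from mult_left_mono[OF this, of "x ^ j"]
      have "x ^ j * cmod (F j x) \<le> x ^ j * cmod (nderiv j a x) +
          (\<Sum>k<N - j. x ^ j * cmod (nderiv k (nderiv j a) 0 / fact k * of_real (x ^ k)))"
        using x by (simp only: distrib_left sum_distrib_left) simp
      also have "x ^ j * cmod (nderiv j a x) \<le> x ^ j * (D * Q * x powr (\<tau> + \<delta> * real j))"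
        using nd[OF j, of x] x x1 by (intro mult_left_mono) auto
      also have "\<dots> = D * Q * ?u"
        using x by (simp add: powr_add distrib_right powr_realpow)
      also have "(\<Sum>k<N - j. x ^ j * cmod (nderiv k (nderiv j a) 0 / fact k * of_real (x ^ k)))
          \<le> (\<Sum>k<N - j. Q * ?v)"
      proof (rule sum_mono)
        fix k assume k: "k \<in> {..<N - j}"
        have "cmod (nderiv (k + j) a 0) \<le> Q" using a0 k by auto
        moreover have "cmod (nderiv (k + j) a 0) / fact k \<le> cmod (nderiv (k + j) a 0) / 1"
          by (intro divide_left_mono) auto
        ultimately have "cmod (nderiv (k + j) a 0) / fact k \<le> Q" by simp
        moreover have "x ^ (k + j) \<le> ?v"
        proof -
          have "x ^ (k + j) = x powr real (k + j)" using x by (simp add: powr_realpow del: of_nat_add)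
          also have "\<dots> \<le> ?v" using x1 k by (intro powr_mono) auto
          finally show ?thesis .
        qed
        ultimately have "cmod (nderiv (k + j) a 0) / fact k * x ^ (k + j) \<le> Q * ?v"
          using Q x by (intro mult_mono) auto
        thus "x ^ j * cmod (nderiv k (nderiv j a) 0 / fact k * of_real (x ^ k)) \<le> Q * ?v"
          using x by (simp add: nderiv_nderiv norm_mult norm_divide norm_power power_add mult_ac)
      qed
      also have "\<dots> = real (N - j) * Q * ?v" by simp
      also have "\<dots> \<le> real N * Q * ?v" using Q by (intro mult_right_mono) auto
      finally have "x ^ j * cmod (F j x) \<le> D * Q * ?u + real N * Q * ?v" by simp
      also have "\<dots> \<le> (D + real N) * Q * ?u + (D + real N) * Q * ?v"
        using D0 Q by (intro add_mono mult_right_mono) auto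
      finally show ?thesis
        using x False by (simp add: weight_def norm_mult norm_power algebra_simps)
    qed
    have "symb (\<delta> + 1) L (real N) (\<tau> + (\<delta> + 1) * real 0) (real N - 1) ((D + real N) * Q * (real L + 1) ^ L)
        (\<lambda>x. of_real (x ^ 0) * F 0 x)"
      by (rule symb_euler[OF deriv _ bound]) (use \<delta> in auto)
    thus "symb (\<delta> + 1) L (real N) \<tau> (real N - 1) ((D + real N) * (real L + 1) ^ L * Q) (taylor_rem N a)"
      by (simp add: F_def mult_ac)
  qed (use D0 in auto)
qed

section \<open>Asymptotic expansions\<close>

text \<open>Here n is l_0 and l is l_{p,N+1}. The strict floor gives n < (N + 1) / p \<le> n + 1,
  and adding 1 to the integer part makes the inequality for l strict and l positive.\<close>

lemma norm_order_split:
  fixes p \<tau> \<delta> :: real and N :: nat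
  assumes p: "p > 0" and \<delta>: "\<delta> < p - 1"
  obtains n l where "norm_order p \<tau> \<delta> N = N + n + l" "real n < (real N + 1) / p" "(real N + 1) / p \<le> real n + 1"
    "real N + 1 + \<tau> < (p - 1 - \<delta>) * real l" "1 \<le> l"
proof -
  let ?X = "max (real N + 1 + \<tau>) 0 / (p - 1 - \<delta>)"
  define n where "n = nat (strict_floor ((real N + 1) / p))"
  define l where "l = nat (\<lfloor>?X\<rfloor> + 1)"
  have "0 < (real N + 1) / p" using p by simp
  hence "strict_floor ((real N + 1) / p) \<ge> 0" by (simp add: strict_floor_def)
  hence n: "real n = of_int \<lceil>(real N + 1) / p\<rceil> - 1" by (simp add: n_def strict_floor_def)
  have "0 \<le> ?X" using \<delta> by simp
  hence l: "real l = of_int \<lfloor>?X\<rfloor> + 1" "\<lfloor>?X\<rfloor> \<ge> 0" by (simp_all add: l_def)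
  have "?X < real l" using l by linarith
  hence "max (real N + 1 + \<tau>) 0 < (p - 1 - \<delta>) * real l"
    using \<delta> by (simp only: pos_divide_less_eq mult.commute diff_gt_0_iff_gt less_diff_eq)
  moreover have "real l \<ge> 1" using l by linarith
  moreover have "norm_order p \<tau> \<delta> N = N + n + l" by (simp add: norm_order_def n_def l_def)
  moreover have "real n < (real N + 1) / p" "(real N + 1) / p \<le> real n + 1" using n by linarith+
  ultimately show ?thesis using that by simp
qed

text \<open>This is \<open>osc_half_line\<close> for \<sigma> = \<delta> + 1, \<nu> = N, \<mu> =
  \<tau> and \<eta> = N - 1. Both constants are fixed before the amplitude, \<open>lam\<close> and
  s, so their product is uniform. For \<open>lam\<close> < 1 only existence is asserted.\<close>

lemma has_os_integral_taylor_rem: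
  assumes p: "p > 0" and \<delta>: "-1 \<le> \<delta>" "\<delta> < p - 1" and N: "N > 0"
  shows "\<exists>C\<ge>0. \<forall>a \<in> amplitude \<tau> \<delta>. \<forall>lam>0. \<forall>s\<in>{1, -1}.
    \<exists>I. has_os_integral {0<..} (\<lambda>x. s * lam * x powr p) (taylor_rem N a) I \<and>
      (1 \<le> lam \<longrightarrow> cmod I \<le> C * bound_norm p \<tau> \<delta> N a * lam powr (- (real N - p + 1) / p))"
proof -
  obtain n l where ord: "norm_order p \<tau> \<delta> N = N + n + l" "real n < (real N + 1) / p"
    "(real N + 1) / p \<le> real n + 1" "real N + 1 + \<tau> < (p - 1 - \<delta>) * real l" "1 \<le> l"
    by (rule norm_order_split[OF p \<delta>(2)])
  define L where "L = norm_order p \<tau> \<delta> N"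
  have L: "N \<le> L" "n + l \<le> L" by (simp_all add: L_def ord(1))
  have pn: "p * real n < real N + 1" "real N + 1 \<le> p * real n + p"
    using ord(2,3) p by (simp_all add: field_simps)
  have "p * 1 \<le> p * real l" using p ord(5) by (intro mult_left_mono) auto
  hence pl: "p \<le> p * real l" by simp
  \<comment> \<open>The first n steps can only help at infinity: l alone brings \<tau> below -1. For
    the polynomial part one step beyond n suffices, as p (n + 1) \<ge> N + 1; this is where l \<ge>
    1 is needed.\<close>
  have "0 \<le> (p - 1 - \<delta>) * real n" using \<delta> by simp
  hence 2: "\<tau> + (\<delta> + 1 - p) * real (n + l) < -1" using ord(4) by (simp add: algebra_simps)
  have 3: "real N - 1 - p * real (n + l) < -1"
    unfolding of_nat_add distrib_left using pn(2) pl by linarith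
  have 1: "real N - p * real n > -1" using pn by simp
  obtain C1 where C1: "C1 \<ge> 0" "\<forall>\<beta> b M. Re \<beta> = 0 \<longrightarrow> \<beta> \<noteq> 0 \<longrightarrow>
      symb (\<delta> + 1) (n + l) (real N) \<tau> (real N - 1) M b \<longrightarrow>
      (\<exists>I. osc {0<..} \<beta> p (n + l) b I \<and> (1 \<le> cmod \<beta> \<longrightarrow> cmod I \<le> C1 * M / cmod \<beta> ^ n))"
    using osc_half_line[OF _ _ 1 2 3] \<delta> by auto
  obtain C2 where C2: "C2 \<ge> 0" "\<forall>a Q. smooth a \<longrightarrow> 0 \<le> Q \<longrightarrow> (\<forall>k<N. cmod (nderiv k a 0) \<le> Q) \<longrightarrow>
     (\<forall>k\<le>L. \<forall>x. cmod (nderiv k a x) \<le> Q * japanese x powr (\<tau> + \<delta> * real k)) \<longrightarrow>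
     symb (\<delta> + 1) L (real N) \<tau> (real N - 1) (C2 * Q) (taylor_rem N a)"
    using symb_taylor_rem[OF \<delta>(1) N L(1), of \<tau>] by (elim exE conjE)
  show ?thesis
  proof (intro exI[of _ "C1 * C2"] conjI ballI allI impI)
    show "0 \<le> C1 * C2" using C1 C2 by simp
    fix a lam s assume a: "a \<in> amplitude \<tau> \<delta>" and lam: "lam > (0::real)" and s: "s \<in> {1, -1 :: real}"
    let ?Q = "bound_norm p \<tau> \<delta> N a"
    have sm: "smooth a" using a by (simp add: amplitude_def)
    have "symb (\<delta> + 1) L (real N) \<tau> (real N - 1) (C2 * ?Q) (taylor_rem N a)"
      using C2(2)[rule_format, OF sm bound_norm_bounds(1)[OF a N]] bound_norm_bounds(2,3)[OF a N]
      unfolding L_def by blast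
    hence S: "symb (\<delta> + 1) (n + l) (real N) \<tau> (real N - 1) (C2 * ?Q) (taylor_rem N a)"
      using L(2) by (rule symb_le)
    let ?\<beta> = "\<i> * of_real (s * lam)"
    have \<beta>: "Re ?\<beta> = 0" "?\<beta> \<noteq> 0" "cmod ?\<beta> = lam" using s lam by (auto simp: norm_mult)
    from C1(2)[rule_format, OF \<beta>(1,2) S] obtain I where
      I: "osc {0<..} ?\<beta> p (n + l) (taylor_rem N a) I" "1 \<le> lam \<longrightarrow> cmod I \<le> C1 * (C2 * ?Q) / lam ^ n"
      unfolding \<beta>(3) by blast
    have "cmod I \<le> C1 * C2 * ?Q * lam powr (- (real N - p + 1) / p)" if "1 \<le> lam"
    proof -
      have "- real n \<le> - (real N - p + 1) / p" using ord(3) p by (simp add: field_simps)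
      hence "lam powr (- real n) \<le> lam powr (- (real N - p + 1) / p)" using that by (intro powr_mono) auto
      hence "C1 * C2 * ?Q * lam powr (- real n) \<le> C1 * C2 * ?Q * lam powr (- (real N - p + 1) / p)"
        using C1 C2 bound_norm_bounds(1)[OF a N, of p] by (intro mult_left_mono) auto
      moreover have "C1 * (C2 * ?Q) / lam ^ n = C1 * C2 * ?Q * lam powr (- real n)"
        using lam by (simp add: powr_minus powr_realpow divide_inverse)
      ultimately show ?thesis using I(2) that by linarith
    qed
    thus "\<exists>I. has_os_integral {0<..} (\<lambda>x. s * lam * x powr p) (taylor_rem N a) I \<and>
      (1 \<le> lam \<longrightarrow> cmod I \<le> C1 * C2 * ?Q * lam powr (- (real N - p + 1) / p))"
      using osc_imp_has_os_integral[OF I(1)] by blast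
  qed
qed

lemma has_os_integral_expansion:
  assumes p: "p > 0" and s: "s \<in> {1, -1}" and lam: "lam > 0"
    and r: "has_os_integral {0<..} (\<lambda>x. s * lam * x powr p) (taylor_rem N a) I"
  shows "has_os_integral {0<..} (\<lambda>x. s * lam * x powr p) a ((\<Sum>k<N. half_line_term s p a lam k) + I)"
proof -
  have "has_os_integral {0<..} (\<lambda>x. s * lam * x powr p)
      (\<lambda>x. (\<Sum>k<N. (nderiv k a 0 / fact k) * of_real (x powr real k)) + taylor_rem N a x)
      ((\<Sum>k<N. (nderiv k a 0 / fact k) * (fresnel_value s p k * of_real (lam powr (- (real k + 1) / p)))) + I)"
    by (intro has_os_integral_add has_os_integral_sum has_os_integral_cmult has_os_integral_powr assms) auto
  moreover have "(\<Sum>k<N. (nderiv k a 0 / fact k) * (fresnel_value s p k * of_real (lam powr (- (real k + 1) / p))))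
      = (\<Sum>k<N. half_line_term s p a lam k)"
    unfolding half_line_term_def fresnel_eq(2)[OF p s] by (intro sum.cong refl) (simp add: mult_ac)
  ultimately show ?thesis
    by (subst (asm) has_os_integral_cong[where c = a and \<psi> = "\<lambda>x. s * lam * x powr p"])
       (auto simp: taylor_rem_def powr_realpow)
qed

lemma sum_split_tail:
  fixes f :: "nat \<Rightarrow> complex"
  assumes "j < N"
  shows "(\<Sum>k<N. f k) = (\<Sum>k = 0..N - j - 1. f k) + (\<Sum>k\<in>{N - j..<N}. f k)"
proof -
  have eq: "{..<N} = {0..N - j - 1} \<union> {N - j..<N}" using assms by auto
  show ?thesis unfolding eq by (rule sum.union_disjoint) (use assms in auto)
qed

text \<open>A term with k \<ge> N - [p] \<ge> N - p satisfies (k + 1) / p \<ge> (N - p + 1) / p, so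
  for \<lambda> \<ge> 1 it is no larger than the bound for the remainder integral; this is why these
  terms are counted to the remainder.\<close>

lemma half_line_rem_bound:
  assumes p: "p > 0" and \<delta>: "-1 \<le> \<delta>" "\<delta> < p - 1" and N: "real N \<ge> p + 1"
  shows "\<exists>C>0. \<forall>a \<in> amplitude \<tau> \<delta>. \<forall>lam\<ge>1. \<forall>s\<in>{1, -1}.
    cmod (half_line_rem s p N a lam) \<le> C * bound_norm p \<tau> \<delta> N a * lam powr (- (real N - p + 1) / p)"
proof -
  have N0: "N > 0" using N p by (cases N) auto
  obtain C where C: "C \<ge> 0" "\<forall>a \<in> amplitude \<tau> \<delta>. \<forall>lam>0. \<forall>s\<in>{1, -1}.
    \<exists>I. has_os_integral {0<..} (\<lambda>x. s * lam * x powr p) (taylor_rem N a) I \<and>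
      (1 \<le> lam \<longrightarrow> cmod I \<le> C * bound_norm p \<tau> \<delta> N a * lam powr (- (real N - p + 1) / p))"
    using has_os_integral_taylor_rem[OF p \<delta> N0, of \<tau>] by (elim exE conjE)
  \<comment> \<open>Summing over both signs and all k < N makes the constant independent of s; the
    later summand 1 only ensures positivity.\<close>
  define D where "D = (\<Sum>k<N. cmod (fresnel_value 1 p k) + cmod (fresnel_value (-1) p k))"
  have D: "D \<ge> 0" unfolding D_def by (intro sum_nonneg) auto
  show ?thesis
  proof (intro exI[of _ "D + C + 1"] conjI ballI allI impI)
    show "D + C + 1 > 0" using C D by simp
    fix a lam s assume a: "a \<in> amplitude \<tau> \<delta>" and lam: "lam \<ge> (1::real)" and s: "s \<in> {1, -1 :: real}"
    let ?Q = "bound_norm p \<tau> \<delta> N a" and ?w = "lam powr (- (real N - p + 1) / p)"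
    have Q: "?Q \<ge> 0" by (rule bound_norm_bounds(1)[OF a N0])
    have "0 < lam" using lam by simp
    with C(2) a s obtain I where I: "has_os_integral {0<..} (\<lambda>x. s * lam * x powr p) (taylor_rem N a) I"
      "cmod I \<le> C * ?Q * ?w" using lam by blast
    let ?T = "{N - nat \<lfloor>p\<rfloor>..<N}"
    have "cmod (half_line_term s p a lam k) \<le> (cmod (fresnel_value 1 p k) + cmod (fresnel_value (-1) p k)) * (?Q * ?w)"
      if k: "k \<in> ?T" for k
    proof -
      have "real (N - nat \<lfloor>p\<rfloor>) \<ge> real N - p" using p by linarith
      with k have "real k \<ge> real N - p" by auto
      hence "- (real k + 1) / p \<le> - (real N - p + 1) / p" using p by (intro divide_right_mono) auto
      hence w: "lam powr (- (real k + 1) / p) \<le> ?w" using lam by (intro powr_mono) auto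
      have "cmod (nderiv k a 0) / fact k \<le> cmod (nderiv k a 0) / 1" by (intro divide_left_mono) auto
      also have "\<dots> \<le> ?Q" using bound_norm_bounds(2)[OF a N0, of k] k by simp
      finally have d: "cmod (nderiv k a 0) / fact k \<le> ?Q" .
      have "cmod (half_line_term s p a lam k) =
          cmod (fresnel_value s p k) * (cmod (nderiv k a 0) / fact k * lam powr (- (real k + 1) / p))"
        unfolding half_line_term_def fresnel_eq(2)[OF p s] by (simp add: norm_mult norm_divide)
      also have "\<dots> \<le> (cmod (fresnel_value 1 p k) + cmod (fresnel_value (-1) p k)) * (?Q * ?w)"
        using s Q w d by (intro mult_mono) auto
      finally show ?thesis .
    qed
    hence "cmod (\<Sum>k\<in>?T. half_line_term s p a lam k) \<le>
        (\<Sum>k\<in>?T. (cmod (fresnel_value 1 p k) + cmod (fresnel_value (-1) p k)) * (?Q * ?w))"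
      by (rule sum_norm_le)
    also have "\<dots> \<le> (\<Sum>k<N. (cmod (fresnel_value 1 p k) + cmod (fresnel_value (-1) p k)) * (?Q * ?w))"
      using Q by (intro sum_mono2) auto
    also have "\<dots> = D * (?Q * ?w)" unfolding D_def by (rule sum_distrib_right[symmetric])
    finally have "cmod (half_line_rem s p N a lam) \<le> D * (?Q * ?w) + C * ?Q * ?w"
      unfolding half_line_rem_def os_integral_eq[OF I(1)] using I(2) by (intro norm_triangle_mono)
    also have "\<dots> \<le> (D + C + 1) * ?Q * ?w" using Q by (simp add: algebra_simps)
    finally show "cmod (half_line_rem s p N a lam) \<le> (D + C + 1) * ?Q * ?w" .
  qed
qed

section \<open>From the half line to the line\<close>

lemma set_integral_reflect_negative:
  fixes f :: "real \<Rightarrow> complex"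
  shows "set_integrable lborel {..<0} f \<longleftrightarrow> set_integrable lborel {0<..} (\<lambda>x. f (- x))"
    and "(LINT x:{..<0}|lborel. f x) = (LINT x:{0<..}|lborel. f (- x))"
proof -
  have "(\<lambda>x. indicator {..<0} (0 + (-1) * x) *\<^sub>R f (0 + (-1) * x)) = (\<lambda>x. indicator {0<..} x *\<^sub>R f (- x))"
    by (auto simp: indicator_def)
  thus "set_integrable lborel {..<0} f \<longleftrightarrow> set_integrable lborel {0<..} (\<lambda>x. f (- x))"
    using lborel_integrable_real_affine_iff[of "-1" "\<lambda>x. indicator {..<0} x *\<^sub>R f x" 0]
    unfolding set_integrable_def by simp
  have "{x::real. - x \<in> {..<0}} = {0<..}" by auto
  thus "(LINT x:{..<0}|lborel. f x) = (LINT x:{0<..}|lborel. f (- x))"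
    using set_integral_reflect[of "{..<0}" f] by simp
qed

lemma set_integral_split_at_0:
  fixes f :: "real \<Rightarrow> complex"
  assumes "set_integrable lborel {0<..} f" "set_integrable lborel {0<..} (\<lambda>x. f (- x))"
  shows "set_integrable lborel UNIV f"
    and "(LINT x:UNIV|lborel. f x) = (LINT x:{0<..}|lborel. f x) + (LINT x:{0<..}|lborel. f (- x))"
proof -
  have neg: "set_integrable lborel {..<0} f"
    using assms(2) by (simp add: set_integral_reflect_negative)
  have U: "set_integrable lborel ({0<..} \<union> {..<0}) f"
    by (intro set_integrable_Un assms(1) neg) auto
  thus "set_integrable lborel UNIV f"
    by (subst set_integrable_discrete_difference[where X = "{0}" and B = "{0<..} \<union> {..<0}"]) auto
  have "(LINT x:UNIV|lborel. f x) = (LINT x:({0<..} \<union> {..<0})|lborel. f x)"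
    by (rule set_integral_discrete_difference[where X = "{0}"]) auto
  also have "\<dots> = (LINT x:{0<..}|lborel. f x) + (LINT x:{..<0}|lborel. f x)"
    by (rule set_integral_Un) (use assms(1) neg in auto)
  finally show "(LINT x:UNIV|lborel. f x) = (LINT x:{0<..}|lborel. f x) + (LINT x:{0<..}|lborel. f (- x))"
    by (simp add: set_integral_reflect_negative)
qed

text \<open>On the negative half line x \<mapsto> -x turns c x^m into c (-1)^m x^m, and h into its
  reflection, again a Schwartz function with value 1 at 0. The two half lines thus use different
  regularizing functions, which the quantification over all h permits.\<close>

lemma has_os_integral_line:
  assumes m: "m > 0"
    and pos: "has_os_integral {0<..} (\<lambda>x. c * x powr real m) b I"
    and neg: "has_os_integral {0<..} (\<lambda>x. c * (-1) ^ m * x powr real m) (\<lambda>x. b (- x)) I'"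
  shows "has_os_integral UNIV (\<lambda>x. c * x ^ m) b (I + I')"
  unfolding has_os_integral_def
proof (intro allI impI)
  fix h assume h: "schwartz h \<and> h 0 = 1"
  hence h': "schwartz (\<lambda>x. h (- x)) \<and> h (- 0) = 1" using schwartz_reflect by auto
  let ?f = "\<lambda>\<epsilon> x. exp (\<i> * of_real (c * x ^ m)) * b x * h (\<epsilon> * x)"
  have pos': "has_os_integral {0<..} (\<lambda>x. c * x ^ m) b I"
    using pos by (subst has_os_integral_cong[where c = b and \<psi> = "\<lambda>x. c * x powr real m"])
       (auto simp: powr_realpow)
  have neg': "has_os_integral {0<..} (\<lambda>x. c * (- x) ^ m) (\<lambda>x. b (- x)) I'"
  proof -
    have e: "c * (- x) ^ m = c * (-1) ^ m * x powr real m" if "x \<in> {0<..}" for x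
      by (subst power_minus) (use that in \<open>simp add: powr_realpow\<close>)
    show ?thesis
      by (rule iffD2[OF has_os_integral_cong[OF refl e] neg]) simp_all
  qed
  note P = pos'[unfolded has_os_integral_def, rule_format, OF h]
  note Ng = neg'[unfolded has_os_integral_def, rule_format, OF h', unfolded mult_minus_right[symmetric]]
  have 1: "set_integrable lborel {0<..} (?f \<epsilon>)" "set_integrable lborel {0<..} (\<lambda>x. ?f \<epsilon> (- x))"
    if "0 < \<epsilon>" "\<epsilon> < 1" for \<epsilon>
    using P Ng that by blast+
  have "\<forall>\<^sub>F \<epsilon> in at_right 0. \<epsilon> \<in> {0<..<1::real}"
    by (rule eventually_at_right_real) simp
  hence "\<forall>\<^sub>F \<epsilon> in at_right 0. (LINT x:{0<..}|lborel. ?f \<epsilon> x) + (LINT x:{0<..}|lborel. ?f \<epsilon> (- x)) =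
      (LINT x:UNIV|lborel. ?f \<epsilon> x)"
    by eventually_elim (use set_integral_split_at_0(2)[OF 1] in auto)
  hence "((\<lambda>\<epsilon>. LINT x:UNIV|lborel. ?f \<epsilon> x) \<longlongrightarrow> I + I') (at_right 0)"
    by (rule Lim_transform_eventually[rotated]) (intro tendsto_add conjunct2[OF P] conjunct2[OF Ng])
  thus "(\<forall>\<epsilon>. 0 < \<epsilon> \<and> \<epsilon> < 1 \<longrightarrow> set_integrable lborel UNIV (?f \<epsilon>)) \<and>
      ((\<lambda>\<epsilon>. LINT x:UNIV|lborel. ?f \<epsilon> x) \<longlongrightarrow> I + I') (at_right 0)"
    using set_integral_split_at_0(1)[OF 1] by blast
qed

lemma amplitude_reflect:
  assumes "a \<in> amplitude \<tau> \<delta>"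
  shows "(\<lambda>x. a (- x)) \<in> amplitude \<tau> \<delta>"
proof -
  have s: "smooth a" using assms by (simp add: amplitude_def)
  have j: "japanese (- x) = japanese x" for x by (simp add: japanese_def)
  have "\<exists>C>0. \<forall>x. cmod (nderiv k a (- x)) \<le> C * japanese x powr (\<tau> + \<delta> * real k)" for k
  proof -
    obtain C where "C > 0" "\<forall>x. cmod (nderiv k a x) \<le> C * japanese x powr (\<tau> + \<delta> * real k)"
      using assms unfolding amplitude_def by blast
    thus ?thesis using j by metis
  qed
  thus ?thesis
    using smooth_reflect[OF s] by (simp add: amplitude_def nderiv_reflect[OF s] norm_mult norm_power)
qed

lemma bound_norm_reflect:
  assumes "a \<in> amplitude \<tau> \<delta>"
  shows "bound_norm p \<tau> \<delta> N (\<lambda>x. a (- x)) = bound_norm p \<tau> \<delta> N a"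
proof -
  have s: "smooth a" using assms by (simp add: amplitude_def)
  have 1: "cmod (nderiv k (\<lambda>x. a (- x)) x) = cmod (nderiv k a (- x))" for k x
    by (simp add: nderiv_reflect[OF s] norm_mult norm_power)
  have "(SUP x. japanese x powr e * cmod (nderiv k a (- x))) = (SUP x. japanese x powr e * cmod (nderiv k a x))"
    for e k
  proof -
    have "range (\<lambda>x. japanese x powr e * cmod (nderiv k a (- x))) =
        (\<lambda>x. japanese x powr e * cmod (nderiv k a x)) ` range uminus"
      unfolding image_image by (simp add: japanese_def)
    thus ?thesis by simp
  qed
  thus ?thesis by (simp add: bound_norm_def amp_norm_def 1)
qed

lemma taylor_rem_reflect:
  assumes "smooth a"
  shows "taylor_rem N (\<lambda>x. a (- x)) = (\<lambda>x. taylor_rem N a (- x))"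
proof
  fix x
  have "of_real ((- x) ^ k) = (-1) ^ k * complex_of_real (x ^ k)" for k
    by (subst power_minus) simp
  thus "taylor_rem N (\<lambda>x. a (- x)) x = taylor_rem N a (- x)"
    unfolding taylor_rem_def nderiv_reflect[OF assms]
    by (intro arg_cong2[where f = "(-)"] sum.cong refl) (simp_all del: of_real_power)
qed

text \<open>The sign (-1)^k in the coefficient comes from the k-th derivative of the reflected
  amplitude at 0, the sign (-1)^m in the exponent from the reflected phase.\<close>

lemma line_term_eq:
  assumes m: "m > 0" and s: "s \<in> {1, -1}" and a: "smooth a"
  shows "line_term s m a lam k =
    half_line_term s (real m) a lam k + half_line_term (s * (-1) ^ m) (real m) (\<lambda>x. a (- x)) lam k"
proof -
  have s': "s * (-1) ^ m \<in> {1, -1}" using s by (cases "even m") auto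
  have m': "real m > 0" using m by simp
  have c: "line_coeff s m k = fresnel_value s (real m) k + (-1) ^ k * fresnel_value (s * (-1) ^ m) (real m) k"
    unfolding line_coeff_def fresnel_value_def by (simp add: algebra_simps)
  show ?thesis
    unfolding line_term_def half_line_term_def fresnel_eq(2)[OF m' s] fresnel_eq(2)[OF m' s'] c nderiv_reflect[OF a]
    by (simp add: algebra_simps)
qed

text \<open>The finite sums in the three remainders run over the same indices, because the integer
  part of \<open>real m\<close> is m.\<close>

lemma line_rem_eq:
  assumes m: "m > 0" and s: "s \<in> {1, -1}" and a: "smooth a"
    and I: "has_os_integral {0<..} (\<lambda>x. s * lam * x powr real m) (taylor_rem N a) I"
    and I': "has_os_integral {0<..} (\<lambda>x. s * (-1) ^ m * lam * x powr real m) (taylor_rem N (\<lambda>x. a (- x))) I'"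
  shows "has_os_integral UNIV (\<lambda>x. s * lam * x ^ m) (taylor_rem N a) (I + I')"
    and "line_rem s m N a lam =
      half_line_rem s (real m) N a lam + half_line_rem (s * (-1) ^ m) (real m) N (\<lambda>x. a (- x)) lam"
proof -
  show *: "has_os_integral UNIV (\<lambda>x. s * lam * x ^ m) (taylor_rem N a) (I + I')"
    using I' by (intro has_os_integral_line[OF m I]) (simp add: taylor_rem_reflect[OF a] mult_ac)
  show "line_rem s m N a lam =
      half_line_rem s (real m) N a lam + half_line_rem (s * (-1) ^ m) (real m) N (\<lambda>x. a (- x)) lam"
    unfolding line_rem_def half_line_rem_def os_integral_eq[OF *] os_integral_eq[OF I] os_integral_eq[OF I']
    by (simp add: line_term_eq[OF m s a] sum.distrib)
qed

theorem theorem5p2: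
  fixes p \<tau> \<delta> :: real
  assumes "p > 0" and "-1 \<le> \<delta>" and "\<delta> < p - 1"
  shows
    "(\<forall>N::nat. real N \<ge> p + 1 \<longrightarrow>
        (\<forall>a \<in> amplitude \<tau> \<delta>. \<forall>lam>0. \<forall>s\<in>{1, -1}.
           os_integrable {0<..} (\<lambda>x. s * lam * x powr p) a \<and>
           os_integrable {0<..} (\<lambda>x. s * lam * x powr p) (taylor_rem N a) \<and>
           (\<forall>k<N. fresnel_exists s p (real k + 1)) \<and>
           os_integral {0<..} (\<lambda>x. s * lam * x powr p) a =
             (\<Sum>k = 0..N - nat \<lfloor>p\<rfloor> - 1. half_line_term s p a lam k) + half_line_rem s p N a lam) \<and>
        (\<exists>C>0. \<forall>a \<in> amplitude \<tau> \<delta>. \<forall>lam\<ge>1. \<forall>s\<in>{1, -1}.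
           cmod (half_line_rem s p N a lam)
             \<le> C * bound_norm p \<tau> \<delta> N a * lam powr (- (real N - p + 1) / p)))
     \<and>
     (\<forall>m::nat. p = real m \<longrightarrow> (\<forall>N::nat. N > m \<longrightarrow>
        (\<forall>a \<in> amplitude \<tau> \<delta>. \<forall>lam>0. \<forall>s\<in>{1, -1}.
           os_integrable UNIV (\<lambda>x. s * lam * x ^ m) a \<and>
           os_integrable UNIV (\<lambda>x. s * lam * x ^ m) (taylor_rem N a) \<and>
           os_integral UNIV (\<lambda>x. s * lam * x ^ m) a =
             (\<Sum>k = 0..N - m - 1. line_term s m a lam k) + line_rem s m N a lam) \<and>
        (\<exists>C>0. \<forall>a \<in> amplitude \<tau> \<delta>. \<forall>lam\<ge>1. \<forall>s\<in>{1, -1}.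
           cmod (line_rem s m N a lam)
             \<le> C * bound_norm (real m) \<tau> \<delta> N a * lam powr (- (real N - real m + 1) / real m))))"
proof (intro conjI allI impI ballI)
  fix N :: nat and a lam s and k
  assume N: "real N \<ge> p + 1" and a: "a \<in> amplitude \<tau> \<delta>" and lam: "lam > (0::real)" and s: "s \<in> {1, -1 :: real}"
  have N0: "N > 0" using N assms(1) by (cases N) auto
  obtain I where I: "has_os_integral {0<..} (\<lambda>x. s * lam * x powr p) (taylor_rem N a) I"
    using has_os_integral_taylor_rem[OF assms N0, of \<tau>] a lam s by blast
  note J = has_os_integral_expansion[OF assms(1) s lam I]
  show "os_integrable {0<..} (\<lambda>x. s * lam * x powr p) a"
    "os_integrable {0<..} (\<lambda>x. s * lam * x powr p) (taylor_rem N a)"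
    using I J unfolding os_integrable_def by blast+
  show "fresnel_exists s p (real k + 1)"
    by (rule fresnel_eq(1)[OF assms(1) s])
  \<comment> \<open>Hence N - [p] - 1 is not truncated, and the inclusive sum together with the tail
    starting at N - [p] covers each k < N exactly once.\<close>
  have "nat \<lfloor>p\<rfloor> < N" using N assms(1) by linarith
  thus "os_integral {0<..} (\<lambda>x. s * lam * x powr p) a =
      (\<Sum>k = 0..N - nat \<lfloor>p\<rfloor> - 1. half_line_term s p a lam k) + half_line_rem s p N a lam"
    unfolding os_integral_eq[OF J] half_line_rem_def os_integral_eq[OF I]
    by (simp add: sum_split_tail add.assoc)
next
  fix N :: nat assume "real N \<ge> p + 1"
  thus "\<exists>C>0. \<forall>a \<in> amplitude \<tau> \<delta>. \<forall>lam\<ge>1. \<forall>s\<in>{1, -1}. cmod (half_line_rem s p N a lam)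
      \<le> C * bound_norm p \<tau> \<delta> N a * lam powr (- (real N - p + 1) / p)"
    by (rule half_line_rem_bound[OF assms])
next
  fix m N :: nat and a lam s
  assume p: "p = real m" and N: "N > m" and a: "a \<in> amplitude \<tau> \<delta>" and lam: "lam > (0::real)" and s: "s \<in> {1, -1 :: real}"
  let ?a = "\<lambda>x. a (- x)" and ?s = "s * (-1) ^ m"
  have m: "m > 0" using p assms(1) by simp
  have N0: "N > 0" using N by simp
  have sm: "smooth a" using a by (simp add: amplitude_def)
  have s': "?s \<in> {1, -1}" using s by (cases "even m") auto
  obtain I where I: "has_os_integral {0<..} (\<lambda>x. s * lam * x powr real m) (taylor_rem N a) I"
    using has_os_integral_taylor_rem[OF assms N0, of \<tau>] a lam s unfolding p by blast
  obtain I' where I': "has_os_integral {0<..} (\<lambda>x. ?s * lam * x powr real m) (taylor_rem N ?a) I'"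
    using has_os_integral_taylor_rem[OF assms N0, of \<tau>] amplitude_reflect[OF a] lam s' unfolding p by blast
  note R = line_rem_eq(1)[OF m s sm I I']
  note J = has_os_integral_expansion[OF assms(1)[unfolded p] s lam I]
  note J' = has_os_integral_expansion[OF assms(1)[unfolded p] s' lam I']
  have L: "has_os_integral UNIV (\<lambda>x. s * lam * x ^ m) a
      (((\<Sum>k<N. half_line_term s (real m) a lam k) + I) + ((\<Sum>k<N. half_line_term ?s (real m) ?a lam k) + I'))"
    using J' by (intro has_os_integral_line[OF m J]) (simp add: mult_ac)
  show "os_integrable UNIV (\<lambda>x. s * lam * x ^ m) a" "os_integrable UNIV (\<lambda>x. s * lam * x ^ m) (taylor_rem N a)"
    using L R unfolding os_integrable_def by blast+
  have "((\<Sum>k<N. half_line_term s (real m) a lam k) + I) + ((\<Sum>k<N. half_line_term ?s (real m) ?a lam k) + I')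
      = (\<Sum>k<N. line_term s m a lam k) + (I + I')"
    by (simp add: line_term_eq[OF m s sm] sum.distrib)
  thus "os_integral UNIV (\<lambda>x. s * lam * x ^ m) a =
      (\<Sum>k = 0..N - m - 1. line_term s m a lam k) + line_rem s m N a lam"
    unfolding os_integral_eq[OF L] line_rem_def os_integral_eq[OF R]
    by (simp only: sum_split_tail[OF N] add.assoc)
next
  fix m N :: nat
  assume p: "p = real m" and N: "N > m"
  have m: "m > 0" using p assms(1) by simp
  have N0: "N > 0" using N by simp
  have "real N \<ge> p + 1" using N p by simp
  from half_line_rem_bound[OF assms this, of \<tau>] obtain C where C: "C > 0"
    "\<forall>a \<in> amplitude \<tau> \<delta>. \<forall>lam\<ge>1. \<forall>s\<in>{1, -1}. cmod (half_line_rem s (real m) N a lam)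
      \<le> C * bound_norm (real m) \<tau> \<delta> N a * lam powr (- (real N - real m + 1) / real m)"
    unfolding p by (elim exE conjE)
  \<comment> \<open>The half-line bound is used for both a and its reflection, with signs s and s
    (-1)^m; the reflection leaves \<open>bound_norm\<close> unchanged, hence the factor 2.\<close>
  have "cmod (line_rem s m N a lam) \<le> 2 * C * bound_norm (real m) \<tau> \<delta> N a * lam powr (- (real N - real m + 1) / real m)"
    if a: "a \<in> amplitude \<tau> \<delta>" and lam: "lam \<ge> 1" and s: "s \<in> {1, -1}" for a lam s
  proof -
    let ?a = "\<lambda>x. a (- x)" and ?s = "s * (-1) ^ m"
    have sm: "smooth a" using a by (simp add: amplitude_def)
    have s': "?s \<in> {1, -1}" using s by (cases "even m") auto
    have lam0: "lam > 0" using lam by simp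
    note a' = amplitude_reflect[OF a]
    obtain I where I: "has_os_integral {0<..} (\<lambda>x. s * lam * x powr real m) (taylor_rem N a) I"
      using has_os_integral_taylor_rem[OF assms N0, of \<tau>] a lam0 s unfolding p by blast
    obtain I' where I': "has_os_integral {0<..} (\<lambda>x. ?s * lam * x powr real m) (taylor_rem N ?a) I'"
      using has_os_integral_taylor_rem[OF assms N0, of \<tau>] a' lam0 s' unfolding p by blast
    show ?thesis
      unfolding line_rem_eq(2)[OF m s sm I I']
      using norm_triangle_mono[OF C(2)[rule_format, OF a lam s] C(2)[rule_format, OF a' lam s']]
      unfolding bound_norm_reflect[OF a] by simp
  qed
  thus "\<exists>C>0. \<forall>a \<in> amplitude \<tau> \<delta>. \<forall>lam\<ge>1. \<forall>s\<in>{1, -1}. cmod (line_rem s m N a lam)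
      \<le> C * bound_norm (real m) \<tau> \<delta> N a * lam powr (- (real N - real m + 1) / real m)"
    using C(1) by (intro exI[of _ "2 * C"]) auto
qed

end
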